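(* Let $z(\hbar_{\mathrm{ren}})=z_{\varphi_c\psi_c\bar\psi_c}(\hbar_{\mathrm{ren}})$ be the vertex renormalization constant of zero-dimensional QED. There are real numbers $c_0,c_1,\dots$ such that for every $R\ge0$, as $n\to\infty$, $$[\hbar_{\mathrm{ren}}^n]\big(1-z(\hbar_{\mathrm{ren}})\big)=\frac{e^{-\frac52}}{\pi}\sum_{k=0}^{R-1}c_k\left(\tfrac12\right)^{-n-2+k}\Gamma(n+2-k)+\mathcal{O}\left(\left(\tfrac12\right)^{-n}\Gamma(n+2-R)\right),$$ with $c_0=1$, $c_1=-\frac{13}{2}$, $c_2=-\frac{67}{8}$, $c_3=-\frac{5177}{48}$; equivalently, $$[\hbar_{\mathrm{ren}}^n](1-z)\sim\frac{e^{-\frac52}}{\pi}\left(\tfrac12\right)^{-n-2}\Gamma(n+2)\left(1-\tfrac12\tfrac{13}{2}\tfrac1{n+1}-\left(\tfrac12\right)^2\tfrac{67}{8}\tfrac1{n(n+1)}-\left(\tfrac12\right)^3\tfrac{5177}{48}\tfrac{1}{(n-1)n(n+1)}+\cdots\right).$$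
   Context: The partition function of zero-dimensional QED is the formal perturbative expansion of $\int\frac{dx}{\sqrt{2\pi\hbar}}e^{\frac1\hbar\left(-\frac{x^2}{2}+jx+\frac{|\eta|^2}{1-x}+\frac12\hbar\log\frac{1}{1-x^2}\right)}$. Concretely, for a power series $f(x)$ put $\langle f\rangle:=\sum_{n\ge0}\hbar^n(2n-1)!!\,[x^{2n}]\frac{f(x)}{\sqrt{1-x^2}}$. Then at $j=\eta=0$: $Z=\langle1\rangle$, $\partial_jZ=0$, $\partial_j^2Z=\hbar^{-2}\langle x^2\rangle$, $\partial_\eta\partial_{\bar\eta}Z=\hbar^{-1}\langle\frac1{1-x}\rangle$, $\partial_j\partial_\eta\partial_{\bar\eta}Z=\hbar^{-2}\langle\frac{x}{1-x}\rangle$. The free energy $W=\hbar\log Z$ has, at $j=\eta=0$, $W_{jj}=\hbar\frac{\partial_j^2Z}{Z}$, $W_{\eta\bar\eta}=\hbar\frac{\partial_\eta\partial_{\bar\eta}Z}{Z}$, $W_{j\eta\bar\eta}=\hbar\frac{\partial_j\partial_\eta\partial_{\bar\eta}Z}{Z}$. The effective action $G(\hbar,\varphi_c,\psi_c)$ (Legendre transform of $W$ in $j,\eta$) has, at $\varphi_c=\psi_c=0$, $G_{\varphi\varphi}=-\frac{1}{W_{jj}}$, $G_{\psi\bar\psi}=-\frac1{W_{\eta\bar\eta}}$, $G_{\varphi\psi\bar\psi}=\frac{W_{j\eta\bar\eta}}{W_{jj}(W_{\eta\bar\eta})^2}$, all power series in $\hbar$. Renormalization: the squared invariant charge is $\alpha(\hbar)=\left(\frac{G_{\varphi\psi\bar\psi}}{(-G_{\varphi\varphi})^{1/2}(-G_{\psi\bar\psi})}\right)^2$;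 $\hbar(\hbar_{\mathrm{ren}})=\hbar_{\mathrm{ren}}+\cdots$ is the unique power series with $\hbar_{\mathrm{ren}}=\hbar(\hbar_{\mathrm{ren}})\,\alpha(\hbar(\hbar_{\mathrm{ren}}))$; and $z_{\varphi_c\psi_c\bar\psi_c}(\hbar_{\mathrm{ren}})=1/G_{\varphi\psi\bar\psi}(\hbar(\hbar_{\mathrm{ren}}))=1-\hbar_{\mathrm{ren}}-\hbar_{\mathrm{ren}}^2-13\hbar_{\mathrm{ren}}^3-\cdots$. *)

theory Defs
  imports
    "HOL-Analysis.Analysis"
    "HOL-Computational_Algebra.Computational_Algebra"
    "HOL-Library.Landau_Symbols"
begin

unbundle no vec_syntax
unbundle fps_syntax

text \<open>
  Power series and Laurent series in \<open>\<hbar>\<close> are real formal series whose variable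
  (\<^const>\<open>fps_X\<close>, \<^const>\<open>fls_X\<close>) stands for \<open>\<hbar>\<close>, or for \<open>\<hbar>\<^sub>r\<^sub>e\<^sub>n\<close> in \<open>hbar_of_ren\<close> and
  \<open>z_vertex\<close>. Only in the argument of \<open>expval\<close> does \<^const>\<open>fps_X\<close> stand for the integration
  variable \<open>x\<close>.
\<close>

abbreviation fps_sqrt :: "real fps \<Rightarrow> real fps" where
  "fps_sqrt \<equiv> fps_radical (\<lambda>k. root k) 2"

text \<open>\<open>(2 n - 1)!!\<close>, with \<open>(-1)!! = 1\<close>.\<close>
definition odd_dfact :: "nat \<Rightarrow> real" where
  "odd_dfact n = (\<Prod>k = 1..n. 2 * real k - 1)"

definition expval :: "real fps \<Rightarrow> real fps" where
  "expval f = Abs_fps (\<lambda>n. odd_dfact n * (f / fps_sqrt (1 - fps_X\<^sup>2)) $ (2 * n))"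

text \<open>
  The partition function and its derivatives at \<open>j = \<eta> = 0\<close>. The suffix \<open>e\<close> stands for the pair of
  derivatives in \<open>\<eta>\<close> and its conjugate. The factors \<open>\<hbar>\<^sup>-\<^sup>1\<close>, \<open>\<hbar>\<^sup>-\<^sup>2\<close> make these Laurent series.
\<close>

definition Z_0 :: "real fls" where
  "Z_0 = fps_to_fls (expval 1)"

definition Z_jj :: "real fls" where
  "Z_jj = fls_X_inv ^ 2 * fps_to_fls (expval (fps_X\<^sup>2))"

definition Z_e :: "real fls" where
  "Z_e = fls_X_inv * fps_to_fls (expval (1 / (1 - fps_X)))"

definition Z_je :: "real fls" where
  "Z_je = fls_X_inv ^ 2 * fps_to_fls (expval (fps_X / (1 - fps_X)))"

text \<open>Derivatives of \<open>W = \<hbar> log Z\<close> at \<open>j = \<eta> = 0\<close>.\<close>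

definition W_jj :: "real fls" where "W_jj = fls_X * (Z_jj / Z_0)"
definition W_e :: "real fls" where "W_e = fls_X * (Z_e / Z_0)"
definition W_je :: "real fls" where "W_je = fls_X * (Z_je / Z_0)"

text \<open>
  Derivatives of the effective action at \<open>\<phi>\<^sub>c = \<psi>\<^sub>c = 0\<close>; the suffix \<open>s\<close> stands for the pair of
  derivatives in \<open>\<psi>\<^sub>c\<close> and its conjugate. Lemma \<open>G_power_series\<close> below shows that
  \<^const>\<open>fls_regpart\<close> discards nothing.
\<close>

definition G_phi2 :: "real fps" where
  "G_phi2 = fls_regpart (- (1 / W_jj))"

definition G_s :: "real fps" where
  "G_s = fls_regpart (- (1 / W_e))"

definition G_phi_s :: "real fps" where
  "G_phi_s = fls_regpart (W_je / (W_jj * W_e ^ 2))"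

definition invcharge :: "real fps" where
  "invcharge = (G_phi_s / (fps_sqrt (- G_phi2) * (- G_s))) ^ 2"

text \<open>Existence and uniqueness are lemma \<open>hbar_of_ren_ex1\<close> below.\<close>
definition hbar_of_ren :: "real fps" where
  "hbar_of_ren = (THE g. g $ 0 = 0 \<and> g $ 1 = 1 \<and> fps_X = g * (invcharge oo g))"

definition z_vertex :: "real fps" where
  "z_vertex = 1 / (G_phi_s oo hbar_of_ren)"


lemma fps_sqrt_nth_0: "fps_sqrt (1 - fps_X\<^sup>2) $ 0 = 1"
  by simp

lemma fps_divide_unit_nth_0:
  fixes f g :: "real fps"
  assumes "g $ 0 \<noteq> 0"
  shows "(f / g) $ 0 = f $ 0 / g $ 0"
  using assms by (simp add: fps_divide_unit divide_inverse)

lemma fps_sqrt_square: "(fps_sqrt (1 - fps_X\<^sup>2))\<^sup>2 = 1 - fps_X\<^sup>2"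
  using power_radical[of "1 - fps_X\<^sup>2 :: real fps" "\<lambda>k. root k" 1]
  by (simp add: numeral_2_eq_2)

lemma inverse_sqrt_low:
  "inverse (fps_sqrt (1 - fps_X\<^sup>2)) $ 0 = 1" "inverse (fps_sqrt (1 - fps_X\<^sup>2)) $ Suc 0 = 0"
proof -
  let ?s = "fps_sqrt (1 - fps_X\<^sup>2)"
  show 0: "inverse ?s $ 0 = 1" by simp
  have "(?s * ?s) $ 1 = 0"
    using fps_sqrt_square by (simp add: power2_eq_square fps_X_power_nth)
  hence s1: "?s $ Suc 0 = 0"
    using fps_sqrt_nth_0 by (simp add: fps_mult_nth)
  have "?s * inverse ?s = 1"
    by (rule inverse_mult_eq_1') simp
  hence "(?s * inverse ?s) $ 1 = 0" by simp
  thus "inverse ?s $ Suc 0 = 0"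
    using s1 0 fps_sqrt_nth_0 by (simp add: fps_mult_nth)
qed

lemma expval_nth:
  "expval f $ n = odd_dfact n * (f * inverse (fps_sqrt (1 - fps_X\<^sup>2))) $ (2 * n)"
  by (simp add: expval_def fps_divide_unit)

lemma expval_nth_0: "expval f $ 0 = f $ 0"
  by (simp add: expval_nth odd_dfact_def)

lemma expval_nth_1:
  assumes "f $ 0 = 0"
  shows "expval f $ Suc 0 = f $ 2"
proof -
  define h where "h = inverse (fps_sqrt (1 - fps_X\<^sup>2))"
  have "h $ 0 = 1" "h $ Suc 0 = 0"
    unfolding h_def by (fact inverse_sqrt_low)+
  hence "(f * h) $ 2 = f $ 2"
    using assms by (simp add: fps_mult_nth numeral_2_eq_2)
  thus ?thesis
    by (simp add: expval_nth odd_dfact_def flip: h_def)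
qed

lemma fps_1_over_1_minus_X: "(1 / (1 - fps_X) :: real fps) = Abs_fps (\<lambda>n. 1)"
proof -
  have "inverse (1 - fps_X :: real fps) = Abs_fps (\<lambda>n. 1)"
    by (rule fps_inverse_one_minus_fps_X(1))
  thus ?thesis by (simp add: fps_divide_unit)
qed

lemma expval_low:
  "expval 1 $ 0 = 1"
  "expval (1 / (1 - fps_X)) $ 0 = 1"
  "expval (fps_X\<^sup>2) $ 0 = 0" "expval (fps_X\<^sup>2) $ Suc 0 = 1"
  "expval (fps_X / (1 - fps_X)) $ 0 = 0" "expval (fps_X / (1 - fps_X)) $ Suc 0 = 1"
proof -
  have e: "fps_X / (1 - fps_X) = (fps_X * Abs_fps (\<lambda>n. 1) :: real fps)"
    using fps_1_over_1_minus_X by (simp add: fps_divide_unit)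
  show "expval 1 $ 0 = 1"
    "expval (1 / (1 - fps_X)) $ 0 = 1"
    "expval (fps_X\<^sup>2) $ 0 = 0"
    "expval (fps_X / (1 - fps_X)) $ 0 = 0"
    by (simp_all add: expval_nth_0 fps_1_over_1_minus_X e)
  show "expval (fps_X\<^sup>2) $ Suc 0 = 1" "expval (fps_X / (1 - fps_X)) $ Suc 0 = 1"
    by (simp_all add: expval_nth_1 e)
qed

lemma fps_to_fls_quotient:
  fixes f g :: "real fps"
  assumes "g $ 0 \<noteq> 0"
  shows "fps_to_fls f / fps_to_fls g = fps_to_fls (f / g)"
proof -
  have "fps_to_fls (f / g) * fps_to_fls g = fps_to_fls f"
    using assms by (simp add: fps_divide_unit mult.assoc inverse_mult_eq_1 flip: fls_times_fps_to_fls)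
  moreover have "fps_to_fls g \<noteq> 0" using assms by auto
  ultimately show ?thesis by (simp add: field_simps)
qed

lemma fps_eq_X_mult_shift:
  fixes f :: "real fps"
  assumes "f $ 0 = 0"
  shows "fps_to_fls f = fls_X * fps_to_fls (fps_shift 1 f)"
proof -
  have "f = fps_X * fps_shift 1 f"
    using assms by (simp add: fps_eq_iff)
  hence "fps_to_fls f = fps_to_fls (fps_X * fps_shift 1 f)" by simp
  also have "\<dots> = fls_X * fps_to_fls (fps_shift 1 f)"
    by (simp add: fls_times_fps_to_fls)
  finally show ?thesis .
qed

lemma X_Xinv: "fls_X * fls_X_inv = (1 :: real fls)"
  by (simp add: fls_X_times_conv_shift)

lemma W_power_series:
  "W_jj = fps_to_fls (fps_shift 1 (expval (fps_X\<^sup>2)) / expval 1)"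
  "W_e = fps_to_fls (expval (1 / (1 - fps_X)) / expval 1)"
  "W_je = fps_to_fls (fps_shift 1 (expval (fps_X / (1 - fps_X))) / expval 1)"
proof -
  have Xi: "fls_X_inv = 1 / (fls_X :: real fls)" "fls_X \<noteq> (0 :: real fls)"
  proof -
    show "fls_X \<noteq> (0 :: real fls)" by simp
    thus "fls_X_inv = 1 / (fls_X :: real fls)"
      using X_Xinv by (metis nonzero_mult_div_cancel_left)
  qed
  have shift: "fls_X * (fls_X_inv ^ 2 * fps_to_fls f / Z_0) = fps_to_fls (fps_shift 1 f / expval 1)"
    if "f $ 0 = 0" for f :: "real fps"
  proof -
    have "x * ((1 / x)\<^sup>2 * (x * g) / z) = g / z" if "x \<noteq> 0" for x g z :: "real fls"
      using that by (simp add: power2_eq_square)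
    thus ?thesis
      using fps_to_fls_quotient[of "expval 1" "fps_shift 1 f"] expval_low(1) Xi(2)
      unfolding Z_0_def fps_eq_X_mult_shift[OF that] Xi(1)
      by (metis one_neq_zero)
  qed
  show "W_jj = fps_to_fls (fps_shift 1 (expval (fps_X\<^sup>2)) / expval 1)"
    "W_je = fps_to_fls (fps_shift 1 (expval (fps_X / (1 - fps_X))) / expval 1)"
    unfolding W_jj_def Z_jj_def W_je_def Z_je_def
    by (simp_all only: shift expval_low)
  show "W_e = fps_to_fls (expval (1 / (1 - fps_X)) / expval 1)"
  proof -
    have "x * (1 / x * g / z) = g / z" if "x \<noteq> 0" for x g z :: "real fls"
      using that by simp
    thus ?thesis
      using fps_to_fls_quotient[of "expval 1" "expval (1 / (1 - fps_X))"] expval_low(1) Xi(2)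
      unfolding W_e_def Z_e_def Z_0_def Xi(1)
      by (metis one_neq_zero)
  qed
qed

lemma G_aux:
  obtains a b c :: "real fps" where
    "a $ 0 = 1" "b $ 0 = 1" "c $ 0 = 1"
    "W_jj = fps_to_fls a" "W_e = fps_to_fls b" "W_je = fps_to_fls c"
proof
  show "(fps_shift 1 (expval (fps_X\<^sup>2)) / expval 1) $ 0 = 1"
    "(expval (1 / (1 - fps_X)) / expval 1) $ 0 = 1"
    "(fps_shift 1 (expval (fps_X / (1 - fps_X))) / expval 1) $ 0 = 1"
    by (simp_all add: fps_divide_unit_nth_0 expval_low del: fps_divide_1)
qed (rule W_power_series)+

lemma G_power_series:
  "fps_to_fls G_phi2 = - (1 / W_jj)"
  "fps_to_fls G_s = - (1 / W_e)"
  "fps_to_fls G_phi_s = W_je / (W_jj * W_e ^ 2)"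
  "G_phi2 $ 0 = -1" "G_s $ 0 = -1" "G_phi_s $ 0 = 1"
proof -
  obtain a b c :: "real fps" where *: "a $ 0 = 1" "b $ 0 = 1" "c $ 0 = 1"
    "W_jj = fps_to_fls a" "W_e = fps_to_fls b" "W_je = fps_to_fls c"
    by (rule G_aux)
  have 1: "- (1 / W_jj) = fps_to_fls (- (1 / a))"
    using fps_to_fls_quotient[of a 1] * by simp
  have 2: "- (1 / W_e) = fps_to_fls (- (1 / b))"
    using fps_to_fls_quotient[of b 1] * by simp
  have 3: "W_je / (W_jj * W_e ^ 2) = fps_to_fls (c / (a * b ^ 2))"
    using fps_to_fls_quotient[of "a * b ^ 2" c] *
    by (simp add: fls_times_fps_to_fls fps_to_fls_power)
  show "fps_to_fls G_phi2 = - (1 / W_jj)"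
    "fps_to_fls G_s = - (1 / W_e)"
    "fps_to_fls G_phi_s = W_je / (W_jj * W_e ^ 2)"
    unfolding G_phi2_def G_s_def G_phi_s_def 1 2 3 by simp_all
  show "G_phi2 $ 0 = -1" "G_s $ 0 = -1" "G_phi_s $ 0 = 1"
    unfolding G_phi2_def G_s_def G_phi_s_def 1 2 3
    using * by (simp_all add: fps_divide_unit_nth_0 fps_nth_power_0)
qed

lemma invcharge_nth_0: "invcharge $ 0 = 1"
  using G_power_series by (simp add: invcharge_def fps_divide_unit_nth_0 fps_nth_power_0)

lemma hbar_of_ren_ex1:
  "\<exists>!g. g $ 0 = 0 \<and> g $ 1 = 1 \<and> fps_X = g * (invcharge oo g)"
proof -
  define a where "a = fps_X * invcharge"
  have a: "a $ 0 = 0" "a $ 1 = 1"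
    by (simp_all add: a_def invcharge_nth_0)
  have comp: "a oo g = g * (invcharge oo g)" if "g $ 0 = 0" for g
    using that by (simp add: a_def fps_compose_mult_distrib)
  have inv0: "fps_inv a $ 0 = 0" by (simp add: fps_inv_def)
  show ?thesis
  proof (rule ex1I[of _ "fps_inv a"])
    have "fps_X = fps_inv a * (invcharge oo fps_inv a)"
      using comp[OF inv0] fps_inv_right[of a] a by simp
    moreover have "fps_inv a $ 1 = 1"
      using a by (simp add: fps_inv_def)
    ultimately show "fps_inv a $ 0 = 0 \<and> fps_inv a $ 1 = 1 \<and>
        fps_X = fps_inv a * (invcharge oo fps_inv a)"
      using inv0 by blast
  next
    fix g assume g: "g $ 0 = 0 \<and> g $ 1 = 1 \<and> fps_X = g * (invcharge oo g)"
    have "g = (fps_inv a oo a) oo g"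
      using fps_inv[of a] a g by simp
    also have "\<dots> = fps_inv a oo (a oo g)"
      using a g by (simp add: fps_compose_assoc)
    also have "\<dots> = fps_inv a"
      using comp[of g] g by simp
    finally show "g = fps_inv a" .
  qed
qed

end

theory Submission
  imports Defs
begin

text \<open>
  A series is called factorially divergent here if its coefficients have a full asymptotic
  expansion in the scale \<open>growth (n - k)\<close>. Such series form a ring, and the map sending a series to
  the generating function of its expansion coefficients is a derivation (the alien derivative).

  The partition function has \<open>Z = \<Sum>\<^sub>n (1/2)\<^sub>n\<^sup>2 (2 \<hbar>)\<^sup>n / n!\<close>, and all other quantities are rational in
  \<open>\<hbar>\<close> and \<open>v = 1 + 2 \<hbar> Z' / Z\<close>, which solves a Riccati equation; the renormalised series
  \<open>u = \<hbar>\<^sub>r\<^sub>e\<^sub>n z\<close> is \<open>v - 1\<close> composed with \<open>\<hbar>(\<hbar>\<^sub>r\<^sub>e\<^sub>n)\<close>. Since \<open>\<hbar>\<^sub>r\<^sub>e\<^sub>n = \<hbar> + 5 \<hbar>\<^sup>2 + \<dots>\<close>, the substitution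
  \<open>\<hbar> = s / (1 + 5 s)\<close> leaves a change of variables \<open>s = \<hbar>\<^sub>r\<^sub>e\<^sub>n + O(\<hbar>\<^sub>r\<^sub>e\<^sub>n\<^sup>3)\<close>. The substitution can be carried
  out explicitly on the coefficients of \<open>Z\<close> and produces the factor \<open>e\<^sup>-\<^sup>5\<^sup>/\<^sup>2\<close>. In the Lagrange inversion
  \<open>n u\<^sub>n = [s\<^sup>n] s w' (1 + \<lambda>)\<^sup>n\<close> of the remaining change of variables, \<open>\<lambda> = O(s\<^sup>2)\<close> makes the term
  \<open>(n choose j) \<lambda>\<^sup>j\<close> of relative size \<open>n\<^sup>1\<^sup>-\<^sup>j\<close>. So finitely many terms matter at each order, \<open>u\<close> is
  factorially divergent, and the terms \<open>j \<le> 1\<close> give its leading coefficient. The higher coefficients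
  follow by applying the alien derivative to the first-order differential equation for \<open>u\<close>.
\<close>

subsection \<open>Factorially divergent power series\<close>

text \<open>Up to the factor \<open>4\<close>, this is \<open>(1/2) powr (- n - 2) * Gamma (n + 2)\<close>. Shifting \<open>n\<close> by \<open>k\<close> gives
  the \<open>k\<close>-th function of the scale; truncated subtraction only affects \<open>n < k\<close>.\<close>
definition growth :: "nat \<Rightarrow> real" where
  "growth n = 2 ^ n * fact (n + 1)"

lemma growth_pos [simp]: "growth n > 0"
  by (simp add: growth_def)

lemma growth_nonneg [simp]: "growth n \<ge> 0"
  using growth_pos[of n] by linarith

lemma growth_neq_0 [simp]: "growth n \<noteq> 0"
  using growth_pos[of n] by linarith

lemma growth_0 [simp]: "growth 0 = 1"
  by (simp add: growth_def)

lemma growth_Suc: "growth (Suc n) = 2 * (real n + 2) * growth n"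
  by (simp add: growth_def algebra_simps)

lemma growth_le_Suc: "growth n \<le> growth (Suc n)"
proof -
  have "1 * growth n \<le> 2 * (real n + 2) * growth n" by (intro mult_right_mono) auto
  thus ?thesis by (simp add: growth_Suc)
qed

lemma growth_mono: "m \<le> n \<Longrightarrow> growth m \<le> growth n"
  by (rule lift_Suc_mono_le[of growth]) (auto simp: growth_le_Suc)

lemma growth_diff_Suc: "k < n \<Longrightarrow> growth (n - k) = 2 * (real n - real k + 1) * growth (n - Suc k)"
proof -
  assume "k < n"
  hence "n - k = Suc (n - Suc k)" by simp
  thus ?thesis using \<open>k < n\<close> by (simp add: growth_Suc of_nat_diff)
qed

section \<open>Landau comparisons between the functions of the scale\<close>

lemma bigo_growth_mono: "r \<le> s \<Longrightarrow> (\<lambda>n. growth (n - s)) \<in> O(\<lambda>n. growth (n - r))"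
  by (intro landau_o.bigI[of 1] always_eventually allI) (auto intro!: growth_mono)

lemma bigo_growth_trans: "f \<in> O(\<lambda>n. growth (n - s)) \<Longrightarrow> r \<le> s \<Longrightarrow> f \<in> O(\<lambda>n. growth (n - r))"
  using bigo_growth_mono landau_o.big_trans by blast

lemma n_times_growth_bigo: "(\<lambda>n. real n * growth (n - Suc r)) \<in> O(\<lambda>n. growth (n - r))"
proof (rule landau_o.bigI[of "real r + 1"])
  show "\<forall>\<^sub>F n in sequentially. norm (real n * growth (n - Suc r)) \<le> (real r + 1) * norm (growth (n - r))"
    using eventually_gt_at_top[of r]
  proof eventually_elim
    case (elim n)
    have "real n = (real n - real r) + real r" by simp
    also have "\<dots> \<le> (real n - real r + 1) * (real r + 1)"
    proof -
      have "real r * 1 \<le> real r * (real n - real r + 1)" using elim by (intro mult_left_mono) auto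
      thus ?thesis using elim by (simp add: algebra_simps)
    qed
    also have "(real n - real r + 1) * (real r + 1) \<le> (real n - real r + 1) * (real r + 1) * 2"
      using elim by simp
    also have "\<dots> = (real r + 1) * (2 * (real n - real r + 1))"
      by simp
    finally have "real n * growth (n - Suc r) \<le> (real r + 1) * (2 * (real n - real r + 1)) * growth (n - Suc r)"
      by (intro mult_right_mono) auto
    thus ?case using elim by (simp add: growth_diff_Suc mult.assoc)
  qed
qed auto

lemma n_mult_bigo:
  assumes "f \<in> O(\<lambda>n. growth (n - Suc r))"
  shows "(\<lambda>n. real n * f n) \<in> O(\<lambda>n. growth (n - r))"
proof -
  have "(\<lambda>n. real n * f n) \<in> O(\<lambda>n. real n * growth (n - Suc r))"
    using assms by (rule landau_o.big.mult_left)
  thus ?thesis using n_times_growth_bigo landau_o.big_trans by blast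
qed

lemma growth_over_n_bigo: "(\<lambda>n. growth (n - r) / (real n + real a)) \<in> O(\<lambda>n. growth (n - Suc r))"
proof (rule landau_o.bigI[of 4])
  show "\<forall>\<^sub>F n in sequentially. norm (growth (n - r) / (real n + real a)) \<le> 4 * norm (growth (n - Suc r))"
    using eventually_gt_at_top[of r]
  proof eventually_elim
    case (elim n)
    have "2 * (real n - real r + 1) * growth (n - Suc r) \<le> (4 * (real n + real a)) * growth (n - Suc r)"
      using elim by (intro mult_right_mono) auto
    moreover have "norm (growth (n - r) / (real n + real a)) = growth (n - r) / (real n + real a)" by simp
    ultimately show ?case using elim by (simp add: growth_diff_Suc divide_le_eq mult_ac)
  qed
qed auto

lemma div_n_bigo:
  assumes "f \<in> O(\<lambda>n. growth (n - r))"
  shows "(\<lambda>n. f n / (real n + real a)) \<in> O(\<lambda>n. growth (n - Suc r))"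
proof -
  have "(\<lambda>n. f n / (real n + real a)) \<in> O(\<lambda>n. growth (n - r) / (real n + real a))"
    by (intro landau_o.big.divide_right assms eventually_mono[OF eventually_gt_at_top[of 0]]) auto
  thus ?thesis using growth_over_n_bigo landau_o.big_trans by blast
qed

lemma bigo_shift:
  assumes "f \<in> O(\<lambda>n. growth (n - r))"
  shows "(\<lambda>n. f (n - 1)) \<in> O(\<lambda>n. growth (n - Suc r))"
proof -
  have "(\<lambda>n. f (n - 1)) \<in> O(\<lambda>n. growth (n - 1 - r))"
    by (rule landau_o.big.compose[OF assms]) (rule filterlim_minus_const_nat_at_top)
  thus ?thesis by simp
qed

text \<open>Consecutive functions of the scale have ratio \<open>2 * (n - r + 1)\<close>, which is
  unbounded. The uniqueness of expansion coefficients rests on this.\<close>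

lemma growth_Suc_not_bigo: "(\<lambda>n. growth (n - r)) \<in> O(\<lambda>n. growth (n - Suc r)) \<Longrightarrow> False"
proof -
  assume "(\<lambda>n. growth (n - r)) \<in> O(\<lambda>n. growth (n - Suc r))"
  then obtain C where C: "C > 0" "\<forall>\<^sub>F n in sequentially. norm (growth (n - r)) \<le> C * norm (growth (n - Suc r))"
    by (rule landau_o.bigE)
  have "\<forall>\<^sub>F n in sequentially. n > r \<and> real n > C + real r"
    using eventually_gt_at_top[of "r + nat \<lceil>C\<rceil>"]
    by eventually_elim (use C(1) in linarith)
  with C(2) have "\<forall>\<^sub>F n in sequentially. False"
  proof eventually_elim
    case (elim n)
    have "2 * (real n - real r + 1) * growth (n - Suc r) \<le> C * growth (n - Suc r)"
      using elim by (simp add: growth_diff_Suc)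
    hence "2 * (real n - real r + 1) \<le> C" by (simp add: mult_le_cancel_right)
    moreover have "C + real r < real n" using elim by blast
    ultimately show False using C(1) by argo
  qed
  thus False by simp
qed

section \<open>Expansions to finite order\<close>

definition asympt :: "nat \<Rightarrow> (nat \<Rightarrow> real) \<Rightarrow> real fps \<Rightarrow> bool" where
  "asympt R f c \<longleftrightarrow> (\<lambda>n. f n - (\<Sum>k<R. c $ k * growth (n - k))) \<in> O(\<lambda>n. growth (n - R))"

lemma asympt_0 [simp]: "asympt 0 f c \<longleftrightarrow> f \<in> O(growth)"
  by (simp add: asympt_def)

lemma asympt_cong_ev:
  assumes "\<forall>\<^sub>F n in sequentially. f n = g n" "\<And>k. k < R \<Longrightarrow> c $ k = d $ k"
  shows "asympt R f c \<longleftrightarrow> asympt R g d"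
proof -
  have "\<forall>\<^sub>F n in sequentially. f n - (\<Sum>k<R. c $ k * growth (n - k)) = g n - (\<Sum>k<R. d $ k * growth (n - k))"
    using assms(1) by eventually_elim (simp add: assms(2))
  thus ?thesis unfolding asympt_def by (rule landau_o.big.in_cong)
qed

lemma asympt_coeff_cong: "asympt R f c \<Longrightarrow> (\<And>k. k < R \<Longrightarrow> c $ k = d $ k) \<Longrightarrow> asympt R f d"
  using asympt_cong_ev[of f f R c d] by simp

lemma asympt_bigo: "f \<in> O(\<lambda>n. growth (n - R)) \<Longrightarrow> asympt R f 0"
  by (simp add: asympt_def)

lemma asympt_add:
  assumes "asympt R f c" "asympt R g d"
  shows "asympt R (\<lambda>n. f n + g n) (c + d)"
proof -
  have "(\<lambda>n. (f n - (\<Sum>k<R. c $ k * growth (n - k))) + (g n - (\<Sum>k<R. d $ k * growth (n - k)))) \<in> O(\<lambda>n. growth (n - R))"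
    using assms unfolding asympt_def by (rule sum_in_bigo)
  thus ?thesis unfolding asympt_def by (simp add: algebra_simps sum.distrib)
qed

lemma asympt_cmult:
  assumes "asympt R f c"
  shows "asympt R (\<lambda>n. a * f n) (fps_const a * c)"
proof -
  have "(\<lambda>n. a * (f n - (\<Sum>k<R. c $ k * growth (n - k)))) \<in> O(\<lambda>n. growth (n - R))"
    using assms unfolding asympt_def by simp
  thus ?thesis unfolding asympt_def by (simp add: algebra_simps sum_distrib_left)
qed

lemma asympt_minus: "asympt R f c \<Longrightarrow> asympt R (\<lambda>n. - f n) (- c)"
  using asympt_cmult[of R f c "-1"] by (simp flip: fps_const_neg)

lemma asympt_diff: "asympt R f c \<Longrightarrow> asympt R g d \<Longrightarrow> asympt R (\<lambda>n. f n - g n) (c - d)"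
  using asympt_add[of R f c "\<lambda>n. - g n" "- d"] asympt_minus by simp

lemma asympt_sum:
  assumes "\<And>i. i \<in> A \<Longrightarrow> asympt R (f i) (c i)"
  shows "asympt R (\<lambda>n. \<Sum>i\<in>A. f i n) (\<Sum>i\<in>A. c i)"
  using assms
proof (induction A rule: infinite_finite_induct)
  case (insert x A)
  thus ?case using asympt_add[of R "f x" "c x" "\<lambda>n. \<Sum>i\<in>A. f i n" "\<Sum>i\<in>A. c i"] by simp
qed (auto intro!: asympt_bigo)

lemma asympt_Suc_imp: "asympt (Suc R) f c \<Longrightarrow> asympt R f c"
proof -
  assume "asympt (Suc R) f c"
  hence 1: "(\<lambda>n. f n - (\<Sum>k<Suc R. c $ k * growth (n - k))) \<in> O(\<lambda>n. growth (n - R))"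
    unfolding asympt_def using bigo_growth_trans[of _ "Suc R" R] by simp
  have 2: "(\<lambda>n. c $ R * growth (n - R)) \<in> O(\<lambda>n. growth (n - R))" by simp
  show ?thesis
    using sum_in_bigo(1)[OF 1 2] unfolding asympt_def by (simp add: algebra_simps)
qed

lemma asympt_mono: "asympt R f c \<Longrightarrow> r \<le> R \<Longrightarrow> asympt r f c"
  by (induction R rule: nat_induct) (auto simp: le_Suc_eq asympt_Suc_imp)

lemma asympt_growth: "asympt R (\<lambda>n. growth (n - k)) (fps_X ^ k)"
proof (cases "k < R")
  case True
  have "(\<Sum>i<R. (fps_X ^ k :: real fps) $ i * growth (n - i)) = growth (n - k)" for n
    using True by (simp add: fps_X_power_nth if_distrib[of "\<lambda>a. a * _"] sum.delta cong: if_cong)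
  thus ?thesis by (simp add: asympt_def)
next
  case False
  hence "asympt R (\<lambda>n. growth (n - k)) 0"
    by (intro asympt_bigo bigo_growth_mono) auto
  thus ?thesis by (rule asympt_coeff_cong) (use False in \<open>simp add: fps_X_power_nth\<close>)
qed

text \<open>Coefficients are kept in a power series so that shifting the index becomes
  multiplication by \<open>fps_X\<close>. The remainder gains an order as well.\<close>

lemma asympt_shift:
  assumes "asympt R f c"
  shows "asympt (Suc R) (\<lambda>n. f (n - 1)) (fps_X * c)"
proof -
  have "(\<lambda>n. f (n - 1) - (\<Sum>k<R. c $ k * growth (n - 1 - k))) \<in> O(\<lambda>n. growth (n - Suc R))"
    using bigo_shift assms unfolding asympt_def by blast
  thus ?thesis
    unfolding asympt_def by (subst sum.lessThan_Suc_shift) (simp add: fps_X_mult_nth)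
qed

lemma asympt_shift_power:
  assumes "asympt R f c"
  shows "asympt (R + k) (\<lambda>n. f (n - k)) (fps_X ^ k * c)"
proof (induction k)
  case (Suc k)
  from asympt_shift[OF Suc] show ?case by (simp add: mult.assoc)
qed (use assms in simp)

text \<open>Replacing \<open>n\<close> by \<open>Suc n\<close> raises every function of the scale by
  one place. The term with \<open>c $ 0\<close> would leave the scale, hence the assumption, and one
  order of accuracy is lost.\<close>

lemma asympt_unshift:
  assumes "asympt (Suc R) f c" "c $ 0 = 0"
  shows "asympt R (\<lambda>n. f (Suc n)) (fps_shift 1 c)"
proof -
  have "(\<lambda>n. f (Suc n) - (\<Sum>k<Suc R. c $ k * growth (Suc n - k))) \<in> O(\<lambda>n. growth (Suc n - Suc R))"
    by (rule landau_o.big.compose[OF assms(1)[unfolded asympt_def]]) (rule filterlim_Suc)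
  thus ?thesis
    unfolding asympt_def using assms(2) by (subst (asm) sum.lessThan_Suc_shift) simp
qed

text \<open>A first nonzero coefficient would make its own scale function as small as the next
  one.\<close>

lemma asympt_unique_0:
  assumes "asympt R f c" "f \<in> O(\<lambda>n. growth (n - r))" "k < r" "k < R"
  shows "c $ k = 0"
  using assms(3,4)
proof (induction k rule: less_induct)
  case (less k)
  have "asympt (Suc k) f c" using assms(1) asympt_mono less.prems by (metis Suc_leI)
  moreover have "(\<Sum>i<Suc k. c $ i * growth (n - i)) = c $ k * growth (n - k)" for n
    using less by (simp add: sum.neutral)
  ultimately have 1: "(\<lambda>n. f n - c $ k * growth (n - k)) \<in> O(\<lambda>n. growth (n - Suc k))"
    by (simp add: asympt_def)
  have 2: "f \<in> O(\<lambda>n. growth (n - Suc k))" using assms(2) less.prems bigo_growth_trans by (meson Suc_leI)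
  have "(\<lambda>n. c $ k * growth (n - k)) \<in> O(\<lambda>n. growth (n - Suc k))"
    using sum_in_bigo(2)[OF 2 1] by simp
  thus ?case using growth_Suc_not_bigo by (cases "c $ k = 0") auto
qed

lemma asympt_unique:
  assumes "asympt R f c" "asympt R f d" "k < R"
  shows "c $ k = d $ k"
proof -
  have "asympt R (\<lambda>n. 0) (c - d)" using asympt_diff[OF assms(1,2)] by simp
  from asympt_unique_0[OF this, of R k] show ?thesis using assms(3) by simp
qed

text \<open>The first \<open>R\<close> coefficients of \<open>f\<close> act as weighted shifts of
  \<open>g\<close>. Since \<open>fps_X ^ k * d\<close> has no terms below \<open>k\<close>, cutting
  \<open>f\<close> off at \<open>R\<close> preserves the coefficients of \<open>f * d\<close> below
  \<open>R\<close>.\<close>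

lemma asympt_lin:
  assumes "asympt R g d"
  shows "asympt R (\<lambda>n. \<Sum>k<R. f $ k * g (n - k)) (f * d)"
proof -
  have "asympt R (\<lambda>n. \<Sum>k<R. f $ k * g (n - k)) (\<Sum>k<R. fps_const (f $ k) * (fps_X ^ k * d))"
    by (intro asympt_sum asympt_cmult asympt_mono[OF asympt_shift_power[OF assms]]) auto
  thus ?thesis
  proof (rule asympt_coeff_cong)
    fix i assume i: "i < R"
    have "(\<Sum>k<R. fps_const (f $ k) * (fps_X ^ k * d)) $ i = (\<Sum>k<R. if k \<le> i then f $ k * d $ (i - k) else 0)"
      by (auto simp: fps_sum_nth fps_X_power_mult_nth intro!: sum.cong)
    also have "\<dots> = (\<Sum>k\<in>{0..i}. f $ k * d $ (i - k))"
      using i by (intro sum.mono_neutral_cong_right) auto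
    finally show "(\<Sum>k<R. fps_const (f $ k) * (fps_X ^ k * d)) $ i = (f * d) $ i"
      by (simp add: fps_mult_nth)
  qed
qed

section \<open>Products and inverses of series of factorial growth\<close>

text \<open>The binomial coefficients \<open>N choose a\<close> increase towards the middle, so all but the two
  outermost terms are smaller by a factor of order \<open>1 / N\<close>.\<close>
lemma sum_fact_mult_fact_le:
  assumes "2 * q \<le> N"
  shows "(\<Sum>a=q..N-q. fact a * fact (N - a) :: real) \<le> (2 * fact q + 2 * fact (q + 1)) * fact (N - q)"
proof -
  have mono: "fact a * fact (N - a) \<le> (fact p * fact (N - p) :: real)"
    if "p \<le> a" "a \<le> N - p" "p \<le> N" for a p
  proof -
    have "N choose p \<le> N choose a"
    proof (cases "2 * a \<le> N")
      case True
      thus ?thesis using that by (intro binomial_mono) auto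
    next
      case False
      have "N choose a = N choose (N - a)" using that by (intro binomial_symmetric) auto
      moreover have "N choose p \<le> N choose (N - a)" using that False by (intro binomial_mono) auto
      ultimately show ?thesis by simp
    qed
    moreover have "real (N choose a) = fact N / (fact a * fact (N - a))"
      "real (N choose p) = fact N / (fact p * fact (N - p))"
      using that by (auto intro!: binomial_fact)
    ultimately have "(fact N / (fact p * fact (N - p)) :: real) \<le> fact N / (fact a * fact (N - a))"
      by (metis of_nat_le_iff)
    thus ?thesis by (simp add: field_simps)
  qed
  let ?f = "\<lambda>a. fact a * fact (N - a) :: real"
  \<comment> \<open>\<open>q\<close> and \<open>N - q\<close> coincide when
    \<open>N = 2 * q\<close>, so the outermost terms are split off by an inequality.\<close>
  have "(\<Sum>a=q..N-q. ?f a) \<le> (\<Sum>a\<in>insert q (insert (N - q) {q+1..N-(q+1)}). ?f a)"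
    by (rule sum_mono2) (use assms in auto)
  also have "\<dots> \<le> ?f q + ?f (N - q) + (\<Sum>a=q+1..N-(q+1). ?f a)"
    by (auto simp: sum.insert_if)
  also have "(\<Sum>a=q+1..N-(q+1). ?f a) \<le> 2 * fact (q + 1) * fact (N - q)"
  proof (cases "q + 1 \<le> N - (q + 1)")
    case True
    have "(\<Sum>a=q+1..N-(q+1). ?f a) \<le> (\<Sum>a=q+1..N-(q+1). ?f (q + 1))"
      using True by (intro sum_mono mono) auto
    also have "\<dots> = real (N - (q+1) - q) * (fact (q + 1) * fact (N - (q + 1)))" by simp
    \<comment> \<open>The number of inner terms turns \<open>fact (N - q - 1)\<close> into
      \<open>fact (N - q)\<close>.\<close>
    also have "\<dots> \<le> (2 * real (N - q)) * (fact (q + 1) * fact (N - (q + 1)))"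
      by (intro mult_right_mono) auto
    also have "\<dots> = 2 * fact (q + 1) * (real (N - q) * fact (N - q - 1))" by simp
    also have "real (N - q) * fact (N - q - 1) = fact (N - q)"
      using True by (subst (2) fact_reduce) auto
    finally show ?thesis .
  next
    case False
    thus ?thesis by simp
  qed
  finally show ?thesis using assms by (simp add: algebra_simps)
qed

text \<open>With factorial growth the product is governed by the two ends of the convolution, which
  the vanishing of the first coefficients moves inwards by \<open>L\<close>. The lag
  \<open>p\<close> serves second factors that are themselves powers, as in
  \<open>power_coeff_bound\<close>.\<close>

lemma conv_bound:
  fixes f g :: "real fps"
  assumes f: "\<And>k. \<bar>f $ k\<bar> \<le> C * growth k" "\<And>k. k < L \<Longrightarrow> f $ k = 0"
    and g: "\<And>k. k \<ge> L + p \<Longrightarrow> \<bar>g $ k\<bar> \<le> D * growth (k - p)" "\<And>k. k < L + p \<Longrightarrow> g $ k = 0"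
  shows "\<bar>(f * g) $ n\<bar> \<le> C * D * (2 ^ (L + 1) * (fact (L + 1) + fact (L + 2))) * growth (n - p - L)"
    and "n < 2 * L + p \<Longrightarrow> (f * g) $ n = 0"
proof -
  show 0: "(f * g) $ n = 0" if "n < 2 * L + p" for n
    unfolding fps_mult_nth
  proof (rule sum.neutral, safe)
    fix i assume "i \<in> {0..n}"
    thus "f $ i * g $ (n - i) = 0" using that f(2)[of i] g(2)[of "n - i"] by (cases "i < L") auto
  qed
  have CD: "C \<ge> 0" "D \<ge> 0"
    using f(1)[of 0] g(1)[of "L + p"] growth_pos[of 0] growth_pos[of L]
    by (smt (verit) mult_neg_pos diff_add_inverse2 le_refl)+
  show "\<bar>(f * g) $ n\<bar> \<le> C * D * (2 ^ (L + 1) * (fact (L + 1) + fact (L + 2))) * growth (n - p - L)"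
  proof (cases "n < 2 * L + p")
    case True
    thus ?thesis using 0 CD by simp
  next
    case False
    \<comment> \<open>The factorial arguments \<open>i + 1\<close> and \<open>n - p - i + 1\<close>
      add up to \<open>n - p + 2\<close>.\<close>
    define N where "N = n - p + 2"
    have "(f * g) $ n = (\<Sum>i=L..n-(L+p). f $ i * g $ (n - i))"
      unfolding fps_mult_nth by (rule sum.mono_neutral_right) (auto simp: f(2) g(2))
    also have "\<bar>\<dots>\<bar> \<le> (\<Sum>i=L..n-(L+p). \<bar>f $ i * g $ (n - i)\<bar>)" by (rule sum_abs)
    also have "\<dots> \<le> (\<Sum>i=L..n-(L+p). (C * growth i) * (D * growth (n - i - p)))"
      unfolding abs_mult using False by (intro sum_mono mult_mono f(1) g(1)) (auto simp: CD)
    also have "\<dots> = (\<Sum>i=L..n-(L+p). C * D * 2 ^ (n - p) * (fact (i + 1) * fact (N - (i + 1))))"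
    proof (rule sum.cong)
      fix i assume i: "i \<in> {L..n - (L + p)}"
      have "i + (n - i - p) = n - p" using i False by auto
      moreover have "N - (i + 1) = n - i - p + 1" using i False by (auto simp: N_def)
      ultimately show "(C * growth i) * (D * growth (n - i - p)) = C * D * 2 ^ (n - p) * (fact (i + 1) * fact (N - (i + 1)))"
        unfolding growth_def by (simp add: power_add[symmetric] algebra_simps)
    qed simp
    also have "\<dots> = C * D * 2 ^ (n - p) * (\<Sum>i=L..n-(L+p). fact (i + 1) * fact (N - (i + 1)))"
      by (simp add: sum_distrib_left)
    also have "(\<Sum>i=L..n-(L+p). fact (i + 1) * fact (N - (i + 1)) :: real) =
        (\<Sum>a=L+1..N-(L+1). fact a * fact (N - a))"
      by (rule sum.reindex_bij_witness[of _ "\<lambda>a. a - 1" "\<lambda>i. i + 1"]) (use False in \<open>auto simp: N_def\<close>)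
    also have "C * D * 2 ^ (n - p) * \<dots> \<le>
        C * D * 2 ^ (n - p) * ((2 * fact (L + 1) + 2 * fact (L + 1 + 1)) * fact (N - (L + 1)))"
      using False by (intro mult_left_mono sum_fact_mult_fact_le) (auto simp: N_def CD)
    also have "\<dots> = C * D * (2 * (fact (L + 1) + fact (L + 2))) * 2 ^ L * growth (n - p - L)"
    proof -
      have "n - p = L + (n - p - L)" "N - (L + 1) = n - p - L + 1" using False by (auto simp: N_def)
      thus ?thesis unfolding growth_def
        by (simp add: power_add algebra_simps)
    qed
    also have "\<dots> = C * D * (2 ^ (L + 1) * (fact (L + 1) + fact (L + 2))) * growth (n - p - L)"
      unfolding power_add by (simp only: power_one_right mult_ac)
    finally show ?thesis .
  qed
qed

lemma bigo_growth_bound: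
  assumes "f \<in> O(growth)"
  obtains C where "C > 0" "\<And>n. \<bar>f n\<bar> \<le> C * growth n"
proof -
  from assms obtain c where c: "c > 0" "\<forall>\<^sub>F n in sequentially. norm (f n) \<le> c * norm (growth n)"
    by (rule landau_o.bigE)
  then obtain N where N: "\<And>n. n \<ge> N \<Longrightarrow> \<bar>f n\<bar> \<le> c * growth n"
    by (auto simp: eventually_at_top_linorder)
  define C where "C = c + (\<Sum>n<N. \<bar>f n\<bar> / growth n)"
  have C: "c \<le> C" unfolding C_def by (simp add: sum_nonneg)
  show ?thesis
  proof
    show "C > 0" using c(1) C by simp
    fix n
    show "\<bar>f n\<bar> \<le> C * growth n"
    proof (cases "n < N")
      case True
      hence "\<bar>f n\<bar> / growth n \<le> (\<Sum>n<N. \<bar>f n\<bar> / growth n)" by (intro member_le_sum) auto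
      hence "\<bar>f n\<bar> / growth n \<le> C" using c(1) by (simp add: C_def)
      thus ?thesis by (simp add: pos_divide_le_eq)
    next
      case False
      hence "\<bar>f n\<bar> \<le> c * growth n" by (intro N) auto
      also have "\<dots> \<le> C * growth n" using C by (intro mult_right_mono) auto
      finally show ?thesis .
    qed
  qed
qed

lemma fps_cutoff_mult_nth:
  "n \<ge> R \<Longrightarrow> (fps_cutoff R f * g) $ n = (\<Sum>k<R. f $ k * g $ (n - k))" for f :: "real fps"
  unfolding fps_mult_nth by (rule sum.mono_neutral_cong_right) auto

text \<open>Cut both series after \<open>R\<close> coefficients. Head times full series gives the
  two sums, head times head stops contributing at \<open>n >= 2 * R\<close>, and the tails vanish
  below \<open>R\<close>, so \<open>conv_bound\<close> puts their product into the
  remainder.\<close>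

lemma fps_mult_nth_split_bigo:
  fixes f g :: "real fps"
  assumes "fps_nth f \<in> O(growth)" "fps_nth g \<in> O(growth)"
  shows "(\<lambda>n. (f * g) $ n - ((\<Sum>k<R. f $ k * g $ (n - k)) + (\<Sum>k<R. g $ k * f $ (n - k))))
    \<in> O(\<lambda>n. growth (n - R))"
proof -
  obtain C where C: "C > 0" "\<And>n. \<bar>f $ n\<bar> \<le> C * growth n" using bigo_growth_bound[OF assms(1)] by blast
  obtain D where D: "D > 0" "\<And>n. \<bar>g $ n\<bar> \<le> D * growth n" using bigo_growth_bound[OF assms(2)] by blast
  define f' g' where "f' = f - fps_cutoff R f" and "g' = g - fps_cutoff R g"
  have eq: "f * g = fps_cutoff R f * g + fps_cutoff R g * f - fps_cutoff R f * fps_cutoff R g + f' * g'"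
    by (simp add: f'_def g'_def algebra_simps)
  have bound: "\<bar>(f' * g') $ n\<bar> \<le> C * D * (2 ^ (R + 1) * (fact (R + 1) + fact (R + 2))) * growth (n - 0 - R)" for n
    by (rule conv_bound(1)) (use C D in \<open>auto simp: f'_def g'_def\<close>)
  show ?thesis
  proof (rule landau_o.bigI[of "C * D * (2 ^ (R + 1) * (fact (R + 1) + fact (R + 2)))"])
    show "0 < C * D * (2 ^ (R + 1) * (fact (R + 1) + fact (R + 2)))"
      using C(1) D(1) by (intro mult_pos_pos add_pos_pos) auto
    show "\<forall>\<^sub>F n in sequentially.
       norm ((f * g) $ n - ((\<Sum>k<R. f $ k * g $ (n - k)) + (\<Sum>k<R. g $ k * f $ (n - k))))
       \<le> C * D * (2 ^ (R + 1) * (fact (R + 1) + fact (R + 2))) * norm (growth (n - R))"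
      using eventually_ge_at_top[of "2 * R"]
    proof eventually_elim
      case (elim n)
      have "(fps_cutoff R f * fps_cutoff R g) $ n = 0"
        unfolding fps_mult_nth using elim by (intro sum.neutral) auto
      thus ?case
        using elim bound[of n] by (subst eq) (simp add: fps_cutoff_mult_nth)
    qed
  qed
qed

lemma asympt_imp_bigo: "asympt R f c \<Longrightarrow> f \<in> O(growth)"
  using asympt_mono[of R f c 0] by simp

lemma asympt_mult:
  fixes f g :: "real fps"
  assumes "asympt R (fps_nth f) c" "asympt R (fps_nth g) d"
  shows "asympt R (fps_nth (f * g)) (f * d + g * c)"
proof -
  have "asympt R (\<lambda>n. (f * g) $ n - ((\<Sum>k<R. f $ k * g $ (n - k)) + (\<Sum>k<R. g $ k * f $ (n - k)))) 0"
    using assms[THEN asympt_imp_bigo] by (intro asympt_bigo fps_mult_nth_split_bigo)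
  from asympt_add[OF this asympt_add[OF asympt_lin[OF assms(2), of f] asympt_lin[OF assms(1), of g]]]
  show ?thesis by simp
qed

text \<open>Strong induction through \<open>f * g = 1\<close> with \<open>g = inverse f\<close>. The
  inner part of the convolution is bounded by a multiple of \<open>growth (n - 1)\<close>, and the
  factor \<open>2 * (n + 1)\<close> between \<open>growth (n - 1)\<close> and
  \<open>growth n\<close> absorbs the constants once \<open>n\<close> is large.\<close>

lemma bigo_growth_inverse:
  fixes f :: "real fps"
  assumes "fps_nth f \<in> O(growth)" "f $ 0 \<noteq> 0"
  shows "fps_nth (inverse f) \<in> O(growth)"
proof -
  define g where "g = inverse f"
  have fg: "f * g = 1" using assms(2) by (simp add: g_def inverse_mult_eq_1')
  obtain C where C: "C > 0" "\<And>n. \<bar>f $ n\<bar> \<le> C * growth n" using bigo_growth_bound[OF assms(1)] by blast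
  define K :: real where "K = 2 ^ 2 * (fact 2 + fact 3)"
  obtain N where N: "C * K / \<bar>f $ 0\<bar> < real N" using reals_Archimedean2 by blast
  \<comment> \<open>The first summand makes the end term \<open>f $ n * g $ 0\<close> at most half
    of the target. The second covers the indices up to \<open>N\<close>, before the absorption takes
    effect.\<close>
  define M where "M = 2 * C * \<bar>g $ 0\<bar> / \<bar>f $ 0\<bar> + (\<Sum>k<Suc N. \<bar>g $ k\<bar>)"
  have M: "M \<ge> 2 * C * \<bar>g $ 0\<bar> / \<bar>f $ 0\<bar>" "M \<ge> (\<Sum>k<Suc N. \<bar>g $ k\<bar>)" "M \<ge> 0"
    using C(1) by (auto simp: M_def sum_nonneg simp del: sum.lessThan_Suc)
  have "\<bar>g $ n\<bar> \<le> M * growth n" for n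
  proof (induction n rule: less_induct)
    case (less n)
    show ?case
    proof (cases "n < Suc N")
      case True
      hence "\<bar>g $ n\<bar> \<le> (\<Sum>k<Suc N. \<bar>g $ k\<bar>)" by (intro member_le_sum) auto
      also have "\<dots> \<le> M * 1" using M by simp
      also have "\<dots> \<le> M * growth n" using M growth_mono[of 0 n] by (intro mult_left_mono) auto
      finally show ?thesis .
    next
      case False
      define f' where "f' = f - fps_cutoff 1 f"
      \<comment> \<open>\<open>g\<close> is cut off at \<open>n\<close> because the induction
        hypothesis bounds only smaller indices.\<close>
      define g' where "g' = fps_cutoff n g - fps_cutoff 1 g"
      have "0 = (f * g) $ n" using False by (simp add: fg)
      also have "\<dots> = (\<Sum>i\<in>{0..n}. f $ i * g $ (n - i))" by (simp add: fps_mult_nth)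
      also have "\<dots> = f $ 0 * g $ n + f $ n * g $ 0 + (\<Sum>i\<in>{0..n}. f' $ i * g' $ (n - i))"
      proof -
        have "(\<Sum>i\<in>{0..n}. f $ i * g $ (n - i)) = f $ 0 * g $ n + (f $ n * g $ 0 + (\<Sum>i\<in>{0<..<n}. f $ i * g $ (n - i)))"
          using False by (subst sum.remove[of _ 0], simp, simp, subst sum.remove[of _ n], simp, simp)
             (auto intro!: sum.cong)
        moreover have "(\<Sum>i\<in>{0<..<n}. f $ i * g $ (n - i)) = (\<Sum>i\<in>{0..n}. f' $ i * g' $ (n - i))"
          by (rule sum.mono_neutral_cong_left) (auto simp: f'_def g'_def)
        ultimately show ?thesis by simp
      qed
      finally have "\<bar>f $ 0\<bar> * \<bar>g $ n\<bar> \<le> \<bar>f $ n * g $ 0\<bar> + \<bar>(f' * g') $ n\<bar>"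
        by (simp add: fps_mult_nth flip: abs_mult)
      also have "\<bar>(f' * g') $ n\<bar> \<le> C * M * (2 ^ (1 + 1) * (fact (1 + 1) + fact (1 + 2))) * growth (n - 0 - 1)"
        by (rule conv_bound(1)) (use C(2) less M(3) False in \<open>auto simp: f'_def g'_def C(1) less_imp_le\<close>)
      also have "\<dots> = C * K * M * growth (n - 1)" by (simp add: K_def mult_ac numeral_2_eq_2 numeral_3_eq_3)
      also have "\<dots> \<le> \<bar>f $ 0\<bar> * (real n / 1) * M * growth (n - 1)"
      proof (intro mult_right_mono)
        have "C * K \<le> real N * \<bar>f $ 0\<bar>" using N assms(2) by (simp add: field_simps)
        also have "\<dots> \<le> real n * \<bar>f $ 0\<bar>" using False by (intro mult_right_mono) auto
        finally show "C * K \<le> \<bar>f $ 0\<bar> * (real n / 1)" by (simp add: mult_ac)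
      qed (use M in auto)
      also have "\<dots> \<le> \<bar>f $ 0\<bar> * M * growth n / 2"
      proof -
        have "growth n = 2 * (real n + 1) * growth (n - 1)" using growth_diff_Suc[of 0 n] False by simp
        hence "real n * growth (n - 1) \<le> growth n / 2" by (simp add: field_simps)
        from mult_left_mono[OF this, of "\<bar>f $ 0\<bar> * M"] M show ?thesis by (simp add: mult_ac)
      qed
      also have "\<bar>f $ n * g $ 0\<bar> \<le> \<bar>f $ 0\<bar> * M * growth n / 2"
      proof -
        have "\<bar>f $ n * g $ 0\<bar> \<le> C * growth n * \<bar>g $ 0\<bar>"
          unfolding abs_mult using C(2) by (intro mult_right_mono) auto
        also have "\<dots> = (C * \<bar>g $ 0\<bar>) * growth n" by simp
        also have "\<dots> \<le> (\<bar>f $ 0\<bar> * M / 2) * growth n"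
          using M(1) assms(2) by (intro mult_right_mono) (auto simp: field_simps)
        finally show ?thesis by simp
      qed
      finally have "\<bar>f $ 0\<bar> * \<bar>g $ n\<bar> \<le> \<bar>f $ 0\<bar> * (M * growth n)" by (simp add: mult_ac)
      thus ?thesis using assms(2) by (simp add: mult_le_cancel_left)
    qed
  qed
  hence "fps_nth g \<in> O(growth)" by (intro bigoI[of _ M] always_eventually) auto
  thus ?thesis by (simp add: g_def)
qed

text \<open>Induction on the order. In the splitting of \<open>f * inverse f = 1\<close>, the
  coefficient \<open>g $ n\<close> occurs once, with factor \<open>f $ 0\<close>; the other
  large-index coefficients of \<open>g\<close> are shifted by at least one, so order
  \<open>R\<close> for \<open>g\<close> gives order \<open>Suc R\<close>.\<close>

lemma asympt_inverse:
  fixes f :: "real fps"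
  assumes "asympt R (fps_nth f) c" "f $ 0 \<noteq> 0"
  shows "asympt R (fps_nth (inverse f)) (- c * (inverse f)\<^sup>2)"
  using assms(1)
proof (induction R)
  case 0
  thus ?case using bigo_growth_inverse[OF _ assms(2)] by simp
next
  case (Suc R)
  define g where "g = inverse f"
  define d where "d = - c * g\<^sup>2"
  define f1 where "f1 = fps_shift 1 f"
  have fg: "f * g = 1" using assms(2) by (simp add: g_def inverse_mult_eq_1')
  have f: "f = fps_const (f $ 0) + fps_X * f1" by (simp add: fps_eq_iff f1_def)
  have IH: "asympt R (fps_nth g) d" using Suc asympt_Suc_imp by (auto simp: g_def d_def)
  have bigo: "fps_nth f \<in> O(growth)" "fps_nth g \<in> O(growth)"
    using Suc.prems bigo_growth_inverse[OF _ assms(2)] asympt_imp_bigo by (auto simp: g_def)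
  have "asympt (Suc R) (\<lambda>n. (f * g) $ n - ((\<Sum>k<Suc R. f $ k * g $ (n - k)) + (\<Sum>k<Suc R. g $ k * f $ (n - k)))) 0"
    using bigo by (intro asympt_bigo fps_mult_nth_split_bigo)
  from asympt_minus[OF asympt_add[OF this asympt_lin[OF Suc.prems, of g]]]
  have "asympt (Suc R) (\<lambda>n. (\<Sum>k<Suc R. f $ k * g $ (n - k)) - (f * g) $ n) (- (g * c))"
    by (simp add: algebra_simps)
  moreover have "\<forall>\<^sub>F n in sequentially. (\<Sum>k<Suc R. f $ k * g $ (n - k)) - (f * g) $ n =
      f $ 0 * g $ n + (\<Sum>k<R. f1 $ k * g $ (n - 1 - k))"
    using eventually_gt_at_top[of 0]
    by eventually_elim (simp add: fg f1_def sum.lessThan_Suc_shift del: sum.lessThan_Suc)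
  ultimately have "asympt (Suc R) (\<lambda>n. f $ 0 * g $ n + (\<Sum>k<R. f1 $ k * g $ (n - 1 - k))) (- (g * c))"
    by (rule asympt_cong_ev[THEN iffD1, rotated 2]) auto
  from asympt_diff[OF this asympt_shift[OF asympt_lin[OF IH, of f1]]]
  have "asympt (Suc R) (\<lambda>n. f $ 0 * g $ n) (- (g * c) - fps_X * (f1 * d))" by simp
  \<comment> \<open>The Leibniz rule for \<open>f * g = 1\<close> demands
    \<open>f * d = - (g * c)\<close>; splitting off the constant term of \<open>f\<close> leaves
    this.\<close>
  also have "- (g * c) - fps_X * (f1 * d) = fps_const (f $ 0) * d"
  proof -
    have "fps_const (f $ 0) * d = f * d - fps_X * f1 * d" by (subst (2) f) (simp add: algebra_simps)
    also have "f * d = - c * g * (f * g)" by (simp add: d_def power2_eq_square mult_ac)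
    finally show ?thesis by (simp add: fg mult_ac)
  qed
  finally have "asympt (Suc R) (\<lambda>n. inverse (f $ 0) * (f $ 0 * g $ n)) (fps_const (inverse (f $ 0)) * (fps_const (f $ 0) * d))"
    by (rule asympt_cmult)
  moreover have "fps_const (inverse (f $ 0)) * (fps_const (f $ 0) * d) = d"
    using assms(2) by (simp flip: mult.assoc)
  moreover have "(\<lambda>n. inverse (f $ 0) * (f $ 0 * g $ n)) = fps_nth g"
    using assms(2) by (simp flip: mult.assoc)
  ultimately show ?case by (simp only: g_def d_def)
qed

section \<open>Multiplication and division by the index, and first-order recurrences\<close>

lemma asympt_n_mult:
  assumes "asympt (Suc R) f c" "c $ 0 = 0"
  shows "asympt R (\<lambda>n. real n * f n) (Abs_fps (\<lambda>k. (c $ Suc k + (2 * real k - 4) * c $ k) / 2))"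
proof -
  let ?c = "Abs_fps (\<lambda>k. (c $ Suc k + (2 * real k - 4) * c $ k) / 2)"
  have 1: "(\<lambda>n. real n * (f n - (\<Sum>k<Suc R. c $ k * growth (n - k)))) \<in> O(\<lambda>n. growth (n - R))"
    using assms(1) unfolding asympt_def by (rule n_mult_bigo)
  \<comment> \<open>On the term of index \<open>R\<close>, multiplication by \<open>n\<close> also
    produces a multiple of \<open>growth (n - R)\<close>, which belongs to the remainder.\<close>
  have 2: "(\<lambda>n. ((2 * real R - 4) * c $ R / 2) * growth (n - R)) \<in> O(\<lambda>n. growth (n - R))" by simp
  have "\<forall>\<^sub>F n in sequentially. real n * (f n - (\<Sum>k<Suc R. c $ k * growth (n - k))) +
      (2 * real R - 4) * c $ R / 2 * growth (n - R) = real n * f n - (\<Sum>k<R. ?c $ k * growth (n - k))"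
    using eventually_ge_at_top[of R]
  proof eventually_elim
    case (elim n)
    have "real n * (\<Sum>k<Suc R. c $ k * growth (n - k)) =
        (\<Sum>k<Suc R. c $ k / 2 * growth (Suc (n - k)) + (2 * real k - 4) * c $ k / 2 * growth (n - k))"
      unfolding sum_distrib_left
    proof (rule sum.cong)
      fix k assume "k \<in> {..<Suc R}"
      thus "real n * (c $ k * growth (n - k)) = c $ k / 2 * growth (Suc (n - k)) + (2 * real k - 4) * c $ k / 2 * growth (n - k)"
        using elim by (simp add: growth_Suc of_nat_diff field_simps)
    qed simp
    also have "\<dots> = (\<Sum>k<Suc R. c $ k / 2 * growth (Suc (n - k))) + (\<Sum>k<Suc R. (2 * real k - 4) * c $ k / 2 * growth (n - k))"
      by (rule sum.distrib)
    also have "(\<Sum>k<Suc R. c $ k / 2 * growth (Suc (n - k))) = (\<Sum>k<R. c $ Suc k / 2 * growth (n - k))"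
      using assms(2) elim by (subst sum.lessThan_Suc_shift) (auto intro!: sum.cong simp: Suc_diff_Suc)
    also have "(\<Sum>k<Suc R. (2 * real k - 4) * c $ k / 2 * growth (n - k)) =
        (\<Sum>k<R. (2 * real k - 4) * c $ k / 2 * growth (n - k)) + (2 * real R - 4) * c $ R / 2 * growth (n - R)"
      by simp
    also have "(\<Sum>k<R. c $ Suc k / 2 * growth (n - k)) + ((\<Sum>k<R. (2 * real k - 4) * c $ k / 2 * growth (n - k)) +
        (2 * real R - 4) * c $ R / 2 * growth (n - R)) =
        (\<Sum>k<R. ?c $ k * growth (n - k)) + (2 * real R - 4) * c $ R / 2 * growth (n - R)"
      by (simp add: add_divide_distrib distrib_right sum.distrib)
    finally show ?case unfolding right_diff_distrib by linarith
  qed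
  from landau_o.big.in_cong[THEN iffD1, OF this sum_in_bigo(1)[OF 1 2]] show ?thesis
    unfolding asympt_def .
qed

text \<open>Writing \<open>n - k + 1 = (n + a) - (k - 1 + a)\<close> in
  \<open>growth_diff_Suc\<close> reduces index \<open>k\<close> to \<open>Suc k\<close>. The
  recursion stops at \<open>k >= R\<close>, where the whole quotient is remainder.\<close>

lemma asympt_growth_div_n: "\<exists>c. asympt (Suc R) (\<lambda>n. growth (n - k) / (real n + real a)) c"
proof -
  have "R \<le> k + d \<Longrightarrow> ?thesis" for d
  proof (induction d arbitrary: k)
    case 0
    hence "(\<lambda>n. growth (n - k) / (real n + real a)) \<in> O(\<lambda>n. growth (n - Suc R))"
      by (intro bigo_growth_trans[OF growth_over_n_bigo]) auto
    from asympt_bigo[OF this] show ?case by (rule exI)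
  next
    case (Suc d)
    then obtain c where c: "asympt (Suc R) (\<lambda>n. growth (n - Suc k) / (real n + real a)) c" by force
    define b where "b = 2 * (real k - 1 + real a)"
    from asympt_diff[OF asympt_cmult[OF asympt_growth, of _ 2 "Suc k"] asympt_cmult[OF c, of b]]
    have "asympt (Suc R) (\<lambda>n. 2 * growth (n - Suc k) - b * (growth (n - Suc k) / (real n + real a)))
       (fps_const 2 * fps_X ^ Suc k - fps_const b * c)" .
    moreover have "\<forall>\<^sub>F n in sequentially. 2 * growth (n - Suc k) - b * (growth (n - Suc k) / (real n + real a)) =
        growth (n - k) / (real n + real a)"
      using eventually_gt_at_top[of k]
      by eventually_elim (simp add: growth_diff_Suc b_def field_simps)
    ultimately have "asympt (Suc R) (\<lambda>n. growth (n - k) / (real n + real a))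
        (fps_const 2 * fps_X ^ Suc k - fps_const b * c)"
      by (rule asympt_cong_ev[THEN iffD1, rotated 2]) auto
    thus ?case by blast
  qed
  from this[of R] show ?thesis by simp
qed

lemma asympt_div_n:
  assumes "asympt R g e"
  shows "\<exists>c. asympt (Suc R) (\<lambda>n. g n / (real n + real a)) c"
proof -
  obtain d where d: "\<And>k. asympt (Suc R) (\<lambda>n. growth (n - k) / (real n + real a)) (d k)"
    using asympt_growth_div_n[of R _ a] by metis
  have 1: "asympt (Suc R) (\<lambda>n. (g n - (\<Sum>k<R. e $ k * growth (n - k))) / (real n + real a)) 0"
    by (intro asympt_bigo div_n_bigo) (use assms in \<open>simp add: asympt_def\<close>)
  have 2: "asympt (Suc R) (\<lambda>n. \<Sum>k<R. e $ k * (growth (n - k) / (real n + real a))) (\<Sum>k<R. fps_const (e $ k) * d k)"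
    by (intro asympt_sum asympt_cmult d)
  have "(\<lambda>n. (g n - (\<Sum>k<R. e $ k * growth (n - k))) / (real n + real a) + (\<Sum>k<R. e $ k * (growth (n - k) / (real n + real a))))
     = (\<lambda>n. g n / (real n + real a))"
    by (auto simp: diff_divide_distrib sum_divide_distrib)
  with asympt_add[OF 1 2] show ?thesis by (intro exI) (simp only:)
qed

text \<open>From \<open>N\<close> on, \<open>\<delta> - \<psi>\<close> increases,
  \<open>\<delta> + \<psi>\<close> decreases, and their gap closes. The common limit comes with
  \<open>\<psi>\<close> as an explicit error.\<close>

lemma telescope_limit:
  fixes \<delta> \<psi> :: "nat \<Rightarrow> real"
  assumes "\<And>n. n \<ge> N \<Longrightarrow> \<bar>\<delta> (Suc n) - \<delta> n\<bar> \<le> \<psi> n - \<psi> (Suc n)" "\<psi> \<longlonglongrightarrow> 0"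
  shows "\<exists>L. \<forall>n\<ge>N. \<bar>\<delta> n - L\<bar> \<le> \<psi> n"
proof -
  let ?f = "\<lambda>n. \<delta> (n + N) - \<psi> (n + N)" and ?g = "\<lambda>n. \<delta> (n + N) + \<psi> (n + N)"
  have lim: "(\<lambda>n. \<psi> (n + N)) \<longlonglongrightarrow> 0" using assms(2) by (rule LIMSEQ_ignore_initial_segment)
  have "decseq (\<lambda>n. \<psi> (n + N))"
    unfolding decseq_Suc_iff using assms(1) by (smt (verit) add_Suc le_add2)
  hence pos: "\<psi> (n + N) \<ge> 0" for n using lim by (rule decseq_ge)
  have "(\<lambda>n. - 2 * \<psi> (n + N)) \<longlonglongrightarrow> - 2 * 0" by (intro tendsto_intros lim)
  hence "(\<lambda>n. ?f n - ?g n) \<longlonglongrightarrow> 0" by (simp add: algebra_simps)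
  moreover have "\<forall>n. ?f n \<le> ?f (Suc n)" "\<forall>n. ?g (Suc n) \<le> ?g n"
    using assms(1) by (smt (verit) add_Suc le_add2)+
  moreover have "\<forall>n. ?f n \<le> ?g n" using pos by (simp add: algebra_simps)
  ultimately obtain L where "\<forall>n. ?f n \<le> L" "\<forall>n. L \<le> ?g n"
    using nested_sequence_unique[of ?f ?g] by blast
  hence L: "\<bar>\<delta> (n + N) - L\<bar> \<le> \<psi> (n + N)" for n
    by (smt (verit))
  have "\<bar>\<delta> n - L\<bar> \<le> \<psi> n" if "n \<ge> N" for n using L[of "n - N"] that by simp
  thus ?thesis by blast
qed

text \<open>The sequence \<open>growth (n - 2)\<close> solves the homogeneous recurrence, which is why \<open>e $ 2\<close> has to vanish.\<close>
lemma asympt_recurrence: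
  assumes "asympt (Suc R) (\<lambda>n. a (Suc n) - 2 * real n * a n) e" "R \<ge> 2" "e $ 2 = 0"
  shows "\<exists>c. asympt (Suc R) a c"
proof -
  \<comment> \<open>On the scale the operator of the recurrence is diagonal with entries
    \<open>4 - 2 * k\<close>. At \<open>k = 2\<close> the quotient is a division by zero, which
    gives 0 and agrees with \<open>e $ 2 = 0\<close>.\<close>
  define d :: "real fps" where "d = Abs_fps (\<lambda>k. e $ k / (4 - 2 * real k))"
  have d: "d $ k * (4 - 2 * real k) = e $ k" for k
    using assms(3) by (cases "k = 2") (auto simp: d_def)
  define \<epsilon> where "\<epsilon> = (\<lambda>n. a n - (\<Sum>k<Suc R. d $ k * growth (n - k)))"
  define \<eta> where "\<eta> = (\<lambda>n. \<epsilon> (Suc n) - 2 * real n * \<epsilon> n)"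
  have "\<forall>\<^sub>F n in sequentially. \<eta> n = (a (Suc n) - 2 * real n * a n) - (\<Sum>k<Suc R. e $ k * growth (n - k))"
    using eventually_ge_at_top[of "Suc R"]
  proof eventually_elim
    case (elim n)
    have "(\<Sum>k<Suc R. d $ k * growth (Suc n - k)) - 2 * real n * (\<Sum>k<Suc R. d $ k * growth (n - k)) =
        (\<Sum>k<Suc R. d $ k * (growth (Suc n - k) - 2 * real n * growth (n - k)))"
      by (simp add: sum_subtractf sum_distrib_left algebra_simps)
    also have "\<dots> = (\<Sum>k<Suc R. e $ k * growth (n - k))"
    proof (rule sum.cong)
      fix k assume "k \<in> {..<Suc R}"
      hence "growth (Suc n - k) - 2 * real n * growth (n - k) = (4 - 2 * real k) * growth (n - k)"
        using elim by (simp add: Suc_diff_le growth_Suc of_nat_diff algebra_simps)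
      thus "d $ k * (growth (Suc n - k) - 2 * real n * growth (n - k)) = e $ k * growth (n - k)"
        by (simp only: d mult.assoc[symmetric])
    qed simp
    finally show ?case by (simp only: \<eta>_def \<epsilon>_def algebra_simps)
  qed
  from landau_o.big.in_cong[OF this] have "\<eta> \<in> O(\<lambda>n. growth (n - Suc R))"
    using assms(1) unfolding asympt_def by blast
  then obtain C where C: "C > 0" "\<forall>\<^sub>F n in sequentially. norm (\<eta> n) \<le> C * norm (growth (n - Suc R))"
    by (rule landau_o.bigE)
  then obtain N0 where N0: "\<And>n. n \<ge> N0 \<Longrightarrow> \<bar>\<eta> n\<bar> \<le> C * growth (n - Suc R)"
    by (auto simp: eventually_at_top_linorder)
  define N where "N = max N0 (Suc (Suc R))"
  \<comment> \<open>Division by the homogeneous solution turns the recurrence into one for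
    differences.\<close>
  define \<delta> where "\<delta> = (\<lambda>n. \<epsilon> n / growth (n - 2))"
  \<comment> \<open>This is the target remainder divided by the same solution. Its decrements are
    \<open>2 * (R - 1)\<close> times the bound for the increments of \<open>\<delta>\<close>, so
    \<open>R >= 2\<close> makes them large enough.\<close>
  define \<psi> where "\<psi> = (\<lambda>n. C * growth (n - Suc R) / growth (n - 2))"
  have "\<bar>\<delta> (Suc n) - \<delta> n\<bar> \<le> \<psi> n - \<psi> (Suc n)" if n: "n \<ge> N" for n
  proof -
    have n': "n > Suc R" "n \<ge> N0" using n by (auto simp: N_def)
    have W1: "growth (n - 1) = 2 * real n * growth (n - 2)" using growth_diff_Suc[of 1 n] n' by (simp add: numeral_2_eq_2)
    have W2: "growth (n - R) = 2 * (real n - real R + 1) * growth (n - Suc R)" using growth_diff_Suc[of R n] n' by simp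
    have "\<epsilon> (Suc n) = 2 * real n * \<epsilon> n + \<eta> n" by (simp add: \<eta>_def)
    hence "\<delta> (Suc n) - \<delta> n = \<eta> n / growth (n - 1)"
      using n' W1 by (simp add: \<delta>_def field_simps numeral_2_eq_2)
    hence "\<bar>\<delta> (Suc n) - \<delta> n\<bar> \<le> C * growth (n - Suc R) / growth (n - 1)"
      using N0[OF n'(2)] by (simp add: divide_right_mono)
    also have "\<dots> \<le> C * growth (n - Suc R) / growth (n - 1) * (2 * (real R - 1))"
    proof -
      have "C * growth (n - Suc R) / growth (n - 1) * 1 \<le> C * growth (n - Suc R) / growth (n - 1) * (2 * (real R - 1))"
        using assms(2) C(1) by (intro mult_left_mono) auto
      thus ?thesis by simp
    qed
    also have "\<dots> = \<psi> n - \<psi> (Suc n)"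
    proof -
      have "\<psi> (Suc n) = C * growth (n - R) / growth (n - 1)" by (simp add: \<psi>_def numeral_2_eq_2)
      also have "\<dots> = C * growth (n - Suc R) / growth (n - 2) * ((real n - real R + 1) / real n)"
      proof -
        have "C * (2 * x * w) / (2 * y * v) = C * w / v * (x / y)" for x y v w :: real by (simp add: mult_ac)
        thus ?thesis unfolding W1 W2 .
      qed
      finally have "\<psi> n - \<psi> (Suc n) = C * growth (n - Suc R) / growth (n - 2) * (1 - (real n - real R + 1) / real n)"
        by (simp only: \<psi>_def right_diff_distrib mult_1_right)
      also have "1 - (real n - real R + 1) / real n = (real R - 1) / real n"
        using n' by (simp add: field_simps)
      finally have *: "\<psi> n - \<psi> (Suc n) = C * growth (n - Suc R) / growth (n - 2) * ((real R - 1) / real n)" .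
      have "C * w / (2 * y * v) * (2 * x) = C * w / v * (x / y)" for x y v w :: real by (simp add: mult_ac)
      thus ?thesis unfolding W1 * .
    qed
    finally show ?thesis .
  qed
  moreover have "\<psi> \<longlonglongrightarrow> 0"
  proof (rule tendsto_sandwich)
    show "\<forall>\<^sub>F n in sequentially. 0 \<le> \<psi> n" using C(1) by (simp add: \<psi>_def)
    show "\<forall>\<^sub>F n in sequentially. \<psi> n \<le> C / real (n - 1)"
      using eventually_gt_at_top[of 2]
    proof eventually_elim
      case (elim n)
      have "growth (n - 2) = 2 * (real n - 1) * growth (n - 3)"
        using growth_diff_Suc[of 2 n] elim by (simp add: numeral_3_eq_3)
      moreover have "growth (n - Suc R) \<le> growth (n - 3)" using assms(2) by (intro growth_mono) auto
      moreover have "(real n - 1) * growth (n - 3) \<ge> 0" using elim by simp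
      ultimately have "growth (n - Suc R) * (real n - 1) \<le> growth (n - 2)"
        using mult_right_mono[of "growth (n - Suc R)" "growth (n - 3)" "real n - 1"] elim
          mult.commute[of "real n - 1" "growth (n - 3)"] mult.assoc[of 2 "real n - 1" "growth (n - 3)"]
        by linarith
      hence "growth (n - Suc R) / growth (n - 2) \<le> 1 / (real n - 1)" using elim by (simp add: field_simps)
      from mult_left_mono[OF this, of C] show ?case using C(1) elim by (simp add: \<psi>_def of_nat_diff)
    qed
    show "(\<lambda>n. C / real (n - 1)) \<longlonglongrightarrow> 0"
      using filterlim_compose[OF lim_const_over_n filterlim_minus_const_nat_at_top] .
  qed simp
  ultimately have "\<exists>L. \<forall>n\<ge>N. \<bar>\<delta> n - L\<bar> \<le> \<psi> n" by (rule telescope_limit)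
  then obtain L where L: "\<And>n. n \<ge> N \<Longrightarrow> \<bar>\<delta> n - L\<bar> \<le> \<psi> n" by blast
  \<comment> \<open>The limit is the multiple of the homogeneous solution contained in the sequence,
    that is, the free coefficient at index 2.\<close>
  have "(\<lambda>n. \<epsilon> n - L * growth (n - 2)) \<in> O(\<lambda>n. growth (n - Suc R))"
  proof (rule landau_o.bigI[OF C(1)])
    show "\<forall>\<^sub>F n in sequentially. norm (\<epsilon> n - L * growth (n - 2)) \<le> C * norm (growth (n - Suc R))"
      using eventually_ge_at_top[of N]
    proof eventually_elim
      case (elim n)
      have "\<epsilon> n - L * growth (n - 2) = (\<delta> n - L) * growth (n - 2)" by (simp add: \<delta>_def field_simps)
      also have "\<bar>\<dots>\<bar> \<le> \<psi> n * growth (n - 2)"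
        unfolding abs_mult using L[OF elim] by (intro mult_mono) auto
      also have "\<dots> = C * growth (n - Suc R)" by (simp add: \<psi>_def)
      finally show ?case by simp
    qed
  qed
  from asympt_add[OF asympt_bigo[OF this] asympt_cmult[OF asympt_growth, of "Suc R" L 2]]
  have "asympt (Suc R) \<epsilon> (fps_const L * fps_X ^ 2)" by simp
  moreover have "asympt (Suc R) (\<lambda>n. \<Sum>k<Suc R. d $ k * growth (n - k)) d"
    by (simp add: asympt_def)
  ultimately have "asympt (Suc R) (\<lambda>n. \<epsilon> n + (\<Sum>k<Suc R. d $ k * growth (n - k))) (fps_const L * fps_X ^ 2 + d)"
    by (rule asympt_add)
  moreover have "(\<lambda>n. \<epsilon> n + (\<Sum>k<Suc R. d $ k * growth (n - k))) = a" by (simp add: \<epsilon>_def)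
  ultimately show ?thesis by metis
qed

section \<open>Full expansions and the alien derivative\<close>

lemma asympt_choice:
  assumes "\<And>R. \<exists>c. asympt R f c"
  shows "\<exists>c. \<forall>R. asympt R f c"
proof -
  obtain C where C: "\<And>R. asympt R f (C R)" using assms by metis
  \<comment> \<open>Expansions of different orders agree by uniqueness, so the diagonal collects
    them into one series.\<close>
  define c where "c = Abs_fps (\<lambda>k. C (Suc k) $ k)"
  have "asympt R f c" for R
  proof (rule asympt_coeff_cong[OF C])
    fix k assume "k < R"
    thus "C R $ k = c $ k"
      using asympt_unique[of "Suc k" f "C R" "C (Suc k)" k] asympt_mono[OF C] C by (simp add: c_def)
  qed
  thus ?thesis by blast
qed

text \<open>The series \<open>c\<close> is the alien derivative of \<open>f\<close>.\<close>
definition fdiv :: "real fps \<Rightarrow> real fps \<Rightarrow> bool" where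
  "fdiv f c \<longleftrightarrow> (\<forall>R. asympt R (fps_nth f) c)"

lemma fdiv_unique:
  assumes "fdiv f c" "fdiv f d"
  shows "c = d"
proof (rule fps_ext)
  fix k show "c $ k = d $ k"
    using assms asympt_unique[of "Suc k" "fps_nth f" c d k] by (simp add: fdiv_def)
qed

lemma fdiv_bigo: "fdiv f c \<Longrightarrow> fps_nth f \<in> O(growth)"
  unfolding fdiv_def by (metis asympt_imp_bigo)

lemma fdiv_add: "fdiv f c \<Longrightarrow> fdiv g d \<Longrightarrow> fdiv (f + g) (c + d)"
  unfolding fdiv_def fps_add_nth[abs_def] by (intro allI asympt_add) simp_all

lemma fdiv_diff: "fdiv f c \<Longrightarrow> fdiv g d \<Longrightarrow> fdiv (f - g) (c - d)"
  unfolding fdiv_def fps_sub_nth[abs_def] by (intro allI asympt_diff) simp_all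

lemma fdiv_mult: "fdiv f c \<Longrightarrow> fdiv g d \<Longrightarrow> fdiv (f * g) (f * d + g * c)"
  unfolding fdiv_def by (intro allI asympt_mult) simp_all

lemma fdiv_inverse: "fdiv f c \<Longrightarrow> f $ 0 \<noteq> 0 \<Longrightarrow> fdiv (inverse f) (- c * (inverse f)\<^sup>2)"
  unfolding fdiv_def by (intro allI asympt_inverse) simp_all

lemma fdiv_ev_0:
  assumes "\<And>n. n > N \<Longrightarrow> f $ n = 0"
  shows "fdiv f 0"
  unfolding fdiv_def
proof (intro allI asympt_bigo)
  fix R
  have "\<forall>\<^sub>F n in sequentially. f $ n = 0"
    using eventually_gt_at_top[of N] by eventually_elim (rule assms)
  from landau_o.big.in_cong[OF this, of "\<lambda>n. growth (n - R)"] show "fps_nth f \<in> O(\<lambda>n. growth (n - R))" by simp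
qed

lemma fdiv_const: "fdiv (fps_const a) 0"
  by (rule fdiv_ev_0[of 0]) auto

lemma fdiv_1: "fdiv 1 0" and fdiv_numeral: "fdiv (numeral k) 0" and fdiv_X: "fdiv fps_X 0"
  using fdiv_const[of 1] fdiv_const[of "numeral k"] fdiv_ev_0[of 1 fps_X] by (simp_all flip: numeral_fps_const)

lemma fdiv_power: "fdiv f c \<Longrightarrow> fdiv (f ^ n) (of_nat n * f ^ (n - 1) * c)"
proof (induction n)
  case 0
  show ?case using fdiv_1 by simp
next
  case (Suc n)
  have "f * (of_nat n * f ^ (n - 1) * c) + f ^ n * c = of_nat (Suc n) * f ^ (Suc n - 1) * c"
    by (cases n) (simp_all add: algebra_simps)
  thus ?case using fdiv_mult[OF Suc.prems Suc.IH[OF Suc.prems]] by simp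
qed

lemma fdiv_shift: "fdiv f c \<Longrightarrow> c $ 0 = 0 \<Longrightarrow> fdiv (fps_shift 1 f) (fps_shift 1 c)"
  unfolding fdiv_def fps_shift_nth[abs_def] Suc_eq_plus1[symmetric] by (intro allI asympt_unshift) simp_all

text \<open>The formula comes from \<open>2 n growth (n - k) = growth (n - k + 1) + (2 k - 4) growth (n - k)\<close>.\<close>
definition dcoeff :: "real fps \<Rightarrow> real fps" where
  "dcoeff c = Abs_fps (\<lambda>k. (c $ Suc k + (2 * real k - 4) * c $ k) / 2)"

lemma fps_X_mult_deriv_nth: "(fps_X * fps_deriv f) $ n = real n * f $ n" for f :: "real fps"
  by (cases n) auto

lemma fdiv_X_deriv: "fdiv f c \<Longrightarrow> c $ 0 = 0 \<Longrightarrow> fdiv (fps_X * fps_deriv f) (dcoeff c)"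
proof -
  assume "fdiv f c" "c $ 0 = 0"
  moreover have "fps_nth (fps_X * fps_deriv f) = (\<lambda>n. real n * f $ n)"
    by (rule ext) (rule fps_X_mult_deriv_nth)
  ultimately show ?thesis unfolding fdiv_def dcoeff_def by (simp add: asympt_n_mult)
qed

subsection \<open>The generating functions as formal power series\<close>

text \<open>Differentiating \<open>h^2 * (1 - fps_X^2) = 1\<close> gives
  \<open>h' * (1 - fps_X^2) = fps_X * h\<close>, whose coefficients form the recurrence.\<close>

lemma inverse_sqrt_nth_Suc_Suc:
  "inverse (fps_sqrt (1 - fps_X\<^sup>2)) $ Suc (Suc n) =
     (real n + 1) / (real n + 2) * inverse (fps_sqrt (1 - fps_X\<^sup>2)) $ n"
proof -
  define s where "s = fps_sqrt (1 - fps_X\<^sup>2)"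
  define h where "h = inverse s"
  have sh: "s * h = 1" unfolding h_def s_def by (rule inverse_mult_eq_1') simp
  have s2: "s\<^sup>2 = 1 - fps_X\<^sup>2" unfolding s_def by (rule fps_sqrt_square)
  have h2: "h\<^sup>2 * (1 - fps_X\<^sup>2) = 1"
    using sh by (simp flip: s2 power_mult_distrib add: mult.commute)
  hence "fps_deriv (h\<^sup>2 * (1 - fps_X\<^sup>2)) = 0" by simp
  hence "2 * h * (fps_deriv h * (1 - fps_X\<^sup>2) - fps_X * h) = 0"
    by (simp add: power2_eq_square algebra_simps)
  moreover have "h \<noteq> 0" using sh by auto
  ultimately have "fps_deriv h * (1 - fps_X\<^sup>2) = fps_X * h" by simp
  hence "(fps_deriv h * (1 - fps_X\<^sup>2)) $ Suc n = (fps_X * h) $ Suc n" by simp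
  moreover have "(fps_deriv h * (1 - fps_X\<^sup>2)) $ Suc n = (real n + 2) * h $ Suc (Suc n) - real n * h $ n"
    by (cases n) (simp_all add: right_diff_distrib fps_X_power_mult_right_nth)
  ultimately show ?thesis by (simp add: h_def s_def field_simps)
qed

definition Zser :: "real fps" where "Zser = expval 1"

lemma Zser_nth_0: "Zser $ 0 = 1" by (simp add: Zser_def expval_low)

lemma Zser_nth_Suc: "Zser $ Suc n = (2 * real n + 1)\<^sup>2 / (2 * real n + 2) * Zser $ n"
proof -
  have "inverse (fps_sqrt (1 - fps_X\<^sup>2)) $ (2 * Suc n) =
      (2 * real n + 1) / (2 * real n + 2) * inverse (fps_sqrt (1 - fps_X\<^sup>2)) $ (2 * n)"
    using inverse_sqrt_nth_Suc_Suc[of "2 * n"] by simp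
  thus ?thesis by (simp add: Zser_def expval_nth odd_dfact_def power2_eq_square)
qed

text \<open>Multiplying by \<open>1 / (1 - fps_X)\<close> forms partial sums. The odd coefficients
  of \<open>h\<close> vanish, and the even ones are central binomial coefficients over
  \<open>4 ^ n\<close>, whose partial sums have a closed form.\<close>

lemma geometric_inverse_sqrt_nth:
  defines "h \<equiv> inverse (fps_sqrt (1 - fps_X\<^sup>2))"
  shows "(1 / (1 - fps_X) * h) $ (2 * n) = (2 * real n + 1) * h $ (2 * n)"
    and "(1 / (1 - fps_X) * h) $ Suc (2 * n) = (2 * real n + 1) * h $ (2 * n)"
proof -
  have nth: "(1 / (1 - fps_X) * h) $ m = (\<Sum>k\<le>m. h $ k)" for m
    unfolding fps_1_over_1_minus_X by (subst mult.commute) (simp add: fps_mult_nth atLeast0AtMost)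
  have rec: "h $ Suc (Suc m) = (real m + 1) / (real m + 2) * h $ m" for m
    unfolding h_def by (rule inverse_sqrt_nth_Suc_Suc)
  have odd: "h $ Suc (2 * m) = 0" for m
  proof (induction m)
    case 0 show ?case unfolding h_def using inverse_sqrt_low by simp
  next
    case (Suc m) thus ?case using rec[of "Suc (2 * m)"] by simp
  qed
  show even: "(1 / (1 - fps_X) * h) $ (2 * n) = (2 * real n + 1) * h $ (2 * n)"
    unfolding nth
  proof (induction n)
    case (Suc n)
    have "(\<Sum>k\<le>2 * Suc n. h $ k) = (\<Sum>k\<le>2*n. h $ k) + h $ (2 * Suc n)" by (simp add: odd)
    also have "\<dots> = (2 * real n + 1) * h $ (2 * n) + h $ (2 * Suc n)" by (simp add: Suc.IH)
    also have "(2 * real n + 1) * h $ (2 * n) = (2 * real n + 2) * h $ (2 * Suc n)"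
      using rec[of "2 * n"] by (simp add: field_simps)
    finally show ?case by (simp add: algebra_simps)
  qed simp
  show "(1 / (1 - fps_X) * h) $ Suc (2 * n) = (2 * real n + 1) * h $ (2 * n)"
    using even odd[of n] unfolding nth by simp
qed

definition Zser_e :: "real fps" where "Zser_e = expval (1 / (1 - fps_X))"

lemma Zser_e_nth: "Zser_e $ n = (2 * real n + 1) * Zser $ n"
  unfolding Zser_e_def Zser_def expval_nth geometric_inverse_sqrt_nth by simp

text \<open>Raising the double factorial by one step supplies the same factor \<open>2 n + 1\<close>
  as the partial sums do. Hence \<open>W_jj\<close> and \<open>W_e\<close> are one series, and all
  Green functions can be expressed through it.\<close>

lemma shift_expval_X2: "fps_shift 1 (expval (fps_X\<^sup>2)) = Zser_e"
proof (rule fps_ext)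
  fix n
  have "(fps_X\<^sup>2 * inverse (fps_sqrt (1 - fps_X\<^sup>2))) $ (2 * Suc n) = inverse (fps_sqrt (1 - fps_X\<^sup>2)) $ (2 * n)"
    by (subst fps_X_power_mult_nth) simp
  thus "fps_shift 1 (expval (fps_X\<^sup>2)) $ n = Zser_e $ n"
    by (simp add: Zser_e_nth Zser_def expval_nth odd_dfact_def del: fps_X_power_mult_nth)
qed

definition Zser_je :: "real fps" where "Zser_je = fps_shift 1 (expval (fps_X / (1 - fps_X)))"

lemma Zser_je_nth: "Zser_je $ n = (2 * real n + 1)\<^sup>2 * Zser $ n"
proof -
  have "fps_X / (1 - fps_X) * g = fps_X * (1 / (1 - fps_X) * g)" for g :: "real fps"
    by (simp add: fps_divide_unit mult_ac)
  hence "(fps_X / (1 - fps_X) * inverse (fps_sqrt (1 - fps_X\<^sup>2))) $ (2 * Suc n) =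
      (1 / (1 - fps_X) * inverse (fps_sqrt (1 - fps_X\<^sup>2))) $ Suc (2 * n)"
    by (simp only: fps_X_mult_nth) simp
  also note geometric_inverse_sqrt_nth(2)
  finally show ?thesis by (simp add: Zser_je_def expval_nth Zser_def odd_dfact_def power2_eq_square mult_ac)
qed

lemma Zser_e_eq: "Zser_e = Zser + 2 * fps_X * fps_deriv Zser"
proof (rule fps_ext)
  fix n show "Zser_e $ n = (Zser + 2 * fps_X * fps_deriv Zser) $ n"
    by (cases n) (simp_all add: Zser_e_nth mult.assoc algebra_simps numeral_fps_const)
qed

lemma Zser_je_eq: "fps_X * Zser_je = Zser_e - Zser"
proof (rule fps_ext)
  fix n show "(fps_X * Zser_je) $ n = (Zser_e - Zser) $ n"
  proof (cases n)
    case (Suc m)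
    have "(2 * real m + 2) * Zser $ Suc m = (2 * real m + 1)\<^sup>2 * Zser $ m"
      by (simp add: Zser_nth_Suc)
    thus ?thesis by (simp add: Suc Zser_e_nth Zser_je_nth algebra_simps)
  qed (simp add: Zser_e_nth)
qed

text \<open>The two-term recurrence of \<open>Zser\<close>, with
  \<open>(2 n + 1)^2 = 1 + 8 n + 4 n (n - 1)\<close> distributed over the derivatives.\<close>

lemma Zser_ode: "2 * fps_deriv Zser = Zser + 8 * fps_X * fps_deriv Zser + 4 * fps_X\<^sup>2 * fps_deriv (fps_deriv Zser)"
proof (rule fps_ext)
  fix n
  have "(fps_X\<^sup>2 * fps_deriv (fps_deriv Zser)) $ n = real n * (real n - 1) * Zser $ n"
    by (cases n; cases "n - 1") (auto simp: fps_X_power_mult_nth)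
  moreover have "(fps_X * fps_deriv Zser) $ n = real n * Zser $ n" by (rule fps_X_mult_deriv_nth)
  moreover have "2 * (real n + 1) * Zser $ Suc n = (2 * real n + 1)\<^sup>2 * Zser $ n"
    by (simp add: Zser_nth_Suc field_simps)
  moreover have "(Zser + 8 * P + 4 * Q) $ n = Zser $ n + 8 * P $ n + 4 * Q $ n" for P Q :: "real fps"
    by (simp add: numeral_fps_const)
  moreover have "(2 * fps_deriv Zser) $ n = 2 * (real n + 1) * Zser $ Suc n"
    by (simp add: numeral_fps_const)
  ultimately show "(2 * fps_deriv Zser) $ n = (Zser + 8 * fps_X * fps_deriv Zser + 4 * fps_X\<^sup>2 * fps_deriv (fps_deriv Zser)) $ n"
    by (simp only: mult.assoc) (simp add: power2_eq_square algebra_simps)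
qed

section \<open>Reduction of the Green functions to one logarithmic derivative\<close>

definition W_ser :: "real fps" where "W_ser = Zser_e * inverse Zser"

lemma W_ser_Zser: "W_ser * Zser = Zser_e"
  by (simp add: W_ser_def Zser_nth_0 inverse_mult_eq_1 mult.assoc)

lemma W_ser_nth_0: "W_ser $ 0 = 1"
  by (simp add: W_ser_def Zser_e_nth Zser_nth_0)

lemma Zser_neq_0: "Zser \<noteq> 0" using Zser_nth_0 by auto

text \<open>The logarithmic derivative of a solution of a linear equation of second order satisfies
  a Riccati equation. Multiplication by \<open>Zser\<^sup>2\<close> clears the denominators.\<close>

lemma W_ser_riccati: "2 * fps_X\<^sup>2 * fps_deriv W_ser = W_ser - 1 - fps_X * W_ser\<^sup>2"
proof -
  define D where "D = fps_deriv Zser"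
  have 1: "W_ser * Zser = Zser + 2 * fps_X * D" using W_ser_Zser Zser_e_eq by (simp add: D_def)
  have "fps_deriv (W_ser * Zser) = fps_deriv (Zser + 2 * fps_X * D)" using 1 by simp
  hence 2: "fps_deriv W_ser * Zser + W_ser * D = 3 * D + 2 * fps_X * fps_deriv D"
    by (simp add: D_def algebra_simps)
  have 3: "2 * D = Zser + 8 * fps_X * D + 4 * fps_X\<^sup>2 * fps_deriv D"
    using Zser_ode by (simp add: D_def)
  have "(2 * fps_X\<^sup>2 * fps_deriv W_ser - (W_ser - 1 - fps_X * W_ser\<^sup>2)) * Zser\<^sup>2 = 0"
    using 1 2 3 by algebra
  thus ?thesis using Zser_neq_0 by simp
qed

lemma fps_sqrt_square':
  assumes "f $ 0 = 1"
  shows "(fps_sqrt f)\<^sup>2 = f"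
  using power_radical[of f "\<lambda>k. root k" 1] assms by (simp add: numeral_2_eq_2)

text \<open>Both propagators are \<open>W_ser\<close>, and \<open>Zser_je_eq\<close> expresses the
  numerator of the vertex through it as well. The identities are kept free of division.\<close>

lemma G_phi_s_eq: "fps_X * G_phi_s * W_ser ^ 3 = W_ser - 1"
  and neg_G_eq: "- G_phi2 * W_ser = 1" "- G_s * W_ser = 1"
proof -
  have W_ser: "Zser_e / Zser = W_ser" by (simp add: W_ser_def fps_divide_unit Zser_nth_0)
  have W: "W_jj = fps_to_fls W_ser" "W_e = fps_to_fls W_ser" "W_je = fps_to_fls (Zser_je / Zser)"
    unfolding W_power_series shift_expval_X2 W_ser[symmetric]
    by (simp_all only: Zser_e_def Zser_def Zser_je_def)
  have vv0: "fps_to_fls W_ser \<noteq> 0" using W_ser_nth_0 by auto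
  have "fps_to_fls (- G_phi2 * W_ser) = 1" "fps_to_fls (- G_s * W_ser) = 1"
    using G_power_series(1,2) vv0 by (simp_all add: W fls_times_fps_to_fls)
  thus "- G_phi2 * W_ser = 1" "- G_s * W_ser = 1"
    by (metis fps_to_fls_eq_iff fps_one_to_fls)+
  have "fps_to_fls (G_phi_s * W_ser ^ 3) = fps_to_fls (Zser_je / Zser)"
    using vv0 by (simp add: fls_times_fps_to_fls fps_to_fls_power G_power_series(3) W power3_eq_cube power2_eq_square)
  hence "G_phi_s * W_ser ^ 3 = Zser_je / Zser" by simp
  hence "G_phi_s * W_ser ^ 3 * Zser = Zser_je"
    by (simp add: fps_divide_unit Zser_nth_0 mult.assoc inverse_mult_eq_1)
  hence "fps_X * G_phi_s * W_ser ^ 3 * Zser = fps_X * Zser_je" by (simp add: mult.assoc)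
  also have "\<dots> = (W_ser - 1) * Zser" by (simp add: Zser_je_eq W_ser_Zser left_diff_distrib)
  finally have "fps_X * G_phi_s * W_ser ^ 3 * Zser = (W_ser - 1) * Zser" .
  thus "fps_X * G_phi_s * W_ser ^ 3 = W_ser - 1" using Zser_neq_0 by simp
qed

text \<open>The square root enters the invariant charge only squared, so it disappears and the
  charge is \<open>G_phi_s^2 * W_ser^3\<close>.\<close>

lemma invcharge_eq: "fps_X\<^sup>2 * invcharge * W_ser ^ 3 = (W_ser - 1)\<^sup>2"
proof -
  define r where "r = fps_sqrt (- G_phi2)"
  have r2: "r\<^sup>2 = - G_phi2" unfolding r_def using G_power_series(4) by (intro fps_sqrt_square') simp
  have r0: "r $ 0 = 1" using G_power_series(4) by (simp add: r_def)
  have d0: "(r * (- G_s)) $ 0 = 1" using r0 G_power_series(5) by simp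
  have "invcharge * (r * (- G_s))\<^sup>2 = G_phi_s\<^sup>2"
  proof -
    have "G_phi_s / (r * (- G_s)) * (r * (- G_s)) = G_phi_s"
      using d0 by (simp add: fps_divide_unit mult.assoc inverse_mult_eq_1 del: mult_minus_right)
    thus ?thesis unfolding invcharge_def r_def[symmetric] by (metis power_mult_distrib)
  qed
  hence "invcharge * (- G_phi2 * (- G_s)\<^sup>2) = G_phi_s\<^sup>2"
    by (simp add: power_mult_distrib r2)
  hence "invcharge * ((- G_phi2 * W_ser) * (- G_s * W_ser)\<^sup>2) * (W_ser ^ 3 * fps_X\<^sup>2) = (fps_X * G_phi_s * W_ser ^ 3)\<^sup>2"
    by algebra
  thus ?thesis unfolding G_phi_s_eq neg_G_eq by (simp add: algebra_simps)
qed

section \<open>The renormalised coupling and the differential equation for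
  \<open>u_ren\<close>\<close>

definition ren_of_hbar :: "real fps" where "ren_of_hbar = fps_X * invcharge"

lemma ren_of_hbar_low: "ren_of_hbar $ 0 = 0" "ren_of_hbar $ Suc 0 = 1"
  by (simp_all add: ren_of_hbar_def invcharge_nth_0)

lemma hbar_of_ren_low: "hbar_of_ren $ 0 = 0" "hbar_of_ren $ Suc 0 = 1"
  and hbar_of_ren_eq: "fps_X = hbar_of_ren * (invcharge oo hbar_of_ren)"
  using theI'[OF hbar_of_ren_ex1] unfolding hbar_of_ren_def[symmetric] by simp_all

lemma ren_of_hbar_compose: "ren_of_hbar oo hbar_of_ren = fps_X"
  using hbar_of_ren_eq hbar_of_ren_low by (simp add: ren_of_hbar_def fps_compose_mult_distrib)

lemma compose_ren_of_hbar: "hbar_of_ren oo ren_of_hbar = fps_X"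
proof -
  have "fps_inv ren_of_hbar = fps_inv ren_of_hbar oo (ren_of_hbar oo hbar_of_ren)"
    by (simp add: ren_of_hbar_compose)
  also have "\<dots> = (fps_inv ren_of_hbar oo ren_of_hbar) oo hbar_of_ren"
    using ren_of_hbar_low hbar_of_ren_low by (simp add: fps_compose_assoc)
  also have "\<dots> = hbar_of_ren"
    using ren_of_hbar_low hbar_of_ren_low by (simp add: fps_inv)
  finally show ?thesis using fps_inv[of ren_of_hbar] ren_of_hbar_low by simp
qed

definition u_ren :: "real fps" where "u_ren = (W_ser - 1) oo hbar_of_ren"

lemma W_ser_compose: "W_ser oo hbar_of_ren = 1 + u_ren"
  by (simp add: u_ren_def fps_compose_sub_distrib)

text \<open>This is \<open>invcharge_eq\<close> in the renormalised variable. It expresses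
  \<open>hbar_of_ren\<close> through \<open>u_ren\<close>, which permits its elimination
  later.\<close>

lemma u_ren_hbar: "fps_X * hbar_of_ren * (1 + u_ren) ^ 3 = u_ren\<^sup>2"
proof -
  have "(fps_X\<^sup>2 * invcharge * W_ser ^ 3) oo hbar_of_ren = (W_ser - 1)\<^sup>2 oo hbar_of_ren"
    by (simp add: invcharge_eq)
  hence "hbar_of_ren\<^sup>2 * (invcharge oo hbar_of_ren) * (1 + u_ren) ^ 3 = u_ren\<^sup>2"
    using hbar_of_ren_low
    by (simp add: fps_compose_mult_distrib fps_compose_power[symmetric] u_ren_def[symmetric] W_ser_compose)
  thus ?thesis by (subst hbar_of_ren_eq) (simp add: power2_eq_square mult_ac)
qed

text \<open>With \<open>H = hbar_of_ren\<close>, the vertex identity reads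
  \<open>H * G * (1 + u_ren)^3 = u_ren\<close> and the charge identity
  \<open>fps_X * H * (1 + u_ren)^3 = u_ren^2\<close>. Their quotient is the claim.\<close>

lemma u_ren_z: "u_ren = fps_X * z_vertex"
proof -
  define G where "G = G_phi_s oo hbar_of_ren"
  have G0: "G $ 0 = 1" using G_power_series(6) by (simp add: G_def)
  have "(fps_X * G_phi_s * W_ser ^ 3) oo hbar_of_ren = (W_ser - 1) oo hbar_of_ren"
    by (simp add: G_phi_s_eq)
  hence 1: "hbar_of_ren * G * (1 + u_ren) ^ 3 = u_ren"
    using hbar_of_ren_low
    by (simp add: fps_compose_mult_distrib fps_compose_power[symmetric] u_ren_def[symmetric] W_ser_compose G_def)
  have zG: "z_vertex * G = 1"
    using G0 by (simp add: z_vertex_def G_def fps_divide_unit inverse_mult_eq_1)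
  have "u_ren * z_vertex = hbar_of_ren * (1 + u_ren) ^ 3 * (z_vertex * G)"
    by (subst 1[symmetric]) (simp only: mult_ac)
  hence "u_ren * (fps_X * z_vertex) = fps_X * hbar_of_ren * (1 + u_ren) ^ 3" by (simp add: zG mult_ac)
  hence "u_ren * (fps_X * z_vertex) = u_ren * u_ren" by (simp add: u_ren_hbar power2_eq_square)
  moreover have "u_ren \<noteq> 0"
  proof
    assume "u_ren = 0"
    with u_ren_hbar hbar_of_ren_low(2) show False by auto
  qed
  ultimately show ?thesis by simp
qed

lemma z_vertex_nth_0: "z_vertex $ 0 = 1"
  using G_power_series(6) by (simp add: z_vertex_def fps_divide_unit)

lemma u_ren_low: "u_ren $ 0 = 0" "u_ren $ Suc 0 = 1"
  by (simp_all add: u_ren_z z_vertex_nth_0)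

text \<open>Composing the Riccati equation with \<open>H\<close> and using the chain rule relates
  \<open>u'\<close>, \<open>H\<close> and \<open>H'\<close>. Both \<open>H\<close> and
  \<open>H'\<close> are then eliminated by \<open>u_ren_hbar\<close> and its derivative.\<close>

lemma u_ren_ode:
  "2 * u_ren\<^sup>2 * (fps_X * fps_deriv u_ren) =
     (fps_X * (1 + u_ren) - u_ren) * (1 + u_ren) * ((2 - u_ren) * (fps_X * fps_deriv u_ren) - (1 + u_ren) * u_ren)"
proof -
  define H where "H = hbar_of_ren"
  define u' where "u' = fps_deriv u_ren"
  define H' where "H' = fps_deriv H"
  define p where "p = fps_deriv W_ser oo H"
  have H0: "H $ 0 = 0" using hbar_of_ren_low by (simp add: H_def)
  have u': "u' = p * H'"
    using fps_compose_deriv[OF H0, of "W_ser - 1"] by (simp add: u'_def u_ren_def p_def H'_def H_def)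
  have "(2 * fps_X\<^sup>2 * fps_deriv W_ser) oo H = (W_ser - 1 - fps_X * W_ser\<^sup>2) oo H" by (simp add: W_ser_riccati)
  hence p: "2 * H\<^sup>2 * p = u_ren - H * (1 + u_ren)\<^sup>2"
    using H0 W_ser_compose
    by (simp add: fps_compose_mult_distrib fps_compose_power[symmetric] fps_compose_sub_distrib p_def H_def)
  have h: "fps_X * H * (1 + u_ren) ^ 3 = u_ren\<^sup>2" using u_ren_hbar by (simp add: H_def)
  have "fps_deriv (fps_X * H * (1 + u_ren) ^ 3) = fps_deriv (u_ren\<^sup>2)" using h by simp
  hence h': "H * (1 + u_ren) ^ 3 + fps_X * H' * (1 + u_ren) ^ 3 + 3 * fps_X * H * (1 + u_ren)\<^sup>2 * u' = 2 * u_ren * u'"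
    by (simp add: u'_def H'_def power2_eq_square power3_eq_cube algebra_simps)
  define K where "K = 1 + u_ren"
  have eq: "2 * H\<^sup>2 * u' = (u_ren - H * K\<^sup>2) * H'"
    using p by (simp add: u' K_def mult.assoc[symmetric])
  \<comment> \<open>The factor \<open>fps_X * K ^ 3\<close> completes every \<open>H\<close> to
    \<open>fps_X * H * K ^ 3 = u_ren\<^sup>2\<close>.\<close>
  have "fps_X * K ^ 3 * (2 * u_ren * u' - H * K ^ 3 - 3 * fps_X * H * K\<^sup>2 * u') =
      2 * fps_X * K ^ 3 * u_ren * u' - K ^ 3 * (fps_X * H * K ^ 3) - 3 * K\<^sup>2 * fps_X * u' * (fps_X * H * K ^ 3)"
    by (simp add: algebra_simps)
  also have "\<dots> = K\<^sup>2 * u_ren * (2 * fps_X * K * u' - K * u_ren - 3 * fps_X * u_ren * u')"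
    unfolding h[folded K_def] by (simp add: algebra_simps power2_eq_square power3_eq_cube)
  also have "2 * fps_X * K * u' - K * u_ren - 3 * fps_X * u_ren * u' = (2 - u_ren) * (fps_X * u') - K * u_ren"
    by (simp add: K_def algebra_simps)
  also have "2 * u_ren * u' - H * K ^ 3 - 3 * fps_X * H * K\<^sup>2 * u' = fps_X * K ^ 3 * H'"
    unfolding h'[folded K_def, symmetric] by (simp add: mult_ac)
  finally have H': "fps_X * K ^ 3 * (fps_X * K ^ 3 * H') = K\<^sup>2 * u_ren * ((2 - u_ren) * (fps_X * u') - K * u_ren)" .
  have "2 * (fps_X * H * K ^ 3)\<^sup>2 * (fps_X * K) * u' = (2 * H\<^sup>2 * u') * ((fps_X * K) * (fps_X * K ^ 3)\<^sup>2)"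
    by (simp add: power_mult_distrib mult_ac)
  also have "\<dots> = (fps_X * K * u_ren - fps_X * H * K ^ 3) * (fps_X * K ^ 3 * (fps_X * K ^ 3 * H'))"
    unfolding eq by (simp add: power2_eq_square power3_eq_cube algebra_simps)
  finally have "2 * (u_ren\<^sup>2)\<^sup>2 * (fps_X * K) * u' = (fps_X * K * u_ren - u_ren\<^sup>2) * (K\<^sup>2 * u_ren * ((2 - u_ren) * (fps_X * u') - K * u_ren))"
    unfolding H' h[folded K_def] .
  hence "u_ren ^ 2 * K * (2 * u_ren\<^sup>2 * (fps_X * u') -
     (fps_X * K - u_ren) * K * ((2 - u_ren) * (fps_X * u') - K * u_ren)) = 0"
    by (simp add: power2_eq_square algebra_simps)
  moreover have "u_ren \<noteq> 0" "1 + u_ren \<noteq> 0"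
  proof -
    show "u_ren \<noteq> 0" using u_ren_low by auto
    show "1 + u_ren \<noteq> 0" using u_ren_low(1) by (metis fps_add_nth fps_one_nth add.right_neutral one_neq_zero fps_zero_nth)
  qed
  ultimately show ?thesis by (simp add: u'_def K_def)
qed

subsection \<open>The partition function after a Moebius substitution\<close>

definition moeb_den :: "real fps" where "moeb_den = inverse (1 + 5 * fps_X)"
definition moeb :: "real fps" where "moeb = fps_X * moeb_den"

lemma moeb_den_eq: "(1 + 5 * fps_X) * moeb_den = 1"
  unfolding moeb_den_def by (rule inverse_mult_eq_1') simp

lemma moeb_den_low: "moeb_den $ 0 = 1" "moeb_den $ Suc 0 = - 5"
proof -
  show 0: "moeb_den $ 0 = 1" by (simp add: moeb_den_def)
  have "((1 + 5 * fps_X) * moeb_den) $ Suc 0 = 0" unfolding moeb_den_eq by simp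
  thus "moeb_den $ Suc 0 = - 5" by (simp add: 0 numeral_fps_const distrib_right mult.assoc)
qed

lemma moeb_low: "moeb $ 0 = 0"
  by (simp add: moeb_def)

lemma moeb_den_deriv: "fps_deriv moeb_den = - 5 * moeb_den\<^sup>2"
  unfolding moeb_den_def by (subst fps_inverse_deriv) (simp_all add: numeral_fps_const)

lemma moeb_deriv: "fps_deriv moeb = moeb_den\<^sup>2"
proof -
  have "fps_deriv moeb = moeb_den - 5 * fps_X * moeb_den\<^sup>2" by (simp add: moeb_def moeb_den_deriv)
  also have "\<dots> = moeb_den * (1 - 5 * fps_X * moeb_den)" by (simp add: algebra_simps power2_eq_square)
  also have "1 - 5 * fps_X * moeb_den = moeb_den" using moeb_den_eq by (simp add: algebra_simps)
  finally show ?thesis by (simp add: power2_eq_square)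
qed

lemma moeb_power_nth:
  assumes "0 < k" "k \<le> n"
  shows "(moeb ^ k) $ n = real ((n - 1) choose (n - k)) * (-5) ^ (n - k)"
proof -
  have "moeb_den ^ k = inverse ((1 - fps_const (-5) * fps_X) ^ k)"
    by (simp add: moeb_den_def fps_inverse_power numeral_fps_const flip: fps_const_neg)
  also have "\<dots> = Abs_fps (\<lambda>i. of_nat ((k + i - 1) choose i) * (-5) ^ i)"
    using assms by (intro one_minus_const_fps_X_neg_power')
  finally have "moeb_den ^ k = Abs_fps (\<lambda>i. of_nat ((k + i - 1) choose i) * (-5) ^ i)" .
  thus ?thesis using assms by (simp add: moeb_def power_mult_distrib fps_X_power_mult_nth)
qed

definition Zser_moeb :: "real fps" where "Zser_moeb = Zser oo moeb"

text \<open>The Moebius change of variables moves all dependence on the substitution to the left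
  side. The right side has coefficients \<open>2 * (n + 1) * (a (n + 1) - 2 * n * a n)\<close>, the
  shape treated by \<open>asympt_recurrence\<close>.\<close>

lemma Zser_moeb_ode: "Zser_moeb * moeb_den\<^sup>2 = 2 * fps_deriv Zser_moeb - 8 * (fps_X * fps_deriv Zser_moeb) - 4 * (fps_X\<^sup>2 * fps_deriv (fps_deriv Zser_moeb))"
proof -
  define A1 where "A1 = fps_deriv Zser oo moeb"
  define A2 where "A2 = fps_deriv (fps_deriv Zser) oo moeb"
  have d1: "fps_deriv Zser_moeb = A1 * moeb_den\<^sup>2"
    unfolding Zser_moeb_def A1_def by (simp add: fps_compose_deriv moeb_low moeb_deriv)
  have "fps_deriv A1 = A2 * moeb_den\<^sup>2"
    unfolding A1_def A2_def by (simp add: fps_compose_deriv moeb_low moeb_deriv)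
  hence d2: "fps_deriv (fps_deriv Zser_moeb) = A2 * moeb_den ^ 4 - 10 * (A1 * moeb_den ^ 3)"
    by (simp add: d1 moeb_den_deriv power2_eq_square power3_eq_cube power4_eq_xxxx algebra_simps)
  have num: "(numeral k :: real fps) oo moeb = numeral k" for k
    by (simp add: numeral_fps_const)
  have "(2 * fps_deriv Zser) oo moeb = (Zser + 8 * fps_X * fps_deriv Zser + 4 * fps_X\<^sup>2 * fps_deriv (fps_deriv Zser)) oo moeb"
    by (simp only: Zser_ode[symmetric])
  hence ode: "2 * A1 = Zser_moeb + 8 * (fps_X * moeb_den) * A1 + 4 * (fps_X * moeb_den)\<^sup>2 * A2"
    by (simp add: fps_compose_add_distrib fps_compose_mult_distrib moeb_low num fps_compose_power[symmetric]
        flip: A1_def A2_def Zser_moeb_def moeb_def)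
  have one: "5 * (fps_X * moeb_den) = 1 - moeb_den" using moeb_den_eq by (simp add: algebra_simps)
  have "2 * fps_deriv Zser_moeb - 8 * (fps_X * fps_deriv Zser_moeb) - 4 * (fps_X\<^sup>2 * fps_deriv (fps_deriv Zser_moeb)) =
      moeb_den\<^sup>2 * (2 * A1 - 8 * fps_X * A1 - 4 * (fps_X * moeb_den)\<^sup>2 * A2 + 8 * fps_X * A1 * (5 * (fps_X * moeb_den)))"
    unfolding d2 unfolding d1 by (simp add: power2_eq_square power3_eq_cube power4_eq_xxxx algebra_simps)
  also have "\<dots> = moeb_den\<^sup>2 * Zser_moeb"
    unfolding ode one by (simp add: algebra_simps)
  finally show ?thesis by (simp add: mult.commute)
qed

lemma Zser_moeb_recurrence: "(Zser_moeb * moeb_den\<^sup>2) $ n = 2 * (real n + 1) * (Zser_moeb $ Suc n - 2 * real n * Zser_moeb $ n)"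
proof -
  have num: "(2 * P - 8 * Q - 4 * R) $ n = 2 * P $ n - 8 * Q $ n - 4 * R $ n" for P Q R :: "real fps"
    by (simp add: numeral_fps_const)
  have "(fps_X\<^sup>2 * fps_deriv (fps_deriv Zser_moeb)) $ n = real n * (real n - 1) * Zser_moeb $ n"
    by (cases n; cases "n - 1") (auto simp: fps_X_power_mult_nth)
  moreover have "(fps_X * fps_deriv Zser_moeb) $ n = real n * Zser_moeb $ n" by (rule fps_X_mult_deriv_nth)
  ultimately show ?thesis unfolding Zser_moeb_ode num by (simp add: algebra_simps)
qed

section \<open>Leading growth and full expansion of the substituted partition function\<close>

definition Z_ratio :: "nat \<Rightarrow> real" where "Z_ratio n = pi * Zser $ n / (2 ^ n * fact (n - 1))"

text \<open>Consecutive quotients of \<open>Z_ratio\<close> and of the Wallis product combine so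
  that their product has a closed form. The Wallis limit \<open>pi / 2\<close> then gives 1.\<close>

lemma Z_ratio_tendsto: "Z_ratio \<longlonglongrightarrow> 1"
proof -
  define p where "p = (\<lambda>n. \<Prod>k=1..n. (4 * real k ^ 2) / (4 * real k ^ 2 - 1))"
  have p: "p \<longlonglongrightarrow> pi / 2" unfolding p_def by (rule wallis)
  have eq: "Z_ratio (Suc n) * p n = pi / 4 * ((2 * real n + 1) / (real n + 1))" for n
  proof (induction n)
    case 0
    show ?case using Zser_nth_Suc[of 0] by (simp add: Z_ratio_def p_def Zser_nth_0)
  next
    case (Suc n)
    have "Z_ratio (Suc (Suc n)) = Z_ratio (Suc n) * ((2 * real n + 3)\<^sup>2 / (4 * (real n + 1) * (real n + 2)))"
      unfolding Z_ratio_def by (subst Zser_nth_Suc) (simp add: field_simps)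
    moreover have "p (Suc n) = p n * (4 * (real n + 1)\<^sup>2 / ((2 * real n + 1) * (2 * real n + 3)))"
      by (simp add: p_def power2_eq_square algebra_simps)
    ultimately have "Z_ratio (Suc (Suc n)) * p (Suc n) = (Z_ratio (Suc n) * p n) *
        (((2 * real n + 3)\<^sup>2 / (4 * (real n + 1) * (real n + 2))) * (4 * (real n + 1)\<^sup>2 / ((2 * real n + 1) * (2 * real n + 3))))"
      by simp
    also have "\<dots> = pi / 4 * ((2 * real n + 1) / (real n + 1) *
        (((2 * real n + 3)\<^sup>2 / (4 * (real n + 1) * (real n + 2))) * (4 * (real n + 1)\<^sup>2 / ((2 * real n + 1) * (2 * real n + 3)))))"
      unfolding Suc.IH by (simp only: mult.assoc)
    also have "(2 * x + 1) / (x + 1) *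
        (((2 * x + 3)\<^sup>2 / (4 * (x + 1) * (x + 2))) * (4 * (x + 1)\<^sup>2 / ((2 * x + 1) * (2 * x + 3)))) =
        (2 * (x + 1) + 1) / ((x + 1) + 1)" if "x \<ge> 0" for x :: real
      using that by (simp add: divide_simps power2_eq_square) (simp add: algebra_simps)
    finally show ?case by simp
  qed
  have p0: "p n \<noteq> 0" for n
  proof -
    have "4 * (real k)\<^sup>2 - 1 \<noteq> 0" if "k \<ge> 1" for k
    proof -
      have "1 \<le> (real k)\<^sup>2" using that by (intro one_le_power) auto
      thus ?thesis by linarith
    qed
    thus ?thesis by (auto simp: p_def)
  qed
  have "(\<lambda>n. (2 - 1 / real (Suc n))) \<longlonglongrightarrow> 2 - 0"
    by (intro tendsto_diff tendsto_const filterlim_compose[OF lim_1_over_n filterlim_Suc])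
  hence "(\<lambda>n. pi / 4 * (2 - 1 / real (Suc n)) / p n) \<longlonglongrightarrow> pi / 4 * (2 - 0) / (pi / 2)"
    by (intro tendsto_divide tendsto_mult tendsto_const p) auto
  moreover have "pi / 4 * (2 - 1 / real (Suc n)) / p n = Z_ratio (Suc n)" for n
  proof -
    have *: "2 - 1 / real (Suc n) = (2 * real n + 1) / (real n + 1)" by (simp add: field_simps)
    show ?thesis unfolding * eq[symmetric] using p0[of n] by simp
  qed
  ultimately have "(\<lambda>n. Z_ratio (Suc n)) \<longlonglongrightarrow> 1" by simp
  thus ?thesis by (rule LIMSEQ_imp_Suc)
qed

text \<open>The binomial coefficient of the substitution and the factorial growth of \<open>Zser\<close> combine into
  the exponential series of \<open>- 5 / 2\<close>, weighted by \<open>Z_ratio\<close>, which tends to \<open>1\<close>.\<close>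
lemma Zser_moeb_nth:
  assumes "n > 0"
  shows "Zser_moeb $ n = 2 ^ n * fact (n - 1) / pi * (\<Sum>m<n. Z_ratio (n - m) * ((-5/2) ^ m / fact m))"
proof -
  have "Zser_moeb $ n = (\<Sum>k=0..n. Zser $ k * (moeb ^ k) $ n)"
    by (simp add: Zser_moeb_def fps_compose_nth)
  also have "\<dots> = (\<Sum>k\<in>{1..n}. Zser $ k * (moeb ^ k) $ n)"
    using assms by (intro sum.mono_neutral_right) (auto simp: not_less_eq_eq[symmetric])
  also have "\<dots> = (\<Sum>m<n. Zser $ (n - m) * (moeb ^ (n - m)) $ n)"
    by (rule sum.reindex_bij_witness[of _ "\<lambda>m. n - m" "\<lambda>k. n - k"]) auto
  also have "\<dots> = (\<Sum>m<n. 2 ^ n * fact (n - 1) / pi * (Z_ratio (n - m) * ((-5/2) ^ m / fact m)))"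
  proof (rule sum.cong)
    fix m assume m: "m \<in> {..<n}"
    have Zn: "Zser $ (n - m) = Z_ratio (n - m) * (2 ^ (n - m) * fact (n - m - 1)) / pi"
      by (simp add: Z_ratio_def)
    have "real ((n - 1) choose m) = fact (n - 1) / (fact m * fact (n - 1 - m))"
      using m by (intro binomial_fact) auto
    moreover have "(moeb ^ (n - m)) $ n = real ((n - 1) choose m) * (-5) ^ m"
      using m by (subst moeb_power_nth) auto
    ultimately have pw: "(moeb ^ (n - m)) $ n = fact (n - 1) / (fact m * fact (n - m - 1)) * (-5) ^ m"
      by simp
    have "(-5/2 :: real) ^ m = (-5) ^ m / 2 ^ m" by (rule power_divide)
    moreover have "(2 :: real) ^ n = 2 ^ m * 2 ^ (n - m)" using m by (simp flip: power_add)
    ultimately have p2: "(-5 :: real) ^ m * 2 ^ (n - m) = (-5/2) ^ m * 2 ^ n" by (simp only: times_divide_eq_left) simp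
    have "Zser $ (n - m) * (moeb ^ (n - m)) $ n =
        Z_ratio (n - m) * fact (n - 1) / (pi * fact m) * ((-5) ^ m * 2 ^ (n - m))"
      unfolding Zn pw by simp
    thus "Zser $ (n - m) * (moeb ^ (n - m)) $ n = 2 ^ n * fact (n - 1) / pi * (Z_ratio (n - m) * ((-5/2) ^ m / fact m))"
      unfolding p2 by simp
  qed simp
  finally show ?thesis by (simp only: sum_distrib_left)
qed

text \<open>Tannery's theorem: each term tends to the corresponding term of the exponential series,
  and the boundedness of \<open>Z_ratio\<close> gives a summable majorant uniform in
  \<open>n\<close>.\<close>

lemma Zser_moeb_sum_tendsto: "(\<lambda>n. \<Sum>m<n. Z_ratio (n - m) * ((-5/2) ^ m / fact m)) \<longlonglongrightarrow> exp (-5/2)"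
proof -
  \<comment> \<open>Padding with zeros makes the range of summation independent of
    \<open>n\<close>.\<close>
  define a where "a = (\<lambda>m n. if m < n then Z_ratio (n - m) * ((-5/2) ^ m / fact m) else 0)"
  define b :: "nat \<Rightarrow> real" where "b = (\<lambda>m. (-5/2) ^ m / fact m)"
  obtain B where B: "\<And>n. \<bar>Z_ratio n\<bar> \<le> B"
    using convergent_imp_Bseq[OF convergentI[OF Z_ratio_tendsto]] unfolding Bseq_def by auto
  have lim: "a m \<longlonglongrightarrow> b m" for m
  proof -
    have "(\<lambda>n. Z_ratio (n - m) * ((-5/2) ^ m / fact m)) \<longlonglongrightarrow> 1 * ((-5/2) ^ m / fact m)"
      by (intro tendsto_mult tendsto_const filterlim_compose[OF Z_ratio_tendsto filterlim_minus_const_nat_at_top])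
    moreover have "\<forall>\<^sub>F n in sequentially. Z_ratio (n - m) * ((-5/2) ^ m / fact m) = a m n"
      using eventually_gt_at_top[of m] by eventually_elim (simp add: a_def)
    ultimately have "a m \<longlonglongrightarrow> 1 * ((-5/2) ^ m / fact m)" by (rule Lim_transform_eventually)
    thus ?thesis by (simp only: b_def mult_1_left)
  qed
  have exps: "b sums exp (-5/2)"
    using exp_converges[of "-5/2 :: real"] unfolding b_def by (simp only: real_scaleR_def divide_inverse mult.commute)
  have summ: "summable (\<lambda>m. B * ((5/2) ^ m / fact m))"
    using summable_exp[of "5/2 :: real"] by (intro summable_mult) (simp only: divide_inverse mult.commute)
  have bound: "norm (a m n) \<le> B * ((5/2) ^ m / fact m)" for m n
  proof -
    have "B \<ge> 0" using B[of 0] by simp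
    moreover have "norm ((-5/2 :: real) ^ m / fact m) = (5/2) ^ m / fact m"
      by (simp add: power_abs)
    moreover have "norm (a m n) = (if m < n then \<bar>Z_ratio (n - m)\<bar> * norm ((-5/2 :: real) ^ m / fact m) else 0)"
      by (cases "m < n") (simp_all only: a_def if_True if_False real_norm_def abs_mult abs_zero)
    ultimately show ?thesis
      using B[of "n - m"] by (auto intro!: mult_right_mono simp del: times_divide_eq_right)
  qed
  have "(\<lambda>n. suminf (\<lambda>m. a m n)) \<longlonglongrightarrow> suminf b"
    by (rule tannerys_theorem[THEN conjunct2, THEN conjunct2, OF lim _ summ])
       (use bound in \<open>auto intro!: always_eventually\<close>)
  moreover have "suminf (\<lambda>m. a m n) = (\<Sum>m<n. Z_ratio (n - m) * ((-5/2) ^ m / fact m))" for n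
    by (subst suminf_finite[of "{..<n}"]) (auto simp: a_def)
  ultimately show ?thesis using sums_unique[OF exps] by simp
qed

definition stokes :: real where "stokes = exp (-5/2) / pi"

text \<open>The factor 4 arises from
  \<open>growth (n - 2) = 2 ^ (n - 2) * fact (n - 1)\<close>.\<close>

lemma Zser_moeb_tendsto: "(\<lambda>n. Zser_moeb $ n / growth (n - 2)) \<longlonglongrightarrow> 4 * stokes"
proof -
  have "(\<lambda>n. 4 / pi * (\<Sum>m<n. Z_ratio (n - m) * ((-5/2) ^ m / fact m))) \<longlonglongrightarrow> 4 / pi * exp (-5/2)"
    by (intro tendsto_mult tendsto_const Zser_moeb_sum_tendsto)
  moreover have "\<forall>\<^sub>F n in sequentially. 4 / pi * (\<Sum>m<n. Z_ratio (n - m) * ((-5/2) ^ m / fact m)) = Zser_moeb $ n / growth (n - 2)"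
    using eventually_ge_at_top[of 2]
  proof eventually_elim
    case (elim n)
    then obtain k where "n = k + 2" by (metis add.commute le_Suc_ex)
    thus ?case by (simp add: Zser_moeb_nth growth_def power_add)
  qed
  ultimately have "(\<lambda>n. Zser_moeb $ n / growth (n - 2)) \<longlonglongrightarrow> 4 / pi * exp (-5/2)"
    by (rule Lim_transform_eventually)
  thus ?thesis by (simp add: stokes_def)
qed

lemma Zser_moeb_bigo: "fps_nth Zser_moeb \<in> O(\<lambda>n. growth (n - 2))"
  using Zser_moeb_tendsto by (rule bigoI_tendsto) auto

lemma moeb_den_fdiv: "fdiv moeb_den 0"
proof -
  have "fdiv (1 + 5 * fps_X) 0"
    by (rule fdiv_ev_0[of 1]) (auto simp: numeral_fps_const)
  from fdiv_inverse[OF this] show ?thesis by (simp add: moeb_den_def)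
qed

text \<open>Bootstrap: in \<open>Zser_moeb_recurrence\<close> an expansion of order \<open>R\<close>
  of the source gains an order on division by \<open>n + 1\<close>, and
  \<open>asympt_recurrence\<close> carries it back to \<open>Zser_moeb\<close>.\<close>

lemma Zser_moeb_asympt: "\<exists>c. asympt R (fps_nth Zser_moeb) c"
proof (induction R)
  case 0
  show ?case using bigo_growth_trans[OF Zser_moeb_bigo, of 0] by simp
next
  case (Suc R)
  show ?case
  proof (cases "R \<ge> 2")
    case False
    hence "fps_nth Zser_moeb \<in> O(\<lambda>n. growth (n - Suc R))" by (intro bigo_growth_trans[OF Zser_moeb_bigo]) auto
    from asympt_bigo[OF this] show ?thesis by (rule exI)
  next
    case True
    from Suc.IH obtain c where c: "asympt R (fps_nth Zser_moeb) c" by blast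
    have "fdiv (moeb_den\<^sup>2) 0" using fdiv_power[OF moeb_den_fdiv, of 2] by simp
    hence "asympt R (fps_nth (moeb_den\<^sup>2)) 0" by (simp add: fdiv_def)
    from asympt_mult[OF c this] have b: "asympt R (fps_nth (Zser_moeb * moeb_den\<^sup>2)) (moeb_den\<^sup>2 * c)" by simp
    define h where "h = (\<lambda>n. Zser_moeb $ Suc n - 2 * real n * Zser_moeb $ n)"
    have h: "(\<lambda>n. 1 / 2 * ((Zser_moeb * moeb_den\<^sup>2) $ n / (real n + real 1))) = h"
      by (auto simp: Zser_moeb_recurrence h_def field_simps)
    obtain e where "asympt (Suc R) (\<lambda>n. (Zser_moeb * moeb_den\<^sup>2) $ n / (real n + real 1)) e"
      using asympt_div_n[OF b, of 1] by (rule exE)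
    from asympt_cmult[OF this, of "1 / 2"]
    have e: "asympt (Suc R) h (fps_const (1 / 2) * e)" unfolding h .
    \<comment> \<open>The bound by \<open>growth (n - 2)\<close> forces the first two coefficients
      to vanish. The source then starts at index 2 and its quotient by \<open>n + 1\<close> at index
      3, which is the condition at index 2 in \<open>asympt_recurrence\<close>.\<close>
    have c0: "c $ k = 0" if "k < 2" for k
      using asympt_unique_0[OF c Zser_moeb_bigo that] that True by simp
    have "asympt 2 (fps_nth (Zser_moeb * moeb_den\<^sup>2)) (moeb_den\<^sup>2 * c)" by (rule asympt_mono[OF b True])
    moreover have "(moeb_den\<^sup>2 * c) $ k = 0" if "k < 2" for k
      unfolding fps_mult_nth using c0 that by (intro sum.neutral) auto
    ultimately have "asympt 2 (fps_nth (Zser_moeb * moeb_den\<^sup>2)) 0"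
      using asympt_coeff_cong[of 2 _ "moeb_den\<^sup>2 * c" 0] by simp
    hence "fps_nth (Zser_moeb * moeb_den\<^sup>2) \<in> O(\<lambda>n. growth (n - 2))" by (simp add: asympt_def)
    from div_n_bigo[OF this, of 1] have "(\<lambda>n. 1 / 2 * ((Zser_moeb * moeb_den\<^sup>2) $ n / (real n + real 1))) \<in> O(\<lambda>n. growth (n - Suc 2))"
      by (subst landau_o.big.cmult_in_iff) simp_all
    hence "h \<in> O(\<lambda>n. growth (n - Suc 2))" unfolding h .
    from asympt_unique_0[OF e this, of 2] True have "(fps_const (1 / 2) * e) $ 2 = 0" by simp
    from asympt_recurrence[OF e[unfolded h_def] True this] show ?thesis .
  qed
qed

text \<open>The recurrence leaves the coefficient at index 2 open; comparison with the limit in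
  \<open>Zser_moeb_tendsto\<close> determines it.\<close>

lemma Zser_moeb_fdiv:
  obtains c where "fdiv Zser_moeb c" "c $ 0 = 0" "c $ Suc 0 = 0" "c $ 2 = 4 * stokes"
proof -
  obtain c where c: "\<And>R. asympt R (fps_nth Zser_moeb) c"
    using asympt_choice[OF Zser_moeb_asympt] by (elim exE) (meson spec)
  have c0: "c $ k = 0" if "k < 2" for k
    using asympt_unique_0[OF c[of 2] Zser_moeb_bigo that that] .
  have "asympt 3 (fps_nth Zser_moeb) c" by (rule c)
  hence "(\<lambda>n. Zser_moeb $ n - c $ 2 * growth (n - 2)) \<in> O(\<lambda>n. growth (n - Suc 2))"
    using c0 by (simp add: asympt_def numeral_3_eq_3 numeral_2_eq_2)
  also have "(\<lambda>n. growth (n - Suc 2)) \<in> o(\<lambda>n. growth (n - 2))"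
  proof (rule landau_o.smallI)
    fix \<epsilon> :: real assume \<epsilon>: "\<epsilon> > 0"
    show "\<forall>\<^sub>F n in sequentially. norm (growth (n - Suc 2)) \<le> \<epsilon> * norm (growth (n - 2))"
      using eventually_gt_at_top[of "2 + nat \<lceil>1 / \<epsilon>\<rceil>"]
    proof eventually_elim
      case (elim n)
      have "1 / \<epsilon> \<le> real n - 2" using elim by linarith
      hence "1 \<le> \<epsilon> * (real n - 2)" using \<epsilon> by (simp add: field_simps)
      also have "\<dots> \<le> \<epsilon> * (2 * (real n - 2 + 1))" using \<epsilon> elim by (intro mult_left_mono) auto
      finally have "1 * growth (n - Suc 2) \<le> \<epsilon> * (2 * (real n - 2 + 1)) * growth (n - Suc 2)"
        by (intro mult_right_mono) auto
      moreover have "growth (n - 2) = 2 * (real n - 2 + 1) * growth (n - Suc 2)" using growth_diff_Suc[of 2 n] elim by simp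
      ultimately have "growth (n - Suc 2) \<le> \<epsilon> * growth (n - 2)" by (simp only: mult.assoc mult_1_left)
      thus ?case by simp
    qed
  qed
  finally have "(\<lambda>n. (Zser_moeb $ n - c $ 2 * growth (n - 2)) / growth (n - 2)) \<longlonglongrightarrow> 0"
    by (rule smalloD_tendsto)
  moreover have "(Zser_moeb $ n - c $ 2 * growth (n - 2)) / growth (n - 2) = Zser_moeb $ n / growth (n - 2) - c $ 2" for n
    by (simp add: diff_divide_distrib)
  ultimately have "(\<lambda>n. Zser_moeb $ n / growth (n - 2)) \<longlonglongrightarrow> c $ 2" by (simp add: LIM_zero_iff)
  hence "c $ 2 = 4 * stokes" using Zser_moeb_tendsto LIMSEQ_unique by blast
  with that[of c] c c0[of 0] c0[of "Suc 0"] show ?thesis by (simp add: fdiv_def)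
qed

subsection \<open>Lagrange inversion of series tangent to the identity to second order\<close>

text \<open>The functional \<open>g \<mapsto> [x\<^sup>n] x g' \<rho>\<^sup>n\<close> sends \<open>(x \<tau>)\<^sup>k\<close> to \<open>n\<close> if \<open>k = n\<close> and to \<open>0\<close> otherwise.\<close>
lemma lagrange_inversion:
  fixes f \<tau> \<rho> :: "real fps"
  assumes "\<rho> * \<tau> = 1"
  shows "real n * f $ n = (fps_X * fps_deriv (f oo (fps_X * \<tau>)) * \<rho> ^ n) $ n"
proof -
  define T where "T = fps_X * \<tau>"
  have T0: "T $ 0 = 0" by (simp add: T_def)
  define L where "L = (\<lambda>g. (fps_X * fps_deriv g * \<rho> ^ n) $ n)"
  have L_add: "L (g + h) = L g + L h" for g h
    by (simp add: L_def algebra_simps)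
  have L_cmult: "L (fps_const c * g) = c * L g" for c g
    unfolding L_def by (simp add: mult.assoc mult.left_commute[of fps_X "fps_const c"])
  have L_sum: "L (\<Sum>k\<in>A. g k) = (\<Sum>k\<in>A. L (g k))" if "finite A" for g :: "nat \<Rightarrow> real fps" and A
    using that by (induction rule: finite_induct) (simp_all add: L_add, simp add: L_def)
  \<comment> \<open>Everything from degree \<open>n + 1\<close> on is invisible to the functional,
    so only a polynomial part of \<open>f\<close> counts below.\<close>
  have L_high: "L (fps_X ^ Suc n * q) = 0" for q
  proof -
    have d: "fps_deriv (fps_X ^ Suc n) = (of_nat (Suc n) * fps_X ^ n :: real fps)"
      using fps_deriv_power'[of "fps_X :: real fps" "Suc n"] by (simp del: power_Suc of_nat_Suc)
    have "fps_X * fps_deriv (fps_X ^ Suc n * q) * \<rho> ^ n =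
        fps_X ^ Suc n * ((fps_X * fps_deriv q + of_nat (Suc n) * q) * \<rho> ^ n)"
      unfolding fps_deriv_mult d by (simp only: power_Suc distrib_left distrib_right mult_ac add_ac)
    thus ?thesis unfolding L_def by (simp only: fps_X_power_mult_nth) simp
  qed
  have L_pow: "L (T ^ k) = (if k = n then real n else 0)" if k: "k \<le> n" for k
  proof (cases k)
    case 0
    thus ?thesis by (simp add: L_def)
  next
    case (Suc i)
    define m where "m = n - k"
    have n: "n = m + Suc i" using k Suc by (simp add: m_def)
    have \<rho>\<tau>: "\<tau> ^ a * \<rho> ^ (b + a) = \<rho> ^ b" for a b
      using assms by (simp add: power_add mult.commute mult.left_commute flip: power_mult_distrib)
    have "fps_deriv (\<rho> * \<tau>) = 0" by (simp add: assms)
    hence d: "\<rho> * fps_deriv \<tau> = - (fps_deriv \<rho> * \<tau>)" by (simp add: algebra_simps eq_neg_iff_add_eq_0)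
    have "fps_deriv T = \<tau> + fps_X * fps_deriv \<tau>" by (simp add: T_def)
    hence dT: "fps_deriv (T ^ k) = of_nat k * (T ^ i * (\<tau> + fps_X * fps_deriv \<tau>))"
      using fps_deriv_power'[of T k] Suc by simp
    have "fps_X * fps_deriv (T ^ k) * \<rho> ^ n =
        fps_X ^ k * (of_nat k * (\<tau> ^ Suc i * \<rho> ^ n + fps_X * (fps_deriv \<tau> * (\<tau> ^ i * \<rho> ^ n))))"
      unfolding dT by (simp add: Suc T_def power_mult_distrib algebra_simps)
    also have "\<tau> ^ Suc i * \<rho> ^ n = \<rho> ^ m" unfolding n by (rule \<rho>\<tau>)
    also have "\<tau> ^ i * \<rho> ^ n = \<rho> ^ Suc m" unfolding n using \<rho>\<tau>[of i "Suc m"] by simp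
    finally have eq: "L (T ^ k) = real k * (\<rho> ^ m + fps_X * (fps_deriv \<tau> * \<rho> ^ Suc m)) $ m"
      using k unfolding L_def m_def by (simp only: fps_X_power_mult_nth) (simp add: fps_of_nat[symmetric])
    show ?thesis
    proof (cases m)
      case 0
      thus ?thesis using eq n Suc by simp
    next
      case (Suc l)
      \<comment> \<open>Here \<open>k < n\<close>. The term
        \<open>fps_X * (fps_deriv \<tau> * \<rho> ^ Suc m)\<close> is \<open>-1/m\<close> times
        \<open>fps_X * fps_deriv (\<rho> ^ m)\<close>, and its coefficient at \<open>m\<close>
        cancels that of \<open>\<rho> ^ m\<close>.\<close>
      have "fps_deriv \<tau> * \<rho> ^ Suc m = (\<rho> * fps_deriv \<tau>) * \<rho> ^ m" by simp
      also have "\<dots> = - (fps_deriv \<rho> * (\<tau> * \<rho>) * \<rho> ^ l)" unfolding d by (simp add: Suc)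
      also have "\<dots> = - (fps_deriv \<rho> * \<rho> ^ l)" using assms by (simp add: mult.commute)
      finally have 1: "fps_X * (fps_deriv \<tau> * \<rho> ^ Suc m) = - (fps_X * (fps_deriv \<rho> * \<rho> ^ l))" by simp
      have 2: "fps_X * fps_deriv (\<rho> ^ m) = fps_const (real m) * (fps_X * (fps_deriv \<rho> * \<rho> ^ l))"
        unfolding fps_deriv_power' using Suc by (simp add: mult_ac fps_of_nat[symmetric] del: of_nat_Suc)
      have "(fps_X * fps_deriv (\<rho> ^ m)) $ m = real m * (fps_X * (fps_deriv \<rho> * \<rho> ^ l)) $ m"
        unfolding 2 by (simp only: fps_mult_left_const_nth)
      moreover have "(fps_X * fps_deriv (\<rho> ^ m)) $ m = real m * (\<rho> ^ m) $ m"
        by (rule fps_X_mult_deriv_nth)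
      ultimately have "(fps_X * (fps_deriv \<rho> * \<rho> ^ l)) $ m = (\<rho> ^ m) $ m" using Suc by simp
      hence "L (T ^ k) = 0" unfolding eq 1 by simp
      thus ?thesis using Suc n \<open>k = Suc i\<close> by simp
    qed
  qed
  define r where "r = fps_shift (Suc n) f"
  have "f = (\<Sum>k\<le>n. fps_const (f $ k) * fps_X ^ k) + fps_X ^ Suc n * r"
  proof (rule fps_ext)
    fix i
    have "(\<Sum>k\<le>n. fps_const (f $ k) * fps_X ^ k) $ i = (\<Sum>k\<le>n. if k = i then f $ i else 0)"
      unfolding fps_sum_nth by (rule sum.cong) (auto simp: fps_X_power_nth)
    also have "\<dots> = (if i \<le> n then f $ i else 0)" by simp
    finally have *: "(\<Sum>k\<le>n. fps_const (f $ k) * fps_X ^ k) $ i = (if i \<le> n then f $ i else 0)" .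
    show "f $ i = ((\<Sum>k\<le>n. fps_const (f $ k) * fps_X ^ k) + fps_X ^ Suc n * r) $ i"
      unfolding fps_add_nth * fps_X_power_mult_nth r_def by auto
  qed
  hence "f oo T = ((\<Sum>k\<le>n. fps_const (f $ k) * fps_X ^ k) + fps_X ^ Suc n * r) oo T" by simp
  also have "\<dots> = (\<Sum>k\<le>n. fps_const (f $ k) * T ^ k) + T ^ Suc n * (r oo T)"
    using T0 by (simp add: fps_compose_add_distrib fps_compose_sum_distrib fps_compose_mult_distrib
        fps_X_power_compose del: power_Suc)
  also have "T ^ Suc n * (r oo T) = fps_X ^ Suc n * (\<tau> ^ Suc n * (r oo T))"
    by (simp add: T_def power_mult_distrib mult_ac)
  finally have "L (f oo T) = (\<Sum>k\<le>n. f $ k * L (T ^ k))"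
    by (simp add: L_add L_sum L_cmult L_high del: power_Suc)
  also have "\<dots> = real n * f $ n"
    by (simp add: L_pow if_distrib[of "\<lambda>x. _ * x"] sum.delta cong: if_cong)
  finally show ?thesis by (simp add: L_def T_def)
qed

section \<open>Binomial sums over powers of a series\<close>

lemma fdiv_binomial:
  assumes "fdiv f c" "\<And>i. i < j + e \<Longrightarrow> c $ i = 0"
  shows "\<exists>d. fdiv (Abs_fps (\<lambda>n. real (n choose j) * f $ n)) d \<and> (\<forall>i<e. d $ i = 0)"
  using assms(2)
proof (induction j arbitrary: e)
  case 0
  have "Abs_fps (\<lambda>n. real (n choose 0) * f $ n) = f" by (simp add: fps_eq_iff)
  thus ?case using assms(1) 0 by auto
next
  \<comment> \<open>Use \<open>(j + 1) * (n choose Suc j) = (n - j) * (n choose j)\<close>. The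
    factor \<open>n\<close> consumes one leading zero of the alien derivative, so
    \<open>j + e\<close> zeros leave \<open>e\<close>.\<close>
  case (Suc j)
  define g where "g = Abs_fps (\<lambda>n. real (n choose j) * f $ n)"
  obtain d where d: "fdiv g d" "\<And>i. i < Suc e \<Longrightarrow> d $ i = 0"
    using Suc.IH[of "Suc e"] Suc.prems by (auto simp: g_def)
  have "Abs_fps (\<lambda>n. real (n choose Suc j) * f $ n) =
      fps_const (1 / real (Suc j)) * (fps_X * fps_deriv g - fps_const (real j) * g)"
  proof (rule fps_ext)
    fix n
    have b: "real (Suc j) * real (n choose Suc j) = (real n - real j) * real (n choose j)"
    proof (cases "j \<le> n")
      case True
      have "Suc j * (n choose Suc j) = (n - j) * (n choose j)"
        by (simp only: binomial_absorption binomial_absorb_comp)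
      hence "real (Suc j * (n choose Suc j)) = real ((n - j) * (n choose j))" by simp
      thus ?thesis using True by (simp only: of_nat_mult of_nat_diff)
    qed (simp add: binomial_eq_0)
    have "(fps_X * fps_deriv g) $ n = real n * g $ n" by (rule fps_X_mult_deriv_nth)
    hence "(fps_const (1 / real (Suc j)) * (fps_X * fps_deriv g - fps_const (real j) * g)) $ n =
        1 / real (Suc j) * ((real n - real j) * real (n choose j)) * f $ n"
      by (simp only: fps_mult_left_const_nth fps_sub_nth) (simp add: g_def algebra_simps)
    thus "Abs_fps (\<lambda>n. real (n choose Suc j) * f $ n) $ n =
      (fps_const (1 / real (Suc j)) * (fps_X * fps_deriv g - fps_const (real j) * g)) $ n"
      unfolding b[symmetric] by simp
  qed
  note eq = this
  have fd: "fdiv (fps_const (1 / real (Suc j)) * (fps_X * fps_deriv g - fps_const (real j) * g))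
      (fps_const (1 / real (Suc j)) * (dcoeff d - fps_const (real j) * d))"
    using fdiv_mult[OF fdiv_const fdiv_diff[OF fdiv_X_deriv[OF d(1)] fdiv_mult[OF fdiv_const d(1)]]] d(2)[of 0]
    by simp
  have "\<forall>i<e. (fps_const (1 / real (Suc j)) * (dcoeff d - fps_const (real j) * d)) $ i = 0"
    using d(2) by (simp add: dcoeff_def)
  with fd show ?case unfolding eq by blast
qed

text \<open>Pair the factors \<open>(i + 1) (M - i) \<ge> M\<close> of \<open>j! M! / (M - j)!\<close>.\<close>
lemma power_mult_fact_le:
  assumes "j \<le> M"
  shows "real M ^ j * fact (M - j) \<le> fact j * fact M"
  using assms
proof (induction j)
  case (Suc j)
  have "real M + real j * (real M - real j - 1) \<ge> real M" using Suc.prems by simp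
  hence "real M \<le> (real j + 1) * (real M - real j)" by (simp add: algebra_simps)
  hence "real M ^ j * fact (M - Suc j) * real M \<le> real M ^ j * fact (M - Suc j) * ((real j + 1) * (real M - real j))"
    by (intro mult_left_mono) auto
  also have "\<dots> = (real j + 1) * (real M ^ j * (real (M - j) * fact (M - Suc j)))"
    using Suc.prems by (simp add: of_nat_diff)
  also have "real (M - j) * fact (M - Suc j) = fact (M - j)"
    using Suc.prems by (subst (2) fact_reduce) auto
  also have "(real j + 1) * (real M ^ j * fact (M - j)) \<le> (real j + 1) * (fact j * fact M)"
    using Suc by (intro mult_left_mono) auto
  finally show ?case by (simp add: algebra_simps)
qed simp

text \<open>A lag of \<open>2 * j - 1\<close> outweighs the binomial coefficient: the bound decays
  geometrically in \<open>j\<close> with a ratio of order \<open>1 / n\<close>, uniformly in the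
  range.\<close>

lemma binomial_growth_le:
  assumes "1 \<le> j" "2 * j \<le> n"
  shows "real (n choose j) * growth (n - (2 * j - 1)) \<le> growth (n + 1) / (2 * (real n + 2)) ^ j"
proof -
  \<comment> \<open>With this \<open>N\<close> the factorial in
    \<open>growth (n - (2 * j - 1))\<close> is \<open>fact (N - 2 * j)\<close>, and
    \<open>power_mult_fact_le\<close> applies with \<open>M = N - j\<close>.\<close>
  define N where "N = n + 2"
  have N: "2 * j \<le> N" "N > 0" using assms by (auto simp: N_def)
  have "real (N choose j) * (fact (N - 2 * j) * (real N / 2) ^ j) \<le> real (N choose j) * (fact j * fact (N - j))"
  proof (intro mult_left_mono)
    have "(real N / 2) ^ j \<le> real (N - j) ^ j" using N by (intro power_mono) auto
    hence "fact (N - 2 * j) * (real N / 2) ^ j \<le> fact (N - 2 * j) * real (N - j) ^ j"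
      by (intro mult_left_mono) auto
    also have "\<dots> = real (N - j) ^ j * fact (N - j - j)" by (simp add: mult_2)
    also have "\<dots> \<le> fact j * fact (N - j)" using N by (intro power_mult_fact_le) auto
    finally show "fact (N - 2 * j) * (real N / 2) ^ j \<le> fact j * fact (N - j)" .
  qed auto
  also have "\<dots> = fact N" using N by (subst binomial_fact) auto
  finally have 1: "real (N choose j) * fact (N - 2 * j) \<le> fact N / (real N / 2) ^ j"
    using N by (simp add: field_simps)
  have e: "n - (2 * j - 1) + 1 = N - 2 * j" "n + 1 = 2 * j + (n - (2 * j - 1))"
    using assms by (auto simp: N_def)
  have "real (n choose j) * growth (n - (2 * j - 1)) = 2 ^ (n - (2 * j - 1)) * (real (n choose j) * fact (N - 2 * j))"
    unfolding growth_def e by simp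
  also have "\<dots> \<le> 2 ^ (n - (2 * j - 1)) * (real (N choose j) * fact (N - 2 * j))"
    by (intro mult_left_mono mult_right_mono) (auto simp: N_def binomial_right_mono)
  also have "\<dots> \<le> 2 ^ (n - (2 * j - 1)) * (fact N / (real N / 2) ^ j)"
    using 1 by (intro mult_left_mono) auto
  also have "\<dots> = 2 ^ (n + 1) * fact N / (2 * real N) ^ j"
  proof -
    have "(2 :: real) ^ (n + 1) = (2 ^ j * 2 ^ j) * 2 ^ (n - (2 * j - 1))"
      by (subst e(2)) (simp only: power_add mult_2)
    thus ?thesis using N by (simp add: power_divide power_mult_distrib)
  qed
  also have "\<dots> = growth (n + 1) / (2 * (real n + 2)) ^ j" by (simp add: growth_def N_def algebra_simps)
  finally show ?thesis .
qed

lemma growth_le_power: "growth m \<le> (2 * (real m + 1)) ^ J * growth (m - J)"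
proof (induction J)
  case (Suc J)
  have "growth (m - J) \<le> 2 * (real m + 1) * growth (m - Suc J)"
  proof (cases "J < m")
    case True
    have "2 * (real m - real J + 1) * growth (m - Suc J) \<le> 2 * (real m + 1) * growth (m - Suc J)"
      by (intro mult_right_mono) auto
    thus ?thesis using True by (simp add: growth_diff_Suc)
  qed simp
  hence "(2 * (real m + 1)) ^ J * growth (m - J) \<le> (2 * (real m + 1)) ^ J * (2 * (real m + 1) * growth (m - Suc J))"
    by (intro mult_left_mono) auto
  from order.trans[OF Suc this] show ?case by (simp add: mult_ac)
qed simp

text \<open>Iterates \<open>conv_bound\<close> with \<open>L = 2\<close>: every further factor adds
  2 to the order of vanishing and to the lag.\<close>

lemma power_coeff_bound:
  fixes f :: "real fps"
  assumes "\<And>k. \<bar>f $ k\<bar> \<le> C * growth k" "\<And>k. k < 2 \<Longrightarrow> f $ k = 0"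
  defines "K \<equiv> 2 ^ (2 + 1) * (fact (2 + 1) + fact (2 + 2)) :: real"
  shows "\<bar>(f ^ Suc i) $ k\<bar> \<le> C * (C * K) ^ i * growth (k - 2 * i) \<and> (k < 2 * Suc i \<longrightarrow> (f ^ Suc i) $ k = 0)"
proof (induction i arbitrary: k)
  case 0
  thus ?case using assms by simp
next
  case (Suc i)
  have g: "\<And>k. 2 + 2 * i \<le> k \<Longrightarrow> \<bar>(f ^ Suc i) $ k\<bar> \<le> C * (C * K) ^ i * growth (k - 2 * i)"
    "\<And>k. k < 2 + 2 * i \<Longrightarrow> (f ^ Suc i) $ k = 0"
    using Suc by auto
  note cb = conv_bound[of f C 2 "2 * i" "f ^ Suc i" "C * (C * K) ^ i", OF assms(1,2) g, folded K_def]
  have "\<bar>(f * f ^ Suc i) $ k\<bar> \<le> C * (C * (C * K) ^ i) * K * growth (k - 2 * i - 2)"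
    by (rule cb(1))
  moreover have "k < 2 * 2 + 2 * i \<Longrightarrow> (f * f ^ Suc i) $ k = 0" by (rule cb(2))
  ultimately show ?case by (simp add: mult_ac)
qed

text \<open>Expand by the binomial theorem. The coefficients of \<open>y * f ^ j\<close> lag by
  \<open>2 * j - 1\<close>, so by \<open>binomial_growth_le\<close> the terms beyond
  \<open>R\<close> are dominated by a geometric series in \<open>B / (2 * (n + 2))\<close>.\<close>

lemma binomial_tail_bigo:
  fixes f y :: "real fps"
  assumes f: "fps_nth f \<in> O(growth)" "f $ 0 = 0" "f $ Suc 0 = 0"
    and y: "fps_nth y \<in> O(growth)" "y $ 0 = 0"
  shows "(\<lambda>n. (y * (1 + f) ^ n) $ n - (\<Sum>j<Suc R. real (n choose j) * (y * f ^ j) $ n)) \<in> O(\<lambda>n. growth (n - R))"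
proof -
  obtain C where C: "C > 0" "\<And>n. \<bar>f $ n\<bar> \<le> C * growth n" using bigo_growth_bound[OF f(1)] by blast
  obtain D where D: "D > 0" "\<And>n. \<bar>y $ n\<bar> \<le> D * growth n" using bigo_growth_bound[OF y(1)] by blast
  define K :: real where "K = 2 ^ (2 + 1) * (fact (2 + 1) + fact (2 + 2))"
  define K1 :: real where "K1 = 2 ^ (1 + 1) * (fact (1 + 1) + fact (1 + 2))"
  have f0: "k < 2 \<Longrightarrow> f $ k = 0" for k using f by (auto simp: less_2_cases_iff)
  have K: "K > 0" "K1 > 0" by (auto simp: K_def K1_def intro!: add_pos_pos)
  note pb = power_coeff_bound[of f C, OF C(2) f0, folded K_def]
  define A where "A = D * C * K1"
  \<comment> \<open>The summand 1 ensures \<open>B > 1\<close>, so that \<open>B ^ j\<close> also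
    dominates \<open>(C * K) ^ i\<close> for \<open>j = Suc i\<close>.\<close>
  define B where "B = 1 + C * K"
  have AB: "A > 0" "B > 1" using C D K by (auto simp: A_def B_def)
  have bnd: "\<bar>(y * f ^ j) $ n\<bar> \<le> A * B ^ j * growth (n - (2 * j - 1)) \<and> (n < 2 * j \<longrightarrow> (y * f ^ j) $ n = 0)" if j1: "j \<ge> 1" for j n
  proof -
    obtain i where j: "j = Suc i" using j1 by (cases j) auto
    have g: "\<And>k. 1 + 2 * i \<le> k \<Longrightarrow> \<bar>(f ^ Suc i) $ k\<bar> \<le> C * (C * K) ^ i * growth (k - 2 * i)"
      "\<And>k. k < 1 + 2 * i \<Longrightarrow> (f ^ Suc i) $ k = 0"
      using pb by auto
    have y0: "\<And>k. k < 1 \<Longrightarrow> y $ k = 0" using y by simp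
    note cb = conv_bound[of y D 1 "2 * i" "f ^ Suc i" "C * (C * K) ^ i", OF D(2) y0 g, folded K1_def]
    have "\<bar>(y * f ^ Suc i) $ n\<bar> \<le> D * (C * (C * K) ^ i) * K1 * growth (n - 2 * i - 1)" by (rule cb(1))
    also have "\<dots> = A * (C * K) ^ i * growth (n - (2 * j - 1))" by (simp add: A_def j)
    also have "\<dots> \<le> A * B ^ j * growth (n - (2 * j - 1))"
    proof (intro mult_right_mono mult_left_mono)
      have "(C * K) ^ i \<le> B ^ i" using C K by (intro power_mono) (auto simp: B_def)
      also have "\<dots> \<le> B ^ j" using AB by (intro power_increasing) (auto simp: j)
      finally show "(C * K) ^ i \<le> B ^ j" .
    qed (use AB in auto)
    finally show ?thesis using cb(2) by (simp add: j)
  qed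
  define J where "J = Suc R"
  show ?thesis
  proof (rule landau_o.bigI[of "2 * A * B ^ J"])
    show "2 * A * B ^ J > 0" using AB by simp
    show "\<forall>\<^sub>F n in sequentially. norm ((y * (1 + f) ^ n) $ n - (\<Sum>j<Suc R. real (n choose j) * (y * f ^ j) $ n))
        \<le> 2 * A * B ^ J * norm (growth (n - R))"
      using eventually_ge_at_top[of "R + nat \<lceil>B\<rceil>"]
    proof eventually_elim
      case (elim n)
      have n: "n \<ge> R" "real n \<ge> B" using elim by linarith+
      define q where "q = B / (2 * (real n + 2))"
      \<comment> \<open>The threshold \<open>n >= B\<close> keeps the ratio at most
        \<open>1 / 2\<close>.\<close>
      have q: "0 < q" "q \<le> 1 / 2" using n AB by (auto simp: q_def field_simps)
      have "(1 + f) ^ n = (\<Sum>j\<le>n. of_nat (n choose j) * f ^ j)"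
        using binomial_ring[of f 1 n] by (simp add: add.commute)
      hence "(y * (1 + f) ^ n) $ n = (\<Sum>j\<le>n. real (n choose j) * (y * f ^ j) $ n)"
        by (simp add: sum_distrib_left fps_sum_nth mult.left_commute[of y] fps_of_nat[symmetric])
      also have "{..n} = {..<J} \<union> {J..n}" using n by (auto simp: J_def)
      also have "(\<Sum>j\<in>\<dots>. real (n choose j) * (y * f ^ j) $ n) =
          (\<Sum>j<J. real (n choose j) * (y * f ^ j) $ n) + (\<Sum>j=J..n. real (n choose j) * (y * f ^ j) $ n)"
        by (rule sum.union_disjoint) auto
      finally have "norm ((y * (1 + f) ^ n) $ n - (\<Sum>j<Suc R. real (n choose j) * (y * f ^ j) $ n)) =
          \<bar>\<Sum>j=J..n. real (n choose j) * (y * f ^ j) $ n\<bar>" by (simp only: J_def) simp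
      also have "\<dots> \<le> (\<Sum>j=J..n. \<bar>real (n choose j) * (y * f ^ j) $ n\<bar>)" by (rule sum_abs)
      also have "\<dots> \<le> (\<Sum>j=J..n. A * growth (n + 1) * q ^ j)"
      proof (rule sum_mono)
        fix j assume j: "j \<in> {J..n}"
        hence j1: "1 \<le> j" by (simp add: J_def)
        show "\<bar>real (n choose j) * (y * f ^ j) $ n\<bar> \<le> A * growth (n + 1) * q ^ j"
        proof (cases "n < 2 * j")
          case True
          hence "(y * f ^ j) $ n = 0" using bnd[OF j1] by blast
          thus ?thesis using AB q by simp
        next
          case False
          have "\<bar>real (n choose j) * (y * f ^ j) $ n\<bar> \<le> real (n choose j) * (A * B ^ j * growth (n - (2 * j - 1)))"
            unfolding abs_mult using bnd[OF j1] by (intro mult_mono) auto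
          also have "\<dots> = A * B ^ j * (real (n choose j) * growth (n - (2 * j - 1)))" by simp
          also have "\<dots> \<le> A * B ^ j * (growth (n + 1) / (2 * (real n + 2)) ^ j)"
            using False j1 AB by (intro mult_left_mono binomial_growth_le) auto
          also have "\<dots> = A * growth (n + 1) * q ^ j" by (simp add: q_def power_divide)
          finally show ?thesis .
        qed
      qed
      also have "\<dots> = A * growth (n + 1) * (\<Sum>j=J..n. q ^ j)" by (simp add: sum_distrib_left)
      also have "(\<Sum>j=J..n. q ^ j) \<le> 2 * q ^ J"
      proof -
        have "(\<Sum>j=J..n. q ^ j) * (1 - q) \<le> q ^ J"
          using q by (simp add: sum_gp mult.commute)
        moreover have "(\<Sum>j=J..n. q ^ j) * (1 / 2) \<le> (\<Sum>j=J..n. q ^ j) * (1 - q)"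
          using q by (intro mult_left_mono sum_nonneg) auto
        ultimately show ?thesis by linarith
      qed
      also have "A * growth (n + 1) * (2 * q ^ J) = 2 * A * B ^ J * (growth (n + 1) / (2 * (real n + 2)) ^ J)"
        by (simp add: q_def power_divide)
      \<comment> \<open>\<open>J = R + 1\<close> powers of \<open>2 * (n + 2)\<close> carry
        \<open>growth (n + 1)\<close> down to \<open>growth (n - R)\<close>.\<close>
      also have "growth (n + 1) / (2 * (real n + 2)) ^ J \<le> growth (n - R)"
        using growth_le_power[of "n + 1" J] by (simp add: J_def divide_le_eq mult_ac add_ac)
      finally show ?case using AB q by (simp add: mult_left_mono)
    qed
  qed
qed

subsection \<open>Asymptotics of the renormalised series\<close>

lemma Zser_moeb_low: "Zser_moeb $ 0 = 1" "Zser_moeb $ Suc 0 = 1 / 2" "Zser_moeb $ Suc (Suc 0) = - 11 / 8"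
proof -
  show 0: "Zser_moeb $ 0 = 1" by (simp add: Zser_moeb_def Zser_nth_0)
  show 1: "Zser_moeb $ Suc 0 = 1 / 2"
    using Zser_moeb_recurrence[of 0] by (simp add: 0 moeb_den_low power2_eq_square)
  show "Zser_moeb $ Suc (Suc 0) = - 11 / 8"
    using Zser_moeb_recurrence[of "Suc 0"] by (simp add: 0 1 moeb_den_low fps_mult_nth power2_eq_square)
qed

text \<open>By \<open>W_ser_moeb\<close>, \<open>w_ser\<close> is \<open>W_ser - 1\<close> after the
  substitution. The factor \<open>w_red\<close> has constant term 1 and can be inverted.\<close>

definition w_red :: "real fps" where "w_red = 2 * (1 + 5 * fps_X) * fps_deriv Zser_moeb * inverse Zser_moeb"
definition w_ser :: "real fps" where "w_ser = fps_X * w_red"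

lemma W_ser_moeb: "W_ser oo moeb = 1 + w_ser"
proof -
  define V where "V = W_ser oo moeb"
  define A1 where "A1 = fps_deriv Zser oo moeb"
  have num: "(numeral k :: real fps) oo moeb = numeral k" for k
    by (simp add: numeral_fps_const)
  have "(W_ser * Zser) oo moeb = (Zser + 2 * fps_X * fps_deriv Zser) oo moeb"
    by (simp only: W_ser_Zser Zser_e_eq)
  hence "V * Zser_moeb = Zser_moeb + 2 * moeb * A1"
    by (simp add: fps_compose_add_distrib fps_compose_mult_distrib moeb_low num V_def A1_def Zser_moeb_def)
  moreover have "fps_deriv Zser_moeb = A1 * moeb_den\<^sup>2"
    unfolding Zser_moeb_def A1_def by (simp add: fps_compose_deriv moeb_low moeb_deriv)
  \<comment> \<open>The chain rule brings in \<open>moeb_den\<close> squared; the factor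
    \<open>1 + 5 * fps_X\<close> cancels one of the two powers.\<close>
  hence "(1 + 5 * fps_X) * fps_deriv Zser_moeb = A1 * moeb_den * ((1 + 5 * fps_X) * moeb_den)"
    by (simp only: power2_eq_square mult_ac)
  hence "moeb * A1 = fps_X * ((1 + 5 * fps_X) * fps_deriv Zser_moeb)"
    by (simp only: moeb_den_eq moeb_def) (simp add: mult_ac)
  ultimately have "V * Zser_moeb = Zser_moeb + 2 * (fps_X * ((1 + 5 * fps_X) * fps_deriv Zser_moeb))"
    by (simp add: mult.assoc)
  also have "\<dots> = (1 + w_ser) * Zser_moeb"
  proof -
    have "inverse Zser_moeb * Zser_moeb = 1" using Zser_moeb_low by (intro inverse_mult_eq_1) simp
    hence "w_ser * Zser_moeb = 2 * (fps_X * ((1 + 5 * fps_X) * fps_deriv Zser_moeb))"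
      by (simp add: w_ser_def w_red_def mult.assoc mult.left_commute[of 2])
    thus ?thesis by (simp add: distrib_right)
  qed
  finally have "V * Zser_moeb = (1 + w_ser) * Zser_moeb" .
  moreover have "Zser_moeb \<noteq> 0" using Zser_moeb_low by auto
  ultimately show ?thesis by (simp add: V_def)
qed

lemma w_red_low: "w_red $ 0 = 1" "w_red $ Suc 0 = - 1"
proof -
  have "inverse Zser_moeb * Zser_moeb = 1" using Zser_moeb_low by (intro inverse_mult_eq_1) simp
  hence eq: "w_red * Zser_moeb = 2 * (1 + 5 * fps_X) * fps_deriv Zser_moeb"
    by (simp add: w_red_def mult.assoc)
  have "(w_red * Zser_moeb) $ 0 = (2 * (1 + 5 * fps_X) * fps_deriv Zser_moeb) $ 0" by (simp only: eq)
  thus 0: "w_red $ 0 = 1" by (simp add: Zser_moeb_low numeral_fps_const)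
  have "(w_red * Zser_moeb) $ Suc 0 = (2 * (1 + 5 * fps_X) * fps_deriv Zser_moeb) $ Suc 0" by (simp only: eq)
  thus "w_red $ Suc 0 = - 1"
    by (simp add: Zser_moeb_low 0 numeral_fps_const fps_mult_nth distrib_right mult.assoc)
qed

text \<open>The reciprocal of \<open>tau_ser\<close>, by \<open>rho_ser_tau_ser\<close>. It is
  written through \<open>w_red\<close> so that the rules for products and inverses give its alien
  derivative.\<close>

definition rho_ser :: "real fps" where "rho_ser = (1 + w_ser) ^ 3 * moeb_den * inverse (w_red\<^sup>2)"
definition tau_ser :: "real fps" where "tau_ser = fps_shift 1 (ren_of_hbar oo moeb)"

lemma rho_ser_w_red: "rho_ser * w_red\<^sup>2 = (1 + w_ser) ^ 3 * moeb_den"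
proof -
  have "inverse (w_red\<^sup>2) * w_red\<^sup>2 = 1" using w_red_low by (intro inverse_mult_eq_1) (simp add: fps_nth_power_0)
  thus ?thesis by (simp add: rho_ser_def mult.assoc)
qed

lemma ren_of_hbar_moeb: "ren_of_hbar oo moeb = fps_X * tau_ser"
  by (simp add: fps_eq_iff tau_ser_def ren_of_hbar_low)

lemma rho_ser_tau_ser: "rho_ser * tau_ser = 1"
proof -
  have "fps_X * ren_of_hbar * W_ser ^ 3 = (W_ser - 1)\<^sup>2"
    unfolding ren_of_hbar_def invcharge_eq[symmetric] by (simp only: power2_eq_square mult.assoc)
  hence "(fps_X * ren_of_hbar * W_ser ^ 3) oo moeb = ((W_ser - 1)\<^sup>2) oo moeb" by simp
  hence "moeb * (fps_X * tau_ser) * (1 + w_ser) ^ 3 = w_ser\<^sup>2"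
    by (simp add: fps_compose_mult_distrib moeb_low fps_compose_power[symmetric] W_ser_moeb ren_of_hbar_moeb
        fps_compose_sub_distrib)
  hence "fps_X\<^sup>2 * (moeb_den * tau_ser * (1 + w_ser) ^ 3) = fps_X\<^sup>2 * w_red\<^sup>2"
    by (simp add: moeb_def w_ser_def power_mult_distrib power2_eq_square mult_ac)
  hence "(1 + w_ser) ^ 3 * moeb_den * tau_ser = w_red\<^sup>2" by (simp add: mult_ac)
  hence "rho_ser * w_red\<^sup>2 * tau_ser = w_red\<^sup>2" by (simp only: rho_ser_w_red)
  hence "(rho_ser * tau_ser) * w_red\<^sup>2 = 1 * w_red\<^sup>2" by (simp only: mult_ac mult_1_left)
  moreover have "w_red \<noteq> 0" using w_red_low by auto
  ultimately show ?thesis by simp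
qed

lemma u_ren_compose: "u_ren oo (fps_X * tau_ser) = w_ser"
proof -
  have T0: "(fps_X * tau_ser) $ 0 = 0" by simp
  have "u_ren oo ren_of_hbar = (W_ser - 1) oo (hbar_of_ren oo ren_of_hbar)"
    unfolding u_ren_def using ren_of_hbar_low hbar_of_ren_low by (simp add: fps_compose_assoc)
  also have "\<dots> = W_ser - 1" by (simp add: compose_ren_of_hbar)
  finally have "(u_ren oo ren_of_hbar) oo moeb = (W_ser - 1) oo moeb" by simp
  thus ?thesis
    using ren_of_hbar_low moeb_low
    by (simp add: fps_compose_assoc[symmetric] ren_of_hbar_moeb fps_compose_sub_distrib W_ser_moeb)
qed

definition y_ser :: "real fps" where "y_ser = fps_X * fps_deriv w_ser"
definition lam_ser :: "real fps" where "lam_ser = rho_ser - 1"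

lemma y_ser_low: "y_ser $ 0 = 0" "y_ser $ Suc 0 = 1"
  by (simp_all add: y_ser_def w_ser_def w_red_low)

text \<open>The linear coefficient of \<open>rho_ser\<close> is \<open>3 - 5 + 2\<close>, from the
  cube, from \<open>moeb_den\<close> and from the inverse square. The constant 5 of the substitution
  is chosen for this cancellation.\<close>

lemma lam_ser_low: "lam_ser $ 0 = 0" "lam_ser $ Suc 0 = 0"
proof -
  have w_ser: "w_ser $ 0 = 0" "w_ser $ Suc 0 = 1" by (simp_all add: w_ser_def w_red_low)
  have "(rho_ser * w_red\<^sup>2) $ 0 = ((1 + w_ser) ^ 3 * moeb_den) $ 0" by (simp only: rho_ser_w_red)
  hence 0: "rho_ser $ 0 = 1" by (simp add: fps_nth_power_0 w_red_low w_ser moeb_den_low)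
  have "(rho_ser * w_red\<^sup>2) $ Suc 0 = ((1 + w_ser) ^ 3 * moeb_den) $ Suc 0" by (simp only: rho_ser_w_red)
  hence "rho_ser $ Suc 0 = 0"
    by (simp add: fps_mult_nth power2_eq_square power3_eq_cube w_red_low w_ser moeb_den_low 0)
  thus "lam_ser $ 0 = 0" "lam_ser $ Suc 0 = 0" using 0 by (simp_all add: lam_ser_def)
qed

lemma fdiv_w_red:
  obtains c where "fdiv w_red c" "c $ 0 = 4 * stokes"
proof -
  obtain c where c: "fdiv Zser_moeb c" "c $ 0 = 0" "c $ Suc 0 = 0" "c $ 2 = 4 * stokes" by (rule Zser_moeb_fdiv)
  define D where "D = fps_shift 1 (dcoeff c)"
  \<comment> \<open>\<open>dcoeff\<close> halves \<open>c $ 2\<close> and moves it to index 1; the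
    shift moves it on to index 0.\<close>
  have D0: "D $ 0 = 2 * stokes" using c by (simp add: D_def dcoeff_def numeral_2_eq_2)
  have "fdiv (fps_shift 1 (fps_X * fps_deriv Zser_moeb)) D"
    unfolding D_def using fdiv_X_deriv[OF c(1,2)] c by (intro fdiv_shift) (auto simp: dcoeff_def)
  moreover have "fps_shift 1 (fps_X * fps_deriv Zser_moeb) = fps_deriv Zser_moeb" by (rule fps_ext) simp
  ultimately have D: "fdiv (fps_deriv Zser_moeb) D" by simp
  have i: "fdiv (inverse Zser_moeb) (- c * (inverse Zser_moeb)\<^sup>2)" using Zser_moeb_low by (intro fdiv_inverse c) simp
  have e: "fdiv (2 * (1 + 5 * fps_X)) 0"
    by (rule fdiv_ev_0[of 1]) (auto simp: numeral_fps_const distrib_left mult.assoc)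
  note f = fdiv_mult[OF fdiv_mult[OF e D] i, folded w_red_def]
  show ?thesis by (rule that[OF f]) (simp add: c D0 Zser_moeb_low numeral_fps_const)
qed

lemma fdiv_y_ser_lam_ser:
  obtains Y L where "fdiv y_ser Y" "Y $ 0 = 2 * stokes" "fdiv lam_ser L" "L $ 0 = - 8 * stokes"
proof -
  obtain c where c: "fdiv w_red c" "c $ 0 = 4 * stokes" by (rule fdiv_w_red)
  have w_ser: "fdiv w_ser (fps_X * c)" unfolding w_ser_def using fdiv_mult[OF fdiv_X c(1)] by simp
  have "fdiv (1 + w_ser) (fps_X * c)" using fdiv_add[OF fdiv_1 w_ser] by simp
  from fdiv_power[OF this, of 3] have p: "fdiv ((1 + w_ser) ^ 3) (of_nat 3 * (1 + w_ser) ^ (3 - 1) * (fps_X * c))" .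
  have "fdiv (inverse (w_red\<^sup>2)) (- (of_nat 2 * w_red ^ (2 - 1) * c) * (inverse (w_red\<^sup>2))\<^sup>2)"
    using fdiv_power[OF c(1), of 2] w_red_low by (intro fdiv_inverse) (auto simp: fps_nth_power_0)
  \<comment> \<open>Only the inverse square contributes at index 0, with
    \<open>- 2 * (4 * stokes)\<close>; the alien derivative of the cube carries a factor
    \<open>fps_X\<close>.\<close>
  note r = fdiv_mult[OF fdiv_mult[OF p moeb_den_fdiv] this, folded rho_ser_def]
  note l = fdiv_diff[OF r fdiv_1, folded lam_ser_def]
  show ?thesis
  proof (rule that[OF _ _ l])
    show "fdiv y_ser (dcoeff (fps_X * c))" unfolding y_ser_def by (rule fdiv_X_deriv[OF w_ser]) simp
    show "dcoeff (fps_X * c) $ 0 = 2 * stokes" using c by (simp add: dcoeff_def)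
  qed (simp add: c w_red_low w_ser_def moeb_den_low fps_nth_power_0)
qed

lemma n_u_ren_eq: "real n * u_ren $ n = (y_ser * (1 + lam_ser) ^ n) $ n"
  using lagrange_inversion[OF rho_ser_tau_ser, of n u_ren] by (simp add: u_ren_compose y_ser_def lam_ser_def)

text \<open>The leading coefficient is \<open>2 * stokes\<close> from \<open>j = 0\<close> plus
  \<open>- 4 * stokes\<close> from \<open>j = 1\<close>. For larger \<open>j\<close> the vanishing
  of \<open>lam_ser\<close> to second order outweighs the power of \<open>n\<close> in the
  binomial.\<close>

lemma n_u_ren_asympt: "\<exists>c. asympt (Suc R) (\<lambda>n. real n * u_ren $ n) c \<and> c $ 0 = - 2 * stokes"
proof -
  obtain Y L where YL: "fdiv y_ser Y" "Y $ 0 = 2 * stokes" "fdiv lam_ser L" "L $ 0 = - 8 * stokes"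
    by (rule fdiv_y_ser_lam_ser)
  have f: "fdiv (y_ser * lam_ser ^ j) (y_ser * (of_nat j * lam_ser ^ (j - 1) * L) + lam_ser ^ j * Y)" for j
    by (rule fdiv_mult[OF YL(1) fdiv_power[OF YL(3)]])
  define B where "B = (\<lambda>j. Abs_fps (\<lambda>n. real (n choose j) * (y_ser * lam_ser ^ j) $ n))"
  have "\<exists>d. fdiv (B j) d \<and> d $ 0 = (if j = 0 then 2 * stokes else if j = 1 then - 4 * stokes else 0)" for j
  proof -
    consider "j = 0" | "j = 1" | "j \<ge> 2" by linarith
    thus ?thesis
    proof cases
      case 1
      have "B 0 = y_ser" by (simp add: B_def fps_eq_iff)
      thus ?thesis using YL 1 by auto
    next
      case 2
      have "B 1 = fps_X * fps_deriv (y_ser * lam_ser)"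
      proof (rule fps_ext)
        fix n show "B 1 $ n = (fps_X * fps_deriv (y_ser * lam_ser)) $ n"
          unfolding fps_X_mult_deriv_nth by (simp add: B_def)
      qed
      moreover have "fdiv (y_ser * lam_ser) (y_ser * L + lam_ser * Y)" by (rule fdiv_mult[OF YL(1,3)])
      hence "fdiv (fps_X * fps_deriv (y_ser * lam_ser)) (dcoeff (y_ser * L + lam_ser * Y))"
        by (rule fdiv_X_deriv) (simp add: y_ser_low lam_ser_low)
      moreover have "dcoeff (y_ser * L + lam_ser * Y) $ 0 = - 4 * stokes"
        by (simp add: dcoeff_def fps_mult_nth y_ser_low lam_ser_low YL)
      ultimately show ?thesis using 2 by auto
    next
      case 3
      have lam_ser: "lam_ser = fps_X ^ 2 * fps_shift 2 lam_ser"
      proof (rule fps_ext)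
        fix n show "lam_ser $ n = (fps_X ^ 2 * fps_shift 2 lam_ser) $ n"
        proof (cases "n < 2")
          case True
          thus ?thesis using lam_ser_low by (auto simp: fps_X_power_mult_nth less_2_cases_iff)
        next
          case False
          hence "n - 2 + 2 = n" by simp
          thus ?thesis using False by (simp only: fps_X_power_mult_nth fps_shift_nth if_False)
        qed
      qed
      have y_ser: "y_ser = fps_X * fps_shift 1 y_ser"
        using y_ser_low by (auto simp: fps_eq_iff)
      have p: "lam_ser ^ i = fps_X ^ (2 * i) * fps_shift 2 lam_ser ^ i" for i
        by (subst lam_ser) (simp add: power_mult_distrib power_mult)
      \<comment> \<open>Both products vanish to order at least \<open>2 * j - 1\<close>, and
        \<open>2 * j - 1 >= j + 1\<close> for \<open>j >= 2\<close>. The binomial factor uses up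
        \<open>j\<close> of these orders and leaves at least one.\<close>
      have "(y_ser * (of_nat j * lam_ser ^ (j - 1) * L) + lam_ser ^ j * Y) $ i = 0" if i: "i < j + 1" for i
      proof -
        have "y_ser * (of_nat j * lam_ser ^ (j - 1) * L) = fps_X ^ Suc (2 * (j - 1)) * (fps_shift 1 y_ser * (of_nat j * fps_shift 2 lam_ser ^ (j - 1) * L))"
          by (subst y_ser, subst p) (simp add: mult_ac)
        hence "(y_ser * (of_nat j * lam_ser ^ (j - 1) * L)) $ i = 0"
          using i 3 by (simp only: fps_X_power_mult_nth) simp
        moreover have "(lam_ser ^ j * Y) $ i = 0"
          using i 3 by (subst p) (simp add: mult.assoc fps_X_power_mult_nth)
        ultimately show ?thesis by simp
      qed
      hence "\<exists>d. fdiv (B j) d \<and> (\<forall>i<1. d $ i = 0)"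
        unfolding B_def by (intro fdiv_binomial[OF f])
      thus ?thesis using 3 by auto
    qed
  qed
  then obtain d where d: "\<And>j. fdiv (B j) (d j)"
    "\<And>j. d j $ 0 = (if j = 0 then 2 * stokes else if j = 1 then - 4 * stokes else 0)"
    by metis
  define N where "N = Suc (Suc R)"
  have "(\<lambda>n. real n * u_ren $ n - (\<Sum>j<N. B j $ n)) \<in> O(\<lambda>n. growth (n - Suc R))"
    unfolding n_u_ren_eq B_def N_def fps_nth_Abs_fps
    using YL(1,3)[THEN fdiv_bigo] y_ser_low lam_ser_low by (intro binomial_tail_bigo) auto
  from asympt_bigo[OF this]
  have 1: "asympt (Suc R) (\<lambda>n. real n * u_ren $ n - (\<Sum>j<N. B j $ n)) 0" .
  have 2: "asympt (Suc R) (\<lambda>n. \<Sum>j<N. B j $ n) (\<Sum>j<N. d j)"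
    by (rule asympt_sum) (use d(1) in \<open>simp add: fdiv_def\<close>)
  have "asympt (Suc R) (\<lambda>n. real n * u_ren $ n) (\<Sum>j<N. d j)"
    using asympt_add[OF 1 2] by simp
  moreover have "(\<Sum>j<N. d j) $ 0 = - 2 * stokes"
    unfolding N_def sum.lessThan_Suc_shift by (simp add: fps_sum_nth d(2))
  ultimately show ?thesis by blast
qed

text \<open>Division by \<open>n\<close> gains one order and empties index 0. The coefficient at
  index 1 is recovered by reading \<open>dcoeff\<close> backwards.\<close>

lemma fdiv_u_ren:
  obtains U where "fdiv u_ren U" "U $ 0 = 0" "U $ Suc 0 = - 4 * stokes"
proof -
  have "\<exists>c. asympt R (fps_nth u_ren) c" for R
  proof -
    obtain e where e: "asympt (Suc R) (\<lambda>n. real n * u_ren $ n) e" using n_u_ren_asympt[of R] by blast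
    obtain c where "asympt (Suc (Suc R)) (\<lambda>n. real n * u_ren $ n / (real n + real 0)) c"
      using asympt_div_n[OF e, of 0] by (rule exE)
    moreover have "\<forall>\<^sub>F n in sequentially. real n * u_ren $ n / (real n + real 0) = u_ren $ n"
      using eventually_gt_at_top[of 0] by eventually_elim simp
    ultimately have "asympt (Suc (Suc R)) (fps_nth u_ren) c"
      using asympt_cong_ev[of "\<lambda>n. real n * u_ren $ n / (real n + real 0)" "fps_nth u_ren" "Suc (Suc R)" c c] by simp
    from asympt_mono[OF this, of R] show ?thesis by auto
  qed
  from asympt_choice[OF this] obtain U where U: "fdiv u_ren U" unfolding fdiv_def by (rule exE)
  obtain e where e: "asympt (Suc 0) (\<lambda>n. real n * u_ren $ n) e" "e $ 0 = - 2 * stokes"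
    using n_u_ren_asympt[of 0] by blast
  have 1: "(\<lambda>n. real n * u_ren $ n / (real n + real 0)) \<in> O(\<lambda>n. growth (n - Suc 0))"
    using asympt_imp_bigo[OF e(1)] by (intro div_n_bigo) simp
  have "\<forall>\<^sub>F n in sequentially. real n * u_ren $ n / (real n + real 0) = u_ren $ n"
    using eventually_gt_at_top[of 0] by eventually_elim simp
  from landau_o.big.in_cong[THEN iffD1, OF this 1] have "fps_nth u_ren \<in> O(\<lambda>n. growth (n - Suc 0))" .
  hence U0: "U $ 0 = 0"
    using asympt_unique_0[of 1 "fps_nth u_ren" U 1 0] U by (simp add: fdiv_def)
  have "fdiv (fps_X * fps_deriv u_ren) (dcoeff U)" by (rule fdiv_X_deriv[OF U U0])
  moreover have "fps_nth (fps_X * fps_deriv u_ren) = (\<lambda>n. real n * u_ren $ n)"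
    by (rule ext) (rule fps_X_mult_deriv_nth)
  ultimately have "asympt (Suc 0) (\<lambda>n. real n * u_ren $ n) (dcoeff U)" by (simp add: fdiv_def)
  from asympt_unique[OF this e(1), of 0] e(2) have "dcoeff U $ 0 = - 2 * stokes" by simp
  hence "U $ Suc 0 = - 4 * stokes" using U0 by (simp add: dcoeff_def)
  with U U0 show ?thesis by (rule that)
qed

section \<open>Low-order coefficients of \<open>u_ren\<close> and of its alien derivative\<close>

lemma fps_mult_nth_low:
  fixes f g :: "real fps"
  shows "(f * g) $ 0 = f $ 0 * g $ 0"
    and "(f * g) $ 1 = f $ 0 * g $ 1 + f $ 1 * g $ 0"
    and "(f * g) $ 2 = f $ 0 * g $ 2 + f $ 1 * g $ 1 + f $ 2 * g $ 0"
    and "(f * g) $ 3 = f $ 0 * g $ 3 + f $ 1 * g $ 2 + f $ 2 * g $ 1 + f $ 3 * g $ 0"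
    and "(f * g) $ 4 = f $ 0 * g $ 4 + f $ 1 * g $ 3 + f $ 2 * g $ 2 + f $ 3 * g $ 1 + f $ 4 * g $ 0"
  by (simp_all add: fps_mult_nth eval_nat_numeral)

lemma fps_basis_nth_low:
  "(1 :: real fps) $ 0 = 1" "(1 :: real fps) $ 1 = 0" "(1 :: real fps) $ 2 = 0" "(1 :: real fps) $ 3 = 0" "(1 :: real fps) $ 4 = 0"
  "(2 :: real fps) $ 0 = 2" "(2 :: real fps) $ 1 = 0" "(2 :: real fps) $ 2 = 0" "(2 :: real fps) $ 3 = 0" "(2 :: real fps) $ 4 = 0"
  "(4 :: real fps) $ 0 = 4" "(4 :: real fps) $ 1 = 0" "(4 :: real fps) $ 2 = 0" "(4 :: real fps) $ 3 = 0" "(4 :: real fps) $ 4 = 0"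
  "(fps_X :: real fps) $ 0 = 0" "(fps_X :: real fps) $ 1 = 1" "(fps_X :: real fps) $ 2 = 0" "(fps_X :: real fps) $ 3 = 0" "(fps_X :: real fps) $ 4 = 0"
  by (simp_all add: numeral_fps_const)

definition q_ser :: "real fps" where "q_ser = fps_deriv u_ren"
definition K_ser :: "real fps" where "K_ser = 1 + u_ren"
text \<open>\<open>b_ser\<close> and \<open>zeta_ser\<close> are factors of \<open>u_ren_ode\<close>
  divided by \<open>fps_X\<close> and \<open>fps_X^2\<close>, so that \<open>z_vertex_ode\<close>
  has no common power of \<open>fps_X\<close> left.\<close>

definition b_ser :: "real fps" where "b_ser = (2 - u_ren) * q_ser - K_ser * z_vertex"
definition zeta_ser :: "real fps" where "zeta_ser = fps_shift 1 (K_ser - z_vertex)"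

lemma zeta_ser_eq: "fps_X * K_ser - u_ren = fps_X * fps_X * zeta_ser"
proof -
  have "K_ser - z_vertex = fps_X * zeta_ser"
    by (simp add: zeta_ser_def fps_eq_iff K_ser_def u_ren_low z_vertex_nth_0)
  hence "fps_X * (K_ser - z_vertex) = fps_X * fps_X * zeta_ser" by (simp add: mult.assoc)
  thus ?thesis by (simp add: u_ren_z right_diff_distrib)
qed

lemma b_ser_eq: "(2 - u_ren) * (fps_X * q_ser) - K_ser * u_ren = fps_X * b_ser"
  by (subst (2) u_ren_z) (simp add: b_ser_def algebra_simps)

lemma z_vertex_ode: "2 * z_vertex * z_vertex * q_ser = zeta_ser * K_ser * b_ser"
proof -
  have "2 * u_ren\<^sup>2 * (fps_X * q_ser) = (fps_X * K_ser - u_ren) * K_ser * ((2 - u_ren) * (fps_X * q_ser) - K_ser * u_ren)"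
    using u_ren_ode by (simp only: q_ser_def K_ser_def)
  hence "2 * u_ren\<^sup>2 * (fps_X * q_ser) = (fps_X * fps_X * zeta_ser) * K_ser * (fps_X * b_ser)"
    by (simp only: zeta_ser_eq b_ser_eq)
  hence "fps_X * fps_X * fps_X * (2 * z_vertex * z_vertex * q_ser) = fps_X * fps_X * fps_X * (zeta_ser * K_ser * b_ser)"
    by (subst (asm) u_ren_z) (simp only: power2_eq_square mult_ac)
  thus ?thesis by simp
qed

lemma z_q_zeta_nth_low:
  "z_vertex $ 0 = u_ren $ 1" "z_vertex $ 1 = u_ren $ 2" "z_vertex $ 2 = u_ren $ 3" "z_vertex $ 3 = u_ren $ 4" "z_vertex $ 4 = u_ren $ 5"
  "q_ser $ 0 = u_ren $ 1" "q_ser $ 1 = 2 * u_ren $ 2" "q_ser $ 2 = 3 * u_ren $ 3" "q_ser $ 3 = 4 * u_ren $ 4" "q_ser $ 4 = 5 * u_ren $ 5"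
  "zeta_ser $ 0 = u_ren $ 1 - u_ren $ 2" "zeta_ser $ 1 = u_ren $ 2 - u_ren $ 3" "zeta_ser $ 2 = u_ren $ 3 - u_ren $ 4" "zeta_ser $ 3 = u_ren $ 4 - u_ren $ 5"
  "zeta_ser $ 4 = u_ren $ 5 - u_ren $ 6"
proof -
  have z: "z_vertex $ n = u_ren $ (n + 1)" for n by (simp add: u_ren_z)
  have zz: "zeta_ser $ n = u_ren $ (n + 1) - u_ren $ (n + 2)" for n
    by (simp add: zeta_ser_def K_ser_def z)
  show "z_vertex $ 0 = u_ren $ 1" "z_vertex $ 1 = u_ren $ 2" "z_vertex $ 2 = u_ren $ 3" "z_vertex $ 3 = u_ren $ 4" "z_vertex $ 4 = u_ren $ 5"
    by (simp_all add: z eval_nat_numeral)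
  show "q_ser $ 0 = u_ren $ 1" "q_ser $ 1 = 2 * u_ren $ 2" "q_ser $ 2 = 3 * u_ren $ 3" "q_ser $ 3 = 4 * u_ren $ 4" "q_ser $ 4 = 5 * u_ren $ 5"
    by (simp_all add: q_ser_def eval_nat_numeral)
  show "zeta_ser $ 0 = u_ren $ 1 - u_ren $ 2" "zeta_ser $ 1 = u_ren $ 2 - u_ren $ 3" "zeta_ser $ 2 = u_ren $ 3 - u_ren $ 4" "zeta_ser $ 3 = u_ren $ 4 - u_ren $ 5"
    "zeta_ser $ 4 = u_ren $ 5 - u_ren $ 6"
    by (simp_all add: zz eval_nat_numeral)
qed

text \<open>The coefficient of \<open>z_vertex_ode\<close> at index \<open>n\<close> is linear in
  \<open>u_ren $ (n + 2)\<close>, which enters through \<open>zeta_ser $ n\<close> alone, so the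
  values follow one by one.\<close>

lemma u_ren_nth_low:
  "u_ren $ 0 = 0" "u_ren $ 1 = 1" "u_ren $ 2 = - 1" "u_ren $ 3 = - 1" "u_ren $ 4 = - 13" "u_ren $ 5 = - 93" "u_ren $ 6 = - 1245"
proof -
  show u0: "u_ren $ 0 = 0" and u1: "u_ren $ 1 = 1" using u_ren_low by simp_all
  have eq: "(2 * z_vertex * z_vertex * q_ser) $ n = (zeta_ser * K_ser * b_ser) $ n" for n by (simp only: z_vertex_ode)
  note low = fps_mult_nth_low fps_basis_nth_low fps_add_nth fps_sub_nth b_ser_def K_ser_def z_q_zeta_nth_low u0 u1
  show u2: "u_ren $ 2 = - 1" using eq[of 0] by (simp add: low del: One_nat_def)
  show u3: "u_ren $ 3 = - 1" using eq[of 1] by (simp add: low u2 del: One_nat_def)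
  show u4: "u_ren $ 4 = - 13" using eq[of 2] by (simp add: low u2 u3 del: One_nat_def)
  show u5: "u_ren $ 5 = - 93" using eq[of 3] by (simp add: low u2 u3 u4 del: One_nat_def)
  show u6: "u_ren $ 6 = - 1245" using eq[of 4] by (simp add: low u2 u3 u4 u5 del: One_nat_def)
qed

text \<open>The alien derivative is a derivation, so it linearises \<open>u_ren_ode\<close>, and
  uniqueness of expansions equates both sides. \<open>Y\<close> belongs to
  \<open>fps_X * fps_deriv u_ren\<close>; a common \<open>fps_X^2\<close> is cancelled.\<close>

lemma linearised_z_vertex_ode:
  assumes "fdiv u_ren (fps_X * V)"
  defines "Y \<equiv> dcoeff (fps_X * V)"
  shows "4 * fps_X * z_vertex * q_ser * V + 2 * z_vertex * z_vertex * Y =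
    (fps_X - 1) * V * K_ser * b_ser + fps_X * fps_X * zeta_ser * V * b_ser +
    zeta_ser * K_ser * ((2 - u_ren) * Y - fps_X * V * (fps_X * q_ser + 1 + 2 * u_ren))"
proof -
  define Q U where "Q = fps_X * q_ser" and "U = fps_X * V"
  define A B where "A = fps_X * K_ser - u_ren" and "B = (2 - u_ren) * Q - K_ser * u_ren"
  have u_ren: "fdiv u_ren U" using assms(1) by (simp add: U_def)
  have Q: "fdiv Q Y" unfolding Q_def q_ser_def Y_def by (rule fdiv_X_deriv[OF assms(1)]) simp
  have K_ser: "fdiv K_ser U" using fdiv_add[OF fdiv_1 u_ren] by (simp add: K_ser_def)
  have A: "fdiv A (fps_X * U - U)"
    using fdiv_diff[OF fdiv_mult[OF fdiv_X K_ser] u_ren] by (simp add: A_def)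
  have "fdiv (2 - u_ren) (- U)" using fdiv_diff[OF fdiv_numeral u_ren] by simp
  from fdiv_diff[OF fdiv_mult[OF this Q] fdiv_mult[OF K_ser u_ren]]
  have B: "fdiv B ((2 - u_ren) * Y + Q * (- U) - (K_ser * U + u_ren * U))" by (simp only: B_def)
  have "2 * (u_ren * u_ren * Q) = A * K_ser * B"
    using u_ren_ode by (simp only: A_def B_def K_ser_def Q_def q_ser_def power2_eq_square mult.assoc)
  moreover have "fdiv (2 * (u_ren * u_ren * Q)) (2 * (u_ren * u_ren * Y + Q * (u_ren * U + u_ren * U)))"
    using fdiv_mult[OF fdiv_numeral[of "num.Bit0 num.One"] fdiv_mult[OF fdiv_mult[OF u_ren u_ren] Q]] by simp
  moreover note fdiv_mult[OF fdiv_mult[OF A K_ser] B]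
  ultimately have "2 * (u_ren * u_ren * Y + Q * (u_ren * U + u_ren * U)) =
      A * K_ser * ((2 - u_ren) * Y + Q * (- U) - (K_ser * U + u_ren * U)) + B * (A * U + K_ser * (fps_X * U - U))"
    using fdiv_unique by metis
  moreover have AB: "A = fps_X * fps_X * zeta_ser" "B = fps_X * b_ser"
    unfolding A_def B_def Q_def by (simp_all only: zeta_ser_eq b_ser_eq)
  moreover have "2 * (u_ren * u_ren * Y + Q * (u_ren * U + u_ren * U)) =
      fps_X * fps_X * (4 * fps_X * z_vertex * q_ser * V + 2 * z_vertex * z_vertex * Y)"
    unfolding Q_def U_def u_ren_z by (simp add: algebra_simps)
  moreover have "fps_X * fps_X * zeta_ser * K_ser * ((2 - u_ren) * Y + Q * (- U) - (K_ser * U + u_ren * U)) + fps_X * b_ser * (fps_X * fps_X * zeta_ser * U + K_ser * (fps_X * U - U)) =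
      fps_X * fps_X * ((fps_X - 1) * V * K_ser * b_ser + fps_X * fps_X * zeta_ser * V * b_ser +
    zeta_ser * K_ser * ((2 - u_ren) * Y - fps_X * V * (fps_X * q_ser + 1 + 2 * u_ren)))"
    unfolding Q_def U_def by (simp add: K_ser_def algebra_simps)
  ultimately have "fps_X * fps_X * (4 * fps_X * z_vertex * q_ser * V + 2 * z_vertex * z_vertex * Y) =
     fps_X * fps_X * ((fps_X - 1) * V * K_ser * b_ser + fps_X * fps_X * zeta_ser * V * b_ser +
    zeta_ser * K_ser * ((2 - u_ren) * Y - fps_X * V * (fps_X * q_ser + 1 + 2 * u_ren)))"
    by metis
  thus ?thesis by simp
qed

text \<open>At index \<open>n\<close> the terms with \<open>V $ n\<close> cancel:
  \<open>V $ n\<close> on the left, \<open>- V $ n + 2 * V $ n\<close> on the right. The equation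
  then relates \<open>V $ (n - 1)\<close> to earlier coefficients, which is why indices 2, 3 and 4
  are used.\<close>

lemma alien_u_ren_nth_low:
  assumes "fdiv u_ren (fps_X * V)"
  shows "V $ 1 = - 13 / 2 * V $ 0" "V $ 2 = - 67 / 8 * V $ 0" "V $ 3 = - 5177 / 48 * V $ 0"
proof -
  define Y where "Y = dcoeff (fps_X * V)"
  have Y: "Y $ 0 = V $ 0 / 2" "Y $ 1 = (V $ 1 - 2 * V $ 0) / 2" "Y $ 2 = V $ 2 / 2" "Y $ 3 = (V $ 3 + 2 * V $ 2) / 2"
    "Y $ 4 = (V $ 4 + 4 * V $ 3) / 2"
    by (simp_all add: Y_def dcoeff_def)
  have K_ser: "K_ser $ 0 = 1" "K_ser $ 1 = 1" "K_ser $ 2 = - 1" "K_ser $ 3 = - 1" "K_ser $ 4 = - 13"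
    by (simp_all add: K_ser_def u_ren_nth_low[unfolded One_nat_def])
  have eq: "(4 * fps_X * z_vertex * q_ser * V + 2 * z_vertex * z_vertex * Y) $ n = ((fps_X - 1) * V * K_ser * b_ser + fps_X * fps_X * zeta_ser * V * b_ser +
    zeta_ser * K_ser * ((2 - u_ren) * Y - fps_X * V * (fps_X * q_ser + 1 + 2 * u_ren))) $ n" for n
    unfolding Y_def by (simp only: linearised_z_vertex_ode[OF assms])
  note low = fps_mult_nth_low fps_basis_nth_low fps_add_nth fps_sub_nth b_ser_def z_q_zeta_nth_low u_ren_nth_low K_ser Y
  show V1: "V $ 1 = - 13 / 2 * V $ 0" using eq[of 2] by (simp add: field_simps low del: One_nat_def)
  show V2: "V $ 2 = - 67 / 8 * V $ 0" using eq[of 3] by (simp add: field_simps low V1 del: One_nat_def)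
  show V3: "V $ 3 = - 5177 / 48 * V $ 0" using eq[of 4] by (simp add: field_simps low V1 V2 del: One_nat_def)
qed

section \<open>Return to Gamma functions\<close>

lemma Gamma_eq_growth:
  assumes "k \<le> n"
  shows "(1/2) powr (- real n - 2 + real k) * Gamma (real n + 2 - real k) = 4 * growth (n - k)"
proof -
  define m where "m = n - k"
  have e: "- real n - 2 + real k = - real (m + 2)" "real n + 2 - real k = 1 + real (m + 1)"
    using assms by (simp_all add: m_def of_nat_diff)
  have "(1/2 :: real) powr (- real j) = 2 ^ j" for j
    by (simp add: powr_minus powr_realpow power_one_over)
  from this[of "m + 2"] have "(1/2 :: real) powr (- real (m + 2)) = 2 ^ (m + 2)" .
  moreover have "Gamma (1 + real (m + 1)) = fact (m + 1)" by (rule Gamma_fact)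
  ultimately show ?thesis unfolding e by (simp add: growth_def m_def power_add)
qed

lemma growth_prod: "k \<le> n \<Longrightarrow> growth n = 2 ^ k * (\<Prod>i<k. real n + 1 - real i) * growth (n - k)"
proof (induction k)
  case (Suc k)
  thus ?case using growth_diff_Suc[of k n] by (simp add: algebra_simps)
qed simp

lemma growth_prod_ge:
  assumes "2 * R \<le> n" "k \<le> R"
  shows "real n ^ k * growth (n - k) \<le> growth n"
  using assms(2)
proof (induction k)
  case (Suc k)
  have "real n ^ k * (real n * growth (n - Suc k)) \<le> real n ^ k * (2 * (real n - real k + 1) * growth (n - Suc k))"
    using Suc assms(1) by (intro mult_left_mono mult_right_mono) auto
  also have "2 * (real n - real k + 1) * growth (n - Suc k) = growth (n - k)"
    using Suc assms(1) by (intro growth_diff_Suc[symmetric]) auto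
  finally show ?case using Suc by (simp add: mult_ac)
qed simp

theorem mainTheorem11:
  shows "\<exists>c :: nat \<Rightarrow> real.
    c 0 = 1 \<and> c 1 = - (13/2) \<and> c 2 = - (67/8) \<and> c 3 = - (5177/48) \<and>
    (\<forall>R::nat.
      (\<lambda>n. (1 - z_vertex) $ n
            - exp (-5/2) / pi *
              (\<Sum>k<R. c k * (1/2) powr (- real n - 2 + real k) * Gamma (real n + 2 - real k)))
      \<in> O(\<lambda>n. (1/2) powr (- real n) * Gamma (real n + 2 - real R))) \<and>
    (\<forall>R\<ge>4.
      (\<lambda>n. (1 - z_vertex) $ n
            - exp (-5/2) / pi * (1/2) powr (- real n - 2) * Gamma (real n + 2) *
              (1 - 1/2 * (13/2) * (1 / (real n + 1))
                 - (1/2)^2 * (67/8) * (1 / (real n * (real n + 1)))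
                 - (1/2)^3 * (5177/48) * (1 / ((real n - 1) * real n * (real n + 1)))
                 + (\<Sum>k=4..<R. (1/2)^k * c k * (1 / (\<Prod>i<k. real n + 1 - real i)))))
      \<in> O(\<lambda>n. (1/2) powr (- real n - 2) * Gamma (real n + 2) * (1 / real n ^ R)))"
proof -
  obtain U where U: "fdiv u_ren U" "U $ 0 = 0" "U $ Suc 0 = - 4 * stokes" by (rule fdiv_u_ren)
  define V where "V = fps_shift 1 U"
  have UV: "U = fps_X * V" using U(2) by (simp add: V_def fps_eq_iff)
  have V0: "V $ 0 = - 4 * stokes" using U(3) by (simp add: V_def)
  note V = alien_u_ren_nth_low[OF U(1)[unfolded UV]]
  have stokes: "stokes > 0" by (simp add: stokes_def)
  \<comment> \<open>The sign comes from \<open>1 - z_vertex\<close>, the 4 from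
    \<open>Gamma_eq_growth\<close>; dividing by \<open>stokes\<close> pulls out the common
    prefactor.\<close>
  define c where "c = (\<lambda>k. - V $ k / (4 * stokes))"
  have c: "stokes * (4 * c k) = - V $ k" for k using stokes by (simp add: c_def)
  have c_low: "c 0 = 1" "c 1 = - (13/2)" "c 2 = - (67/8)" "c 3 = - (5177/48)"
  proof -
    have *: "c k = - V $ k / (4 * stokes)" for k by (simp add: c_def)
    show "c 0 = 1" "c 1 = - (13/2)" "c 2 = - (67/8)" "c 3 = - (5177/48)"
      unfolding * using stokes V V0 by (simp_all add: field_simps)
  qed
  \<comment> \<open>\<open>z_vertex\<close> is \<open>u_ren\<close> with its index shifted, so its
    expansion starts at \<open>growth n\<close> itself.\<close>
  have "fps_shift 1 u_ren = z_vertex" by (simp add: u_ren_z fps_eq_iff)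
  hence "fdiv z_vertex V" using fdiv_shift[OF U(1,2)] by (simp add: V_def)
  from fdiv_diff[OF fdiv_1 this] have "fdiv (1 - z_vertex) (- V)" by simp
  hence main: "(\<lambda>n. (1 - z_vertex) $ n - (\<Sum>k<R. - V $ k * growth (n - k))) \<in> O(\<lambda>n. growth (n - R))" for R
    by (simp add: fdiv_def asympt_def)
  have 1: "(\<lambda>n. (1 - z_vertex) $ n - exp (-5/2) / pi *
              (\<Sum>k<R. c k * (1/2) powr (- real n - 2 + real k) * Gamma (real n + 2 - real k)))
      \<in> O(\<lambda>n. (1/2) powr (- real n) * Gamma (real n + 2 - real R))" for R
  proof -
    have "\<forall>\<^sub>F n in sequentially. (1 - z_vertex) $ n - (\<Sum>k<R. - V $ k * growth (n - k)) =
        (1 - z_vertex) $ n - exp (-5/2) / pi *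
              (\<Sum>k<R. c k * (1/2) powr (- real n - 2 + real k) * Gamma (real n + 2 - real k))"
      using eventually_ge_at_top[of R]
    proof eventually_elim
      case (elim n)
      have "(\<Sum>k<R. - V $ k * growth (n - k)) = (\<Sum>k<R. stokes * (c k * ((1/2) powr (- real n - 2 + real k) * Gamma (real n + 2 - real k))))"
      proof (rule sum.cong)
        fix k assume "k \<in> {..<R}"
        hence "k \<le> n" using elim by simp
        show "- V $ k * growth (n - k) = stokes * (c k * ((1/2) powr (- real n - 2 + real k) * Gamma (real n + 2 - real k)))"
          unfolding Gamma_eq_growth[OF \<open>k \<le> n\<close>] c[symmetric] by simp
      qed simp
      thus ?case by (simp only: sum_distrib_left stokes_def mult.assoc)
    qed
    from landau_o.big.in_cong[THEN iffD1, OF this main]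
    have "(\<lambda>n. (1 - z_vertex) $ n - exp (-5/2) / pi *
              (\<Sum>k<R. c k * (1/2) powr (- real n - 2 + real k) * Gamma (real n + 2 - real k))) \<in> O(\<lambda>n. growth (n - R))" .
    \<comment> \<open>The stated error has the exponential \<open>2 ^ n\<close> without the shift by
      \<open>R\<close>; this changes only the constant.\<close>
    moreover have "(\<lambda>n. growth (n - R)) \<in> O(\<lambda>n. (1/2) powr (- real n) * Gamma (real n + 2 - real R))"
    proof (rule landau_o.bigI[of 1])
      show "\<forall>\<^sub>F n in sequentially. norm (growth (n - R)) \<le> 1 * norm ((1/2) powr (- real n) * Gamma (real n + 2 - real R))"
        using eventually_ge_at_top[of R]
      proof eventually_elim
        case (elim n)
        have "Gamma (real n + 2 - real R) > 0" using elim by (intro Gamma_real_pos) auto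
        moreover have "(1/2 :: real) powr (- real n) * 4 \<ge> (1/2) powr (- real n - 2 + real R)"
        proof -
          have "(1/2 :: real) powr (- real n - 2 + real R) \<le> (1/2) powr (- real n - 2)"
            by (intro powr_mono') auto
          also have "\<dots> = (1/2) powr (- real n) * 4" by (simp add: powr_diff power2_eq_square)
          finally show ?thesis .
        qed
        ultimately have "(1/2) powr (- real n - 2 + real R) * Gamma (real n + 2 - real R) \<le>
            (1/2) powr (- real n) * 4 * Gamma (real n + 2 - real R)"
          by (intro mult_right_mono) auto
        hence "growth (n - R) \<le> (1/2) powr (- real n) * Gamma (real n + 2 - real R)"
          unfolding Gamma_eq_growth[OF elim] by simp
        thus ?case by simp
      qed
    qed simp
    ultimately show ?thesis by (rule landau_o.big_trans)
  qed
  have 2: "(\<lambda>n. (1 - z_vertex) $ n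
            - exp (-5/2) / pi * (1/2) powr (- real n - 2) * Gamma (real n + 2) *
              (1 - 1/2 * (13/2) * (1 / (real n + 1))
                 - (1/2)^2 * (67/8) * (1 / (real n * (real n + 1)))
                 - (1/2)^3 * (5177/48) * (1 / ((real n - 1) * real n * (real n + 1)))
                 + (\<Sum>k=4..<R. (1/2)^k * c k * (1 / (\<Prod>i<k. real n + 1 - real i)))))
      \<in> O(\<lambda>n. (1/2) powr (- real n - 2) * Gamma (real n + 2) * (1 / real n ^ R))" if R: "R \<ge> 4" for R
  proof -
    have G: "(1/2) powr (- real n - 2) * Gamma (real n + 2) = 4 * growth n" for n
      using Gamma_eq_growth[of 0 n] by simp
    have "\<forall>\<^sub>F n in sequentially. (1 - z_vertex) $ n - (\<Sum>k<R. - V $ k * growth (n - k)) = (1 - z_vertex) $ n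
            - exp (-5/2) / pi * (1/2) powr (- real n - 2) * Gamma (real n + 2) *
              (1 - 1/2 * (13/2) * (1 / (real n + 1))
                 - (1/2)^2 * (67/8) * (1 / (real n * (real n + 1)))
                 - (1/2)^3 * (5177/48) * (1 / ((real n - 1) * real n * (real n + 1)))
                 + (\<Sum>k=4..<R. (1/2)^k * c k * (1 / (\<Prod>i<k. real n + 1 - real i))))"
      using eventually_ge_at_top[of R]
    proof eventually_elim
      case (elim n)
      \<comment> \<open>\<open>growth_prod\<close> writes \<open>growth (n - k)\<close> as
        \<open>growth n\<close> divided by \<open>2 ^ k\<close> and a falling product, which gives
        the second form of the expansion.\<close>
      define t where "t = (\<lambda>k. (1/2)^k * c k * (1 / (\<Prod>i<k. real n + 1 - real i)))"
      have "(\<Sum>k<R. - V $ k * growth (n - k)) = (\<Sum>k<R. stokes * (4 * growth n) * t k)"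
      proof (rule sum.cong)
        fix k assume "k \<in> {..<R}"
        hence k: "k \<le> n" using elim by simp
        have "(\<Prod>i<k. real n + 1 - real i) \<noteq> 0" using k by auto
        thus "- V $ k * growth (n - k) = stokes * (4 * growth n) * t k"
          unfolding c[symmetric] t_def growth_prod[OF k] by (simp add: power_one_over)
      qed simp
      also have "\<dots> = stokes * (4 * growth n) * (\<Sum>k<R. t k)" by (simp only: sum_distrib_left)
      also have "(\<Sum>k<R. t k) = (\<Sum>k<4. t k) + (\<Sum>k=4..<R. t k)"
        using sum.atLeastLessThan_concat[of 0 4 R t] R by (simp only: atLeast0LessThan le0)
      also have "(\<Sum>k<4. t k) = 1 - 1/2 * (13/2) * (1 / (real n + 1))
                 - (1/2)^2 * (67/8) * (1 / (real n * (real n + 1)))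
                 - (1/2)^3 * (5177/48) * (1 / ((real n - 1) * real n * (real n + 1)))"
      proof -
        have "(\<Sum>k<4. t k) = t 0 + t 1 + t 2 + t 3" by (simp add: eval_nat_numeral)
        moreover have "t 0 = 1" by (simp add: t_def c_low)
        moreover have "t 1 = - (1/2 * (13/2) * (1 / (real n + 1)))"
          unfolding t_def c_low by simp
        moreover have "t 2 = - ((1/2)^2 * (67/8) * (1 / (real n * (real n + 1))))"
          unfolding t_def c_low by (simp add: eval_nat_numeral mult_ac)
        moreover have "t 3 = - ((1/2)^3 * (5177/48) * (1 / ((real n - 1) * real n * (real n + 1))))"
          unfolding t_def c_low by (simp add: eval_nat_numeral mult_ac)
        ultimately show ?thesis by simp
      qed
      finally show ?case unfolding t_def G[symmetric] stokes_def by (simp only: mult.assoc)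
    qed
    from landau_o.big.in_cong[THEN iffD1, OF this main]
    have "(\<lambda>n. (1 - z_vertex) $ n
            - exp (-5/2) / pi * (1/2) powr (- real n - 2) * Gamma (real n + 2) *
              (1 - 1/2 * (13/2) * (1 / (real n + 1))
                 - (1/2)^2 * (67/8) * (1 / (real n * (real n + 1)))
                 - (1/2)^3 * (5177/48) * (1 / ((real n - 1) * real n * (real n + 1)))
                 + (\<Sum>k=4..<R. (1/2)^k * c k * (1 / (\<Prod>i<k. real n + 1 - real i))))) \<in> O(\<lambda>n. growth (n - R))" .
    moreover have "(\<lambda>n. growth (n - R)) \<in> O(\<lambda>n. (1/2) powr (- real n - 2) * Gamma (real n + 2) * (1 / real n ^ R))"
      unfolding G
    proof (rule landau_o.bigI[of 1])
      show "\<forall>\<^sub>F n in sequentially. norm (growth (n - R)) \<le> 1 * norm (4 * growth n * (1 / real n ^ R))"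
        \<comment> \<open>From \<open>n >= 2 * R\<close> on, each of the \<open>R\<close> factors
          between \<open>growth (n - R)\<close> and \<open>growth n\<close> is at least
          \<open>n\<close>.\<close>
        using eventually_gt_at_top[of "2 * R"]
      proof eventually_elim
        case (elim n)
        have "real n ^ R * growth (n - R) \<le> growth n" using elim by (intro growth_prod_ge[of R]) auto
        also have "\<dots> \<le> 4 * growth n" by simp
        finally show ?case using elim by (simp add: field_simps)
      qed
    qed simp
    ultimately show ?thesis by (rule landau_o.big_trans)
  qed
  show ?thesis using c_low 1 2 by (intro exI[of _ c]) blast
qed

end
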